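(* Let an endpoint-local monotone rule run on a finite simple graph $G=(V,E)$ with $|V|\ge2$ and $m=|E|\ge1$. Initialize the tag at a profile $x$ according to $$\mathbb{P}(J_0=w\mid X_0=x)=\frac{\lambda_w(x)}m\qquad(w\in V).$$ Condition on the initial profile, the event times, and the selected base vertices (the vertices receiving the balls in the base process $X$), but not on the hidden edge marks. There is an auxiliary process $(B_h)_{h\ge0}$ on $\mathcal{M}=E\times(0,1)$ such that $$\bigl(\sigma_{X^{[h]}}(B_h)\bigr)_{h\ge0}$$ has the same conditional law as the event-indexed discrepancy tag $(J_h)_{h\ge0}$. The initial mark $B_0$ has law $\rho$, and each transition of $B$ is given by a Markov kernel acting on $L^2(\rho)$ as an orthogonal conditional-expectation projection (conditional expectation onto a sub-$\sigma$-algebra). The transition preserves $\rho$ and acts nontrivially only on edge fibers incident to the closed neighborhood of the selected vertex. Consequently, at every physical time $t\ge0$, $$\mathbb{P}(J_t=w\mid\text{selected base path})=\frac{\lambda_w(X_t)}m\qquad(w\in V),$$ and for every $x\in\mathbb{Z}^V$ and every bounded measurable function $F$ of a profile and a tag, $$\sum_{v\in V}\lambda_v(x)\,\mathbb{E}_{x,v}F(X_t,J_t)=\mathbb{E}_x\sum_{w\in V}\lambda_w(X_t)F(X_t,w).$$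
   Context: Load vectors (profiles) are elements $x\in\mathbb{Z}^V$; $e_w$ is the standard basis vector at $w$. An endpoint-local monotone rule on $G$ is given by, for each edge $e\in E$, a fixed orientation $(u,v)$ of $e$ and a nonincreasing function $p_e:\mathbb{Z}\to[0,1]$ (the functions may differ between edges; constants allowed). The edges ring according to independent rate-one Poisson processes. When $e$ with orientation $(u,v)$ rings and the current load vector is $x$, a fresh independent $U$ uniform on $(0,1)$ is drawn, and one ball is added to the selected endpoint, which is $u$ if $U\le p_e(x_u-x_v)$ and $v$ otherwise. $X_t$ is the load vector at time $t$; $X^{[h]}$ is the load vector after exactly $h$ allocation events. $\lambda_w(x)$ is the total rate at which vertex $w$ receives a ball in profile $x$; $\sum_w\lambda_w(x)=m$. $\mathbb{E}_x$ is expectation for the process started at $X_0=x$. Marked edge space: $\mathcal{M}=E\times(0,1)$, and $\rho$ is the probability measure on $\mathcal{M}$ assigning mass $1/m$ to each edge fiber $\{e\}\times(0,1)$ and being (normalized) Lebesgue measure within each fiber. For a mark $a=(e,U)\in\mathcal{M}$, $\sigma_x(a)$ is the endpoint of $e$ selected by the rule at profile $x$ with uniform variable $U$. An edge fiber is incident to a vertex set if its edge has an endpoint in that set; the closed neighborhood of $j$ is $N[j]=\{j\}\cup\{\text{neighbors of }j\}$; acting trivially on a fiber means leaving each mark in it fixed. Tag: run two copies of the process from $x$ and $x+e_v$ with the same clocks and the same marks $U$ (the copy from $x$ is the base process $X$). At every time their difference (second minus first) is $e_{J}$ for a single vertex $J$, the tag, with $J_0=v$. $J_t$ is the tag at physical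 time $t$, $J_h$ the tag after exactly $h$ allocation events (so $J_t=J_{N_t}$, with $N_t$ the number of events by time $t$). $\mathbb{E}_{x,v}$ is expectation under this coupling. When $J_0$ is random, it is chosen, given $X_0$, independently of the future clocks and marks. "Selected base path" means the initial profile, event times and selected base vertices. *)

theory Defs
  imports "HOL-Probability.Probability"
begin

text \<open>
  The vertex set is the whole finite type \<open>'v\<close>; edges are two-element vertex sets.  A rule
  consists of an orientation \<open>ori e = (u, v)\<close> of each edge together with the functions \<open>p e\<close>.
  Profiles \<open>'v \<Rightarrow> int\<close> form a countable type and carry the discrete sigma-algebra.
\<close>

type_synonym 'v profile = "'v \<Rightarrow> int"
type_synonym 'v mark = "'v set \<times> real"

definition simple_graph :: "'v set set \<Rightarrow> bool" where
  "simple_graph E \<longleftrightarrow> (\<forall>e\<in>E. card e = 2)"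

definition closed_nbhd :: "'v set set \<Rightarrow> 'v \<Rightarrow> 'v set" where
  "closed_nbhd E j = {j} \<union> {w. {j, w} \<in> E}"

definition endpoint_local_monotone_rule ::
    "'v set set \<Rightarrow> ('v set \<Rightarrow> 'v \<times> 'v) \<Rightarrow> ('v set \<Rightarrow> int \<Rightarrow> real) \<Rightarrow> bool" where
  "endpoint_local_monotone_rule E ori p \<longleftrightarrow>
     (\<forall>e\<in>E. e = {fst (ori e), snd (ori e)} \<and> antimono (p e) \<and> (\<forall>k. 0 \<le> p e k \<and> p e k \<le> 1))"

text \<open>The vertex \<open>\<sigma>\<^sub>x(e, U)\<close>.\<close>

definition sel ::
    "('v set \<Rightarrow> 'v \<times> 'v) \<Rightarrow> ('v set \<Rightarrow> int \<Rightarrow> real) \<Rightarrow> 'v profile \<Rightarrow> 'v mark \<Rightarrow> 'v" where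
  "sel ori p x a =
     (case a of (e, U) \<Rightarrow>
        if U \<le> p e (x (fst (ori e)) - x (snd (ori e))) then fst (ori e) else snd (ori e))"

definition add_ball :: "'v profile \<Rightarrow> 'v \<Rightarrow> 'v profile" where
  "add_ball x w = x(w := x w + 1)"

text \<open>\<open>\<lambda>\<^sub>w(x)\<close>: every edge rings at rate one and then selects \<open>w\<close> with the probability summed here.\<close>

definition rate ::
    "'v set set \<Rightarrow> ('v set \<Rightarrow> 'v \<times> 'v) \<Rightarrow> ('v set \<Rightarrow> int \<Rightarrow> real) \<Rightarrow> 'v profile \<Rightarrow> 'v \<Rightarrow> real" where
  "rate E ori p x w = (\<Sum>e\<in>E. measure lborel {U \<in> {0<..<1}. sel ori p x (e, U) = w})"

definition unit_uniform :: "real measure" where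
  "unit_uniform = restrict_space lborel {0<..<1}"

text \<open>The law \<open>\<rho>\<close> on \<open>E \<times> (0, 1)\<close>; its space is exactly this set.\<close>

definition mark_law :: "'v set set \<Rightarrow> 'v mark measure" where
  "mark_law E = uniform_count_measure E \<Otimes>\<^sub>M unit_uniform"

text \<open>
  The driving randomness is a pair \<open>(\<xi>, U)\<close>.  The clock of \<open>e\<close> is the rate-one Poisson process
  with independent Exp(1) waiting times \<open>\<xi> (e, 0), \<xi> (e, 1), \<dots>\<close>, independently over edges, and
  \<open>U h\<close> is the fresh uniform variable used at the \<open>(h + 1)\<close>-st allocation event overall.
\<close>

type_synonym 'v driving = "('v set \<times> nat \<Rightarrow> real) \<times> (nat \<Rightarrow> real)"

definition driving_law :: "'v set set \<Rightarrow> 'v driving measure" where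
  "driving_law E =
     (\<Pi>\<^sub>M i\<in>E \<times> UNIV. density lborel (\<lambda>s. ennreal (exponential_density 1 s)))
       \<Otimes>\<^sub>M (\<Pi>\<^sub>M h\<in>UNIV. unit_uniform)"

definition ring_time :: "('v set \<times> nat \<Rightarrow> real) \<Rightarrow> 'v set \<Rightarrow> nat \<Rightarrow> real" where
  "ring_time \<xi> e n = (\<Sum>k\<le>n. \<xi> (e, k))"

text \<open>
  Superposition of the clocks.  If edge \<open>e\<close> has rung \<open>c e\<close> times so far, the next edge to ring is
  the one minimising \<open>ring_time \<xi> e (c e)\<close>; ties have probability zero.
  Allocation events are numbered from 0, so that event \<open>h\<close> leads from \<open>X\<^sup>[\<^sup>h\<^sup>]\<close> to \<open>X\<^sup>[\<^sup>h\<^sup>+\<^sup>1\<^sup>]\<close>.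
\<close>

definition next_edge ::
    "'v set set \<Rightarrow> ('v set \<times> nat \<Rightarrow> real) \<Rightarrow> ('v set \<Rightarrow> nat) \<Rightarrow> 'v set" where
  "next_edge E \<xi> c = arg_min (\<lambda>e. ring_time \<xi> e (c e)) (\<lambda>e. e \<in> E)"

primrec ring_counts ::
    "'v set set \<Rightarrow> ('v set \<times> nat \<Rightarrow> real) \<Rightarrow> nat \<Rightarrow> 'v set \<Rightarrow> nat" where
  "ring_counts E \<xi> 0 = (\<lambda>e. 0)"
| "ring_counts E \<xi> (Suc h) =
     (let c = ring_counts E \<xi> h; e = next_edge E \<xi> c in c(e := Suc (c e)))"

definition event_edge :: "'v set set \<Rightarrow> 'v driving \<Rightarrow> nat \<Rightarrow> 'v set" where
  "event_edge E d h = next_edge E (fst d) (ring_counts E (fst d) h)"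

definition event_time :: "'v set set \<Rightarrow> 'v driving \<Rightarrow> nat \<Rightarrow> real" where
  "event_time E d h =
     ring_time (fst d) (event_edge E d h) (ring_counts E (fst d) h (event_edge E d h))"

definition event_mark :: "'v set set \<Rightarrow> 'v driving \<Rightarrow> nat \<Rightarrow> 'v mark" where
  "event_mark E d h = (event_edge E d h, snd d h)"

definition num_events :: "'v set set \<Rightarrow> 'v driving \<Rightarrow> real \<Rightarrow> nat" where
  "num_events E d t = card {h. event_time E d h \<le> t}"

text \<open>\<open>load E ori p x d h\<close> is \<open>X\<^sup>[\<^sup>h\<^sup>]\<close> for the process started at \<open>x\<close> and driven by \<open>d\<close>.\<close>

primrec load ::
    "'v set set \<Rightarrow> ('v set \<Rightarrow> 'v \<times> 'v) \<Rightarrow> ('v set \<Rightarrow> int \<Rightarrow> real) \<Rightarrow>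
      'v profile \<Rightarrow> 'v driving \<Rightarrow> nat \<Rightarrow> 'v profile" where
  "load E ori p x d 0 = x"
| "load E ori p x d (Suc h) =
     add_ball (load E ori p x d h) (sel ori p (load E ori p x d h) (event_mark E d h))"

definition selected ::
    "'v set set \<Rightarrow> ('v set \<Rightarrow> 'v \<times> 'v) \<Rightarrow> ('v set \<Rightarrow> int \<Rightarrow> real) \<Rightarrow>
      'v profile \<Rightarrow> 'v driving \<Rightarrow> nat \<Rightarrow> 'v" where
  "selected E ori p x d h = sel ori p (load E ori p x d h) (event_mark E d h)"

text \<open>The tag: the copy started at \<open>x + e\<^sub>v\<close> exceeds the base copy by one ball, at the tag.\<close>

definition tag ::
    "'v set set \<Rightarrow> ('v set \<Rightarrow> 'v \<times> 'v) \<Rightarrow> ('v set \<Rightarrow> int \<Rightarrow> real) \<Rightarrow>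
      'v profile \<Rightarrow> 'v \<Rightarrow> 'v driving \<Rightarrow> nat \<Rightarrow> 'v" where
  "tag E ori p x v d h =
     (THE w. load E ori p (add_ball x v) d h = add_ball (load E ori p x d h) w)"

definition load_at ::
    "'v set set \<Rightarrow> ('v set \<Rightarrow> 'v \<times> 'v) \<Rightarrow> ('v set \<Rightarrow> int \<Rightarrow> real) \<Rightarrow>
      'v profile \<Rightarrow> 'v driving \<Rightarrow> real \<Rightarrow> 'v profile" where
  "load_at E ori p x d t = load E ori p x d (num_events E d t)"

definition tag_at ::
    "'v set set \<Rightarrow> ('v set \<Rightarrow> 'v \<times> 'v) \<Rightarrow> ('v set \<Rightarrow> int \<Rightarrow> real) \<Rightarrow>
      'v profile \<Rightarrow> 'v \<Rightarrow> 'v driving \<Rightarrow> real \<Rightarrow> 'v" where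
  "tag_at E ori p x v d t = tag E ori p x v d (num_events E d t)"

text \<open>
  Sample space for a random start: points are \<open>((x, v), d)\<close> with initial profile \<open>x\<close> and initial
  tag \<open>v\<close>, drawn jointly from \<open>\<nu>\<close> and independently of the clocks and uniform variables.
\<close>

definition process_law ::
    "('v profile \<times> 'v) pmf \<Rightarrow> 'v set set \<Rightarrow> (('v profile \<times> 'v) \<times> 'v driving) measure" where
  "process_law \<nu> E = measure_pmf \<nu> \<Otimes>\<^sub>M driving_law E"

text \<open>Selected base paths: initial profile, event times, selected vertices.\<close>

type_synonym 'v path = "'v profile \<times> (nat \<Rightarrow> real) \<times> (nat \<Rightarrow> 'v)"

definition path_space :: "'v path measure" where
  "path_space =
     count_space UNIV \<Otimes>\<^sub>M ((\<Pi>\<^sub>M h\<in>UNIV. borel) \<Otimes>\<^sub>M (\<Pi>\<^sub>M h\<in>UNIV. count_space UNIV))"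

definition base_path ::
    "'v set set \<Rightarrow> ('v set \<Rightarrow> 'v \<times> 'v) \<Rightarrow> ('v set \<Rightarrow> int \<Rightarrow> real) \<Rightarrow>
      ('v profile \<times> 'v) \<times> 'v driving \<Rightarrow> 'v path" where
  "base_path E ori p \<omega> =
     (case \<omega> of ((x, v), d) \<Rightarrow> (x, event_time E d, selected E ori p x d))"

text \<open>The profile \<open>X\<^sup>[\<^sup>h\<^sup>]\<close> and the selected vertex of event \<open>h\<close>, read off from the path alone.\<close>

primrec replay :: "'v profile \<Rightarrow> (nat \<Rightarrow> 'v) \<Rightarrow> nat \<Rightarrow> 'v profile" where
  "replay x s 0 = x"
| "replay x s (Suc h) = add_ball (replay x s h) (s h)"

definition path_profile :: "'v path \<Rightarrow> nat \<Rightarrow> 'v profile" where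
  "path_profile \<gamma> h = replay (fst \<gamma>) (snd (snd \<gamma>)) h"

definition path_selected :: "'v path \<Rightarrow> nat \<Rightarrow> 'v" where
  "path_selected \<gamma> h = snd (snd \<gamma>) h"

text \<open>
  \<open>cond_prob_given M Y S P\<close> is a version of the conditional probability of the event \<open>P\<close> given the
  \<open>S\<close>-valued random variable \<open>Y\<close>; \<open>is_cond_law M Y S Z T \<kappa>\<close> says that the probability kernel \<open>\<kappa>\<close>
  is a regular conditional law of the \<open>T\<close>-valued random variable \<open>Z\<close> given \<open>Y\<close>.
\<close>

definition cond_prob_given ::
    "'a measure \<Rightarrow> ('a \<Rightarrow> 'b) \<Rightarrow> 'b measure \<Rightarrow> ('a \<Rightarrow> bool) \<Rightarrow> 'a \<Rightarrow> real" where
  "cond_prob_given M Y S P =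
     real_cond_exp M (vimage_algebra (space M) Y S) (indicat_real {\<omega> \<in> space M. P \<omega>})"

definition is_cond_law ::
    "'a measure \<Rightarrow> ('a \<Rightarrow> 'b) \<Rightarrow> 'b measure \<Rightarrow> ('a \<Rightarrow> 'c) \<Rightarrow> 'c measure \<Rightarrow> ('b \<Rightarrow> 'c measure) \<Rightarrow> bool"
  where
  "is_cond_law M Y S Z T \<kappa> \<longleftrightarrow>
     Y \<in> M \<rightarrow>\<^sub>M S \<and> Z \<in> M \<rightarrow>\<^sub>M T \<and> \<kappa> \<in> S \<rightarrow>\<^sub>M prob_algebra T \<and>
     (\<forall>A\<in>sets T. AE \<omega> in M. cond_prob_given M Y S (\<lambda>\<omega>. Z \<omega> \<in> A) \<omega> = measure (\<kappa> (Y \<omega>)) A)"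

text \<open>
  \<open>L\<close> is the law of a (time-inhomogeneous) Markov chain with state space \<open>M\<close>, initial law \<open>\<mu>\<close>
  and kernel \<open>K h\<close> for the transition from time \<open>h\<close> to time \<open>h + 1\<close>; the chain is the coordinate
  process, and its past up to time \<open>h\<close> is the restriction of the trajectory to \<open>{..h}\<close>.
\<close>

definition markov_chain_law ::
    "'a measure \<Rightarrow> 'a measure \<Rightarrow> (nat \<Rightarrow> 'a \<Rightarrow> 'a measure) \<Rightarrow> (nat \<Rightarrow> 'a) measure \<Rightarrow> bool" where
  "markov_chain_law M \<mu> K L \<longleftrightarrow>
     L \<in> space (prob_algebra (\<Pi>\<^sub>M h\<in>UNIV. M)) \<and>
     distr L M (\<lambda>b. b 0) = \<mu> \<and>
     (\<forall>h. \<forall>A\<in>sets (\<Pi>\<^sub>M k\<in>{..h}. M). \<forall>C\<in>sets M.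
        measure L {b \<in> space L. restrict b {..h} \<in> A \<and> b (Suc h) \<in> C} =
        (\<integral>b. indicat_real A (restrict b {..h}) * measure (K h (b h)) C \<partial>L))"

text \<open>
  A Markov kernel acting on \<open>L\<^sup>2(\<rho>)\<close> as the conditional expectation onto some sub-sigma-algebra.
\<close>

definition acts_as_cond_exp :: "'a measure \<Rightarrow> ('a \<Rightarrow> 'a measure) \<Rightarrow> bool" where
  "acts_as_cond_exp \<rho> K \<longleftrightarrow>
     (\<exists>F. subalgebra \<rho> F \<and>
       (\<forall>f\<in>borel_measurable \<rho>. integrable \<rho> (\<lambda>a. (f a :: real)\<^sup>2) \<longrightarrow>
          (AE a in \<rho>. integrable (K a) f \<and> (\<integral>b. f b \<partial>K a) = real_cond_exp \<rho> F f a)))"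

end

theory Submission
  imports Defs
begin

text \<open>
  If the tag sits at \<open>j\<close> and the base process selects \<open>j\<close> at profile \<open>x\<close>, the tag moves to the
  vertex which the same mark selects at \<open>x + e\<^sub>j\<close>; by monotonicity it stays put in all other cases.
  Likewise a mark that does not select \<open>j\<close> at \<open>x\<close> selects the same vertex at \<open>x\<close> and at \<open>x + e\<^sub>j\<close>.
  By memorylessness of the clocks the event marks are i.i.d. with law \<open>\<rho>\<close> and independent of the
  event times, so given the base path the hidden marks are independent with law
  \<open>\<rho>(\<cdot> | \<sigma>\<^sub>x = j)\<close>.  Hence the tag moves like \<open>\<sigma>\<close> of an auxiliary mark that is resampled from
  \<open>\<rho>(\<cdot> | \<sigma>\<^sub>x = j)\<close> whenever it selects the vertex \<open>j\<close> chosen by the base process.  This resampling is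
  the conditional expectation onto the sets that contain or avoid \<open>{\<sigma>\<^sub>x = j}\<close>; it preserves \<open>\<rho>\<close>,
  so at every time the tag has law \<open>\<lambda>\<^sub>w(X) / m\<close> given the path.
\<close>

text \<open>The argument rests on a coincidence: when \<open>j\<close> is selected at
  \<open>x\<close>, the next base profile is \<open>add_ball x j\<close>, which is also the profile
  at which the second copy evaluates the mark if the tag sits at \<open>j\<close>. So reading a
  resampled mark at the next base profile gives the new tag vertex, and reading an unchanged mark
  there gives the old one. The vertex read off from the auxiliary mark is therefore itself Markov,
  with the transition probabilities \<open>trans_prob\<close> of the tag. Laws are compared on
  cylinders, which fix finitely many selections and tag positions but allow any event on the whole
  sequence of event times; there both sides are products. An equality of joint laws of path and tag
  is required, because at a physical time the index at which the tag is read is a function of the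
  path. The clocks are given as a race of explicit waiting times, so the independence of times and
  edges has to be extracted by restarting the clocks after the first ring. The auxiliary chain is
  built from independent marks drawn in advance, one for each possible resampling.\<close>

lemma arg_min_cong:
  assumes "\<And>x y. P x \<Longrightarrow> P y \<Longrightarrow> f x < f y \<longleftrightarrow> g x < g y"
  shows "arg_min f P = arg_min g P"
proof -
  have "is_arg_min f P = is_arg_min g P"
    using assms by (auto simp: is_arg_min_def fun_eq_iff)
  then show ?thesis by (simp add: arg_min_def)
qed

lemma arg_min_in_finite:
  fixes f :: "'a \<Rightarrow> 'b::linorder"
  assumes "finite A" "A \<noteq> {}"
  shows "arg_min f (\<lambda>x. x \<in> A) \<in> A" "\<And>y. y \<in> A \<Longrightarrow> f (arg_min f (\<lambda>x. x \<in> A)) \<le> f y"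
  using arg_min_if_finite[OF assms, of f] by (auto simp: arg_min_on_def not_less)

lemma add_ball_inject: "add_ball x v = add_ball x w \<longleftrightarrow> v = w"
proof
  assume "add_ball x v = add_ball x w"
  then have "add_ball x v v = add_ball x w v" by simp
  then show "v = w" by (auto simp: add_ball_def split: if_splits)
qed simp

lemma add_ball_commute: "add_ball (add_ball x v) w = add_ball (add_ball x w) v"
  by (auto simp: add_ball_def)

lemma replay_cong: "(\<And>i. i < h \<Longrightarrow> s i = s' i) \<Longrightarrow> replay x s h = replay x s' h"
  by (induction h) simp_all

section \<open>The coupled copies and the recursion of the tag\<close>

locale local_rule =
  fixes E :: "'v::finite set set"
    and ori :: "'v set \<Rightarrow> 'v \<times> 'v"
    and p :: "'v set \<Rightarrow> int \<Rightarrow> real"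
  assumes graph: "simple_graph E"
    and edges_ne: "E \<noteq> {}"
    and rule: "endpoint_local_monotone_rule E ori p"
begin

abbreviation "\<sigma> \<equiv> sel ori p"

lemma ori_edge:
  assumes "e \<in> E"
  shows "e = {fst (ori e), snd (ori e)}" "fst (ori e) \<noteq> snd (ori e)"
proof -
  show "e = {fst (ori e), snd (ori e)}"
    using rule assms by (auto simp: endpoint_local_monotone_rule_def)
  then have "card {fst (ori e), snd (ori e)} = 2" using graph assms by (simp add: simple_graph_def)
  then show "fst (ori e) \<noteq> snd (ori e)" by auto
qed

lemma antimono_rule: "e \<in> E \<Longrightarrow> k \<le> l \<Longrightarrow> p e l \<le> p e k"
  using rule by (auto simp: endpoint_local_monotone_rule_def antimono_def)

lemma sel_in_edge: "e \<in> E \<Longrightarrow> \<sigma> x (e, U) \<in> e"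
  using ori_edge(1)[of e] by (auto simp: sel_def)

text \<open>An extra ball at \<open>j\<close> moves the load difference of an edge at
  \<open>j\<close> in the direction in which the nonincreasing \<open>p e\<close> makes
  \<open>j\<close> less likely, so a mark that already picked the other endpoint keeps it. An edge
  away from \<open>j\<close> sees the same difference.\<close>

lemma sel_add_ball:
  assumes "fst a \<in> E" "\<sigma> x a \<noteq> j"
  shows "\<sigma> (add_ball x j) a = \<sigma> x a"
proof -
  obtain e U where a: "a = (e, U)" by force
  have e: "e \<in> E" using assms a by simp
  let ?u = "fst (ori e)" and ?v = "snd (ori e)"
  have mono: "p e (x ?u - x ?v) \<le> p e (x ?u - (x ?v + 1))"
             "p e (x ?u + 1 - x ?v) \<le> p e (x ?u - x ?v)"
    using antimono_rule[OF e] by auto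
  show ?thesis
    using assms(2) ori_edge(2)[OF e] mono by (auto simp: a sel_def add_ball_def split: if_splits)
qed

text \<open>If the base copy selects another vertex, so does the second copy, and the difference
  stays at \<open>w\<close>. If the base copy selects \<open>w\<close>, it catches up there, and the
  new discrepancy is wherever the second copy puts its own ball.\<close>

definition tag_step :: "'v profile \<Rightarrow> 'v \<Rightarrow> 'v mark \<Rightarrow> 'v" where
  "tag_step x w a = (if \<sigma> x a = w then \<sigma> (add_ball x w) a else w)"

lemma finite_edges: "finite E" by simp

lemma next_edge_in: "next_edge E \<xi> c \<in> E"
  unfolding next_edge_def using arg_min_in_finite(1)[OF finite_edges edges_ne] by fastforce

lemma next_edge_min: "e \<in> E \<Longrightarrow> ring_time \<xi> (next_edge E \<xi> c) (c (next_edge E \<xi> c)) \<le> ring_time \<xi> e (c e)"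
  unfolding next_edge_def
  using arg_min_in_finite(2)[OF finite_edges edges_ne, where f = "\<lambda>e. ring_time \<xi> e (c e)"] by fastforce

lemma event_edge_in: "event_edge E d h \<in> E"
  by (simp add: event_edge_def next_edge_in)

primrec tag_rec :: "'v profile \<Rightarrow> 'v \<Rightarrow> 'v driving \<Rightarrow> nat \<Rightarrow> 'v" where
  "tag_rec x v d 0 = v"
| "tag_rec x v d (Suc h) = tag_step (load E ori p x d h) (tag_rec x v d h) (event_mark E d h)"

text \<open>This supplies the existence half of the definite description in \<open>tag\<close>;
  uniqueness is \<open>add_ball_inject\<close>. From here on the tag is a recursion driven by the
  base profile and the marks.\<close>

lemma load_add_ball:
  "load E ori p (add_ball x v) d h = add_ball (load E ori p x d h) (tag_rec x v d h)"
proof (induction h)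
  case (Suc h)
  let ?y = "load E ori p x d h" and ?w = "tag_rec x v d h" and ?a = "event_mark E d h"
  have a: "fst ?a \<in> E" by (simp add: event_mark_def event_edge_in)
  show ?case
  proof (cases "\<sigma> ?y ?a = ?w")
    case True
    then show ?thesis by (simp add: Suc.IH tag_step_def)
  next
    case False
    then show ?thesis using sel_add_ball[OF a False] by (simp add: Suc.IH tag_step_def add_ball_commute)
  qed
qed simp

lemma tag_eq_rec: "tag E ori p x v d = tag_rec x v d"
  by (rule ext) (simp add: tag_def load_add_ball add_ball_inject)

lemma tag_0: "tag E ori p x v d 0 = v"
  and tag_Suc: "tag E ori p x v d (Suc h) =
    tag_step (load E ori p x d h) (tag E ori p x v d h) (event_mark E d h)"
  by (simp_all add: tag_eq_rec)

lemma load_eq_replay: "load E ori p x d h = replay x (selected E ori p x d) h"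
  by (induction h) (simp_all add: selected_def)

end

subsection \<open>Superposition of the clocks\<close>

abbreviation clock_law :: "'v set set \<Rightarrow> ('v set \<times> nat \<Rightarrow> real) measure" where
  "clock_law E \<equiv> \<Pi>\<^sub>M i\<in>E \<times> UNIV. density lborel (\<lambda>s. ennreal (exponential_density 1 s))"

lemma measurable_compose_discrete:
  "f \<in> M \<rightarrow>\<^sub>M count_space UNIV \<Longrightarrow> (\<lambda>x. g (f x)) \<in> M \<rightarrow>\<^sub>M count_space UNIV"
  using measurable_compose[of f M "count_space UNIV" g "count_space UNIV"] by simp

text \<open>\<open>arg_min\<close> is a Hilbert choice, but it depends on \<open>x\<close> only
  through the set of minimisers, which ranges over the finitely many subsets of \<open>I\<close>.
  Hence ties do no harm to measurability.\<close>

lemma measurable_arg_min: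
  fixes f :: "'a \<Rightarrow> 'b \<Rightarrow> real"
  assumes I: "finite I" and f: "\<And>i. i \<in> I \<Longrightarrow> f i \<in> borel_measurable M"
  shows "(\<lambda>x. arg_min (\<lambda>i. f i x) (\<lambda>i. i \<in> I)) \<in> M \<rightarrow>\<^sub>M count_space UNIV"
proof -
  note f[measurable]
  define S where "S x = {i \<in> I. \<forall>j\<in>I. f i x \<le> f j x}" for x
  have "S \<in> M \<rightarrow>\<^sub>M count_space (Pow I)"
  proof (subst measurable_count_space_eq2)
    show "finite (Pow I)" using I by simp
    show "S \<in> space M \<rightarrow> Pow I \<and> (\<forall>a\<in>Pow I. S -` {a} \<inter> space M \<in> sets M)"
    proof safe
      fix A assume "A \<subseteq> I"
      have eq: "S -` {A} \<inter> space M = {x \<in> space M. \<forall>i\<in>I. (\<forall>j\<in>I. f i x \<le> f j x) \<longleftrightarrow> i \<in> A}"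
        using \<open>A \<subseteq> I\<close> unfolding S_def by blast
      have "{x \<in> space M. (\<forall>j\<in>I. f i x \<le> f j x) \<longleftrightarrow> i \<in> A} \<in> sets M" if i: "i \<in> I" for i
      proof -
        have [measurable]: "f i \<in> borel_measurable M" using f i .
        have "{x \<in> space M. \<forall>j\<in>I. f i x \<le> f j x} \<in> sets M"
          using I i by (intro sets.sets_Collect_finite_All') (auto simp: borel_measurable_le[OF f[OF i] f])
        from this sets.sets_Collect_neg[OF this] show ?thesis by (cases "i \<in> A") simp_all
      qed
      then show "S -` {A} \<inter> space M \<in> sets M"
        unfolding eq using I by (intro sets.sets_Collect_finite_All) auto
    qed (auto simp: S_def)
  qed
  then have "(\<lambda>x. SOME i. i \<in> S x) \<in> M \<rightarrow>\<^sub>M count_space UNIV"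
    by (rule measurable_compose) simp
  moreover have "(SOME i. i \<in> S x) = arg_min (\<lambda>i. f i x) (\<lambda>i. i \<in> I)" for x
    by (simp add: S_def arg_min_def is_arg_min_def not_less Ball_def)
  ultimately show ?thesis by simp
qed

context local_rule
begin

lemma measurable_ring_time:
  "e \<in> E \<Longrightarrow> (\<lambda>\<xi>. ring_time \<xi> e n) \<in> borel_measurable (clock_law E)"
  unfolding ring_time_def
  by (intro borel_measurable_sum measurable_compose[OF measurable_component_singleton]) auto

lemma measurable_next_edge: "(\<lambda>\<xi>. next_edge E \<xi> c) \<in> clock_law E \<rightarrow>\<^sub>M count_space UNIV"
  unfolding next_edge_def by (intro measurable_arg_min measurable_ring_time) simp_all

text \<open>Count vectors are functions on the finite type of vertex sets and so form a countable
  type; the current vector can be held fixed and the pieces recombined over countably many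
  values.\<close>

lemma measurable_ring_counts: "(\<lambda>\<xi>. ring_counts E \<xi> h) \<in> clock_law E \<rightarrow>\<^sub>M count_space UNIV"
proof (induction h)
  case (Suc h)
  have "(\<lambda>\<xi>. c(next_edge E \<xi> c := Suc (c (next_edge E \<xi> c)))) \<in> clock_law E \<rightarrow>\<^sub>M count_space UNIV" for c
    by (rule measurable_compose_discrete[OF measurable_next_edge, where g = "\<lambda>e. c(e := Suc (c e))"])
  from measurable_compose_countable[OF this Suc.IH] show ?case unfolding ring_counts.simps Let_def .
qed simp

lemma measurable_event_edge: "(\<lambda>\<xi>. event_edge E (\<xi>, U) h) \<in> clock_law E \<rightarrow>\<^sub>M count_space UNIV"
  using measurable_compose_countable[OF measurable_next_edge measurable_ring_counts]
  by (simp add: event_edge_def)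

lemma measurable_event_time: "(\<lambda>\<xi>. event_time E (\<xi>, U) h) \<in> borel_measurable (clock_law E)"
proof -
  have 1: "(\<lambda>\<xi>. ring_time \<xi> e (ring_counts E \<xi> h e)) \<in> borel_measurable (clock_law E)" if "e \<in> E" for e
    using measurable_compose_countable[OF measurable_ring_time[OF that] 
        measurable_compose[OF measurable_ring_counts[of h], of "\<lambda>c. c e"]] by simp
  have 2: "(\<lambda>\<xi>. event_edge E (\<xi>, U) h) \<in> clock_law E \<rightarrow>\<^sub>M count_space E"
    by (rule measurable_count_space_extend[OF _ _ measurable_event_edge]) (auto simp: event_edge_in)
  show ?thesis
    using measurable_compose_countable'[OF 1 2] by (simp add: event_time_def)
qed

end

section \<open>Memorylessness of the exponential clocks\<close>

abbreviation exp1 :: "real measure" where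
  "exp1 \<equiv> density lborel (\<lambda>s. ennreal (exponential_density 1 s))"

lemma prob_space_exp1: "prob_space exp1"
  by (rule prob_space_exponential_density) simp

lemma AE_exp1_nonneg: "AE s in exp1. 0 \<le> s"
  by (subst AE_density) (auto simp: exponential_density_def)

lemma emeasure_exp1_memoryless:
  assumes s: "0 \<le> s" and A: "A \<in> sets borel" and I: "I = {0<..} \<or> I = {0::real..}"
  shows "emeasure exp1 {y. y - s \<in> I \<and> y - s \<in> A} = ennreal (exp (- s)) * emeasure exp1 A"
proof -
  note A[measurable]
  have [measurable]: "I \<in> sets borel" using I by auto
  have "emeasure exp1 {y. y - s \<in> I \<and> y - s \<in> A} =
      (\<integral>\<^sup>+y. ennreal (exponential_density 1 y) * indicator {y. y - s \<in> I \<and> y - s \<in> A} y \<partial>lborel)"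
    by (subst emeasure_density) auto
  also have "\<dots> = (\<integral>\<^sup>+z. ennreal (exponential_density 1 (s + 1 * z)) *
      indicator {y. y - s \<in> I \<and> y - s \<in> A} (s + 1 * z) \<partial>lborel)"
    by (subst nn_integral_real_affine[where c = 1 and t = s]) (auto simp: measurable_If)
  also have "\<dots> = (\<integral>\<^sup>+z. ennreal (exp (- s)) * (ennreal (exponential_density 1 z) * indicator A z) \<partial>lborel)"
  proof (rule nn_integral_cong_AE)
    \<comment> \<open>The two choices of \<open>I\<close> differ only at \<open>z = 0\<close>, a
      null point.\<close>
    have "AE z in lborel. z \<noteq> (0::real)" by (rule AE_lborel_singleton)
    then show "AE z in lborel. ennreal (exponential_density 1 (s + 1 * z)) *
        indicator {y. y - s \<in> I \<and> y - s \<in> A} (s + 1 * z) =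
        ennreal (exp (- s)) * (ennreal (exponential_density 1 z) * indicator A z)"
    proof eventually_elim
      case (elim z)
      then show ?case
        using s I by (cases "z < 0") 
          (auto simp: exponential_density_def indicator_def ennreal_mult[symmetric] exp_add[symmetric])
    qed
  qed
  also have "\<dots> = ennreal (exp (- s)) * emeasure exp1 A"
    by (subst nn_integral_cmult) (auto simp: emeasure_density)
  finally show ?thesis .
qed

text \<open>Restricting a measure to an event and pushing it forward is written as
  \<open>distr\<close> of a \<open>density\<close>, so that uniqueness theorems for measures apply
  to laws of total mass below one.\<close>

lemma emeasure_distr_density_indicator:
  assumes [measurable]: "S \<in> sets M" "f \<in> M \<rightarrow>\<^sub>M N" "X \<in> sets N"
  shows "emeasure (distr (density M (indicator S)) N f) X = emeasure M (S \<inter> (f -` X \<inter> space M))"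
proof -
  have "emeasure (distr (density M (indicator S)) N f) X =
      (\<integral>\<^sup>+x. indicator S x * indicator (f -` X \<inter> space M) x \<partial>M)"
    by (subst emeasure_distr) (simp_all add: emeasure_density)
  also have "\<dots> = (\<integral>\<^sup>+x. indicator (S \<inter> (f -` X \<inter> space M)) x \<partial>M)"
    by (simp add: indicator_inter_arith)
  also have "\<dots> = emeasure M (S \<inter> (f -` X \<inter> space M))"
    by (intro nn_integral_indicator) measurable
  finally show ?thesis .
qed

context local_rule
begin

abbreviation "\<Xi> \<equiv> clock_law E"

lemma prob_space_clock: "prob_space \<Xi>"
  by (intro prob_space_PiM prob_space_exp1)

sublocale clock: product_prob_space "\<lambda>_. exp1" "E \<times> UNIV"
  by (intro product_prob_spaceI prob_space_exp1)

definition first_edge :: "('v set \<times> nat \<Rightarrow> real) \<Rightarrow> 'v set" where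
  "first_edge \<xi> = next_edge E \<xi> (\<lambda>_. 0)"

text \<open>The waiting times seen by an observer who restarts at time \<open>s\<close>, when
  \<open>e\<close> has just rung for the first time: \<open>e\<close> drops its first waiting time,
  every other edge keeps only the residual of its own.\<close>

definition shift_clocks :: "'v set \<Rightarrow> real \<Rightarrow> ('v set \<times> nat \<Rightarrow> real) \<Rightarrow> 'v set \<times> nat \<Rightarrow> real" where
  "shift_clocks e s \<xi> = (\<lambda>(e', n)\<in>E \<times> UNIV.
     if e' = e then \<xi> (e, Suc n) else if n = 0 then \<xi> (e', 0) - s else \<xi> (e', n))"

lemma ring_time_shift:
  assumes "e' \<in> E"
  shows "ring_time \<xi> e' (if e' = e then Suc n else n) =
    \<xi> (e, 0) + ring_time (shift_clocks e (\<xi> (e, 0)) \<xi>) e' n"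
proof (cases "e' = e")
  case True
  then show ?thesis using assms by (simp add: ring_time_def shift_clocks_def sum.atMost_Suc_shift del: sum.atMost_Suc)
next
  case False
  then show ?thesis using assms by (induction n) (simp_all add: ring_time_def shift_clocks_def)
qed

text \<open>By \<open>ring_time_shift\<close>, restarting translates all arrival times by one
  constant, so comparisons between them are unchanged. Since \<open>arg_min_cong\<close> equates the
  minimality predicates, the Hilbert choice agrees even at ties.\<close>

lemma next_edge_shift:
  "next_edge E \<xi> (\<lambda>e'. if e' = e then Suc (c e') else c e') =
   next_edge E (shift_clocks e (\<xi> (e, 0)) \<xi>) c"
  unfolding next_edge_def
proof (rule arg_min_cong)
  fix x y assume "x \<in> E" "y \<in> E"
  then show "(ring_time \<xi> x (if x = e then Suc (c x) else c x)
              < ring_time \<xi> y (if y = e then Suc (c y) else c y)) \<longleftrightarrow>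
             (ring_time (shift_clocks e (\<xi> (e, 0)) \<xi>) x (c x)
              < ring_time (shift_clocks e (\<xi> (e, 0)) \<xi>) y (c y))"
    by (simp only: ring_time_shift[where e = e] add_less_cancel_left)
qed

lemma ring_counts_shift:
  assumes "first_edge \<xi> = e"
  shows "ring_counts E \<xi> (Suc h) =
    (\<lambda>e'. if e' = e then Suc (ring_counts E (shift_clocks e (\<xi> (e, 0)) \<xi>) h e')
          else ring_counts E (shift_clocks e (\<xi> (e, 0)) \<xi>) h e')"
proof (induction h)
  case 0
  then show ?case using assms by (auto simp: first_edge_def Let_def)
next
  case (Suc h)
  show ?case
    unfolding ring_counts.simps(2)[of E \<xi> "Suc h"] Let_def Suc.IH next_edge_shift
    by (rule ext) (auto simp: Let_def)
qed

lemma event_edge_0: "event_edge E (\<xi>, U) 0 = first_edge \<xi>"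
  by (simp add: event_edge_def first_edge_def)

lemma event_time_0: "event_time E (\<xi>, U) 0 = \<xi> (first_edge \<xi>, 0)"
  by (simp add: event_time_def event_edge_0 ring_time_def)

lemma event_edge_Suc:
  assumes "first_edge \<xi> = e"
  shows "event_edge E (\<xi>, U) (Suc h) = event_edge E (shift_clocks e (\<xi> (e, 0)) \<xi>, U') h"
  by (simp only: event_edge_def fst_conv ring_counts_shift[OF assms] next_edge_shift)

lemma event_time_Suc:
  assumes "first_edge \<xi> = e"
  shows "event_time E (\<xi>, U) (Suc h) = \<xi> (e, 0) + event_time E (shift_clocks e (\<xi> (e, 0)) \<xi>, U') h"
  unfolding event_time_def fst_conv event_edge_Suc[OF assms, of U h U'] ring_counts_shift[OF assms]
  by (rule ring_time_shift) (rule event_edge_in)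

text \<open>The opposite of dropping the first ring of \<open>e\<close>: its old waiting times move
  up by one place and \<open>s\<close> comes first. This turns the first waiting time into an
  explicit independent variable for Fubini.\<close>

definition insert_clock :: "'v set \<Rightarrow> real \<Rightarrow> ('v set \<times> nat \<Rightarrow> real) \<Rightarrow> 'v set \<times> nat \<Rightarrow> real" where
  "insert_clock e s \<eta> = (\<lambda>(e', n)\<in>E \<times> UNIV.
     if e' = e then (case n of 0 \<Rightarrow> s | Suc k \<Rightarrow> \<eta> (e, k)) else \<eta> (e', n))"

text \<open>All coordinates have the same law, so reindexing along the injection \<open>f\<close>,
  which lowers the index on \<open>e\<close> by one, gives the product law on the indices other than
  \<open>(e, 0)\<close>; the free index then receives the independent \<open>s\<close>.\<close>

lemma distr_insert_clock:
  assumes e: "e \<in> E"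
  shows "distr (exp1 \<Otimes>\<^sub>M \<Xi>) \<Xi> (\<lambda>(s, \<eta>). insert_clock e s \<eta>) = \<Xi>"
proof -
  define I where "I = E \<times> (UNIV :: nat set) - {(e, 0)}"
  define f where "f = (\<lambda>(e', n). if e' = e then (e, n - 1) else (e', n :: nat))"
  have ins: "insert (e, 0) I = E \<times> UNIV" using e by (auto simp: I_def)
  have f: "inj_on f I" "f \<in> I \<rightarrow> E \<times> UNIV"
    using e by (auto simp: inj_on_def f_def I_def split: if_splits prod.splits)
  let ?P = "PiM I (\<lambda>_. exp1)" and ?r = "\<lambda>\<omega>. \<lambda>n\<in>I. \<omega> (f n) :: real"
  have r[measurable]: "?r \<in> \<Xi> \<rightarrow>\<^sub>M ?P"
    using f(2) by (intro measurable_restrict measurable_component_singleton) auto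
  have 1: "distr \<Xi> ?P ?r = ?P"
    using distr_PiM_reindex[of "E \<times> UNIV" "\<lambda>_. exp1" f I] f prob_space_exp1 by simp
  have P: "prob_space ?P" by (intro prob_space_PiM prob_space_exp1)
  interpret P: prob_space ?P by fact
  have u[measurable]: "(\<lambda>(x, X). X((e, 0) := x)) \<in> exp1 \<Otimes>\<^sub>M ?P \<rightarrow>\<^sub>M \<Xi>"
    unfolding ins[symmetric] case_prod_beta by (intro measurable_fun_upd[where J = I]) auto
  have "\<Xi> = distr (exp1 \<Otimes>\<^sub>M ?P) \<Xi> (\<lambda>(x, X). X((e, 0) := x))"
    using distr_pair_PiM_eq_PiM[of I "\<lambda>_. exp1" "(e, 0)"] prob_space_exp1 by (simp add: ins)
  also have "exp1 \<Otimes>\<^sub>M ?P = distr exp1 exp1 (\<lambda>x. x) \<Otimes>\<^sub>M distr \<Xi> ?P ?r"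
    by (simp add: 1)
  also have "\<dots> = distr (exp1 \<Otimes>\<^sub>M \<Xi>) (exp1 \<Otimes>\<^sub>M ?P) (\<lambda>(x, y). (x, ?r y))"
    by (intro pair_measure_distr) (auto simp: 1 P.sigma_finite_measure_axioms intro: r)
  also have "distr \<dots> \<Xi> (\<lambda>(x, X). X((e, 0) := x)) =
      distr (exp1 \<Otimes>\<^sub>M \<Xi>) \<Xi> ((\<lambda>(x, X). X((e, 0) := x)) \<circ> (\<lambda>(x, y). (x, ?r y)))"
    by (rule distr_distr[OF u]) measurable
  also have "(\<lambda>(x, X). X((e, 0) := x)) \<circ> (\<lambda>(x, y). (x, ?r y)) = (\<lambda>(s, \<eta>). insert_clock e s \<eta>)"
    using e by (auto simp: fun_eq_iff insert_clock_def f_def I_def split: nat.splits)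
  finally show ?thesis by simp
qed

lemma measurable_insert_clock:
  assumes e: "e \<in> E"
  shows "(\<lambda>(s, \<eta>). insert_clock e s \<eta>) \<in> exp1 \<Otimes>\<^sub>M \<Xi> \<rightarrow>\<^sub>M \<Xi>"
  unfolding insert_clock_def case_prod_beta
proof (rule measurable_restrict)
  fix i :: "'v set \<times> nat" assume i: "i \<in> E \<times> UNIV"
  obtain e' n where "i = (e', n)" by force
  then show "(\<lambda>x. if fst i = e then case snd i of 0 \<Rightarrow> fst x | Suc k \<Rightarrow> snd x (e, k)
       else snd x (fst i, snd i)) \<in> exp1 \<Otimes>\<^sub>M \<Xi> \<rightarrow>\<^sub>M exp1"
    using i e by (cases n) (auto intro!: measurable_compose[OF measurable_snd measurable_component_singleton])
qed

definition subtract_clocks :: "'v set \<Rightarrow> real \<Rightarrow> ('v set \<times> nat \<Rightarrow> real) \<Rightarrow> 'v set \<times> nat \<Rightarrow> real" where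
  "subtract_clocks e s \<eta> = (\<lambda>(e', n)\<in>E \<times> UNIV.
     if e' \<noteq> e \<and> n = 0 then \<eta> (e', n) - s else \<eta> (e', n))"

lemma shift_insert_clock: "shift_clocks e s (insert_clock e s \<eta>) = subtract_clocks e s \<eta>"
  by (auto simp: shift_clocks_def insert_clock_def subtract_clocks_def fun_eq_iff restrict_def)

lemma measurable_subtract_clocks: "subtract_clocks e s \<in> \<Xi> \<rightarrow>\<^sub>M \<Xi>"
  unfolding subtract_clocks_def case_prod_beta
proof (rule measurable_restrict)
  fix i :: "'v set \<times> nat" assume i: "i \<in> E \<times> UNIV"
  then have "(\<lambda>x. x (fst i, snd i)) \<in> borel_measurable \<Xi>"
    using measurable_component_singleton[of i "E \<times> UNIV" "\<lambda>_. exp1"] by simp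
  then show "(\<lambda>x. if fst i \<noteq> e \<and> snd i = 0 then x (fst i, snd i) - s else x (fst i, snd i)) \<in> \<Xi> \<rightarrow>\<^sub>M exp1"
    by (auto simp del: prod.collapse)
qed

lemma measurable_shift_clocks:
  assumes e: "e \<in> E"
  shows "(\<lambda>\<xi>. shift_clocks e (\<xi> (e, 0)) \<xi>) \<in> \<Xi> \<rightarrow>\<^sub>M \<Xi>"
  unfolding shift_clocks_def case_prod_beta
proof (rule measurable_restrict)
  fix i :: "'v set \<times> nat" assume i: "i \<in> E \<times> UNIV"
  have "(\<lambda>x. x j) \<in> borel_measurable \<Xi>" if "j \<in> E \<times> UNIV" for j
    using measurable_component_singleton[OF that, of "\<lambda>_. exp1"] by simp
  then show "(\<lambda>x. if fst i = e then x (e, Suc (snd i)) else if snd i = 0 then x (fst i, 0) - x (e, 0)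
      else x (fst i, snd i)) \<in> \<Xi> \<rightarrow>\<^sub>M exp1"
    using i e by (auto intro!: borel_measurable_diff)
qed

text \<open>With \<open>s\<close> fixed, memorylessness acts separately on the first waiting times
  of the \<open>card E - 1\<close> other edges: each outlives \<open>s\<close> with weight
  \<open>exp (- s)\<close> and leaves a residual with its original law. By uniqueness of product
  measures it suffices to compare finite boxes.\<close>

lemma emeasure_subtract_clocks:
  assumes e: "e \<in> E" and s: "0 \<le> s" and I: "I = {0<..} \<or> I = {0::real..}" and X: "X \<in> sets \<Xi>"
  shows "emeasure \<Xi> {\<eta> \<in> space \<Xi>. (\<forall>e'\<in>E - {e}. \<eta> (e', 0) - s \<in> I) \<and> subtract_clocks e s \<eta> \<in> X} =
    ennreal (exp (- s)) ^ (card E - 1) * emeasure \<Xi> X"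
proof -
  define S where "S = {\<eta> \<in> space \<Xi>. \<forall>e'\<in>E - {e}. \<eta> (e', 0) - s \<in> I}"
  define D where "D = (E - {e}) \<times> {0::nat}"
  have I_meas[measurable]: "I \<in> sets borel" using I by auto
  have comp: "(\<lambda>x. x j) \<in> borel_measurable \<Xi>" if "j \<in> E \<times> UNIV" for j
    using measurable_component_singleton[OF that, of "\<lambda>_. exp1"] by simp
  have S: "S \<in> sets \<Xi>"
    unfolding S_def
  proof (intro sets.sets_Collect_finite_All)
    fix e' assume "e' \<in> E - {e}"
    then have [measurable]: "(\<lambda>x. x (e', 0)) \<in> borel_measurable \<Xi>" by (intro comp) auto
    show "{x \<in> space \<Xi>. x (e', 0) - s \<in> I} \<in> sets \<Xi>" by measurable
  qed simp
  note [measurable] = measurable_subtract_clocks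
  have "distr (density \<Xi> (indicator S)) \<Xi> (subtract_clocks e s) =
     scale_measure (ennreal (exp (- s)) ^ (card E - 1)) \<Xi>" (is "?L = ?R")
  proof (rule measure_eqI_PiM_infinite)
    fix A :: "'v set \<times> nat \<Rightarrow> real set" and J
    assume J: "finite J" "J \<subseteq> E \<times> UNIV" and A: "\<And>i. i \<in> J \<Longrightarrow> A i \<in> sets exp1"
    let ?X = "prod_emb (E \<times> UNIV) (\<lambda>_. exp1) J (Pi\<^sub>E J A)"
    \<comment> \<open>\<open>D\<close> holds the coordinates constrained by survival.
      \<open>A'\<close> extends the box by \<open>UNIV\<close> outside \<open>J\<close>, which adds
      only factors 1.\<close>
    define A' where "A' i = (if i \<in> J then A i else UNIV)" for i
    define B where "B i = (if i \<in> D then {y. y - s \<in> I \<and> y - s \<in> A' i} else A' i)" for i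
    have A'[measurable]: "A' i \<in> sets borel" for i using A by (simp add: A'_def)
    have B: "B i \<in> sets exp1" for i by (simp add: B_def)
    have X[measurable]: "?X \<in> sets \<Xi>" using J A by (intro sets_PiM_I) auto
    have D: "finite D" "D \<subseteq> E \<times> UNIV" "card D = card E - 1"
      using e by (auto simp: D_def card_cartesian_product)
    have "emeasure ?L ?X = emeasure \<Xi> (S \<inter> (subtract_clocks e s -` ?X \<inter> space \<Xi>))"
      using S X by (intro emeasure_distr_density_indicator) auto
    also have "S \<inter> (subtract_clocks e s -` ?X \<inter> space \<Xi>) = {\<eta> \<in> space \<Xi>. \<forall>i\<in>J \<union> D. \<eta> i \<in> B i}"
    proof -
      have "\<eta> \<in> S \<and> subtract_clocks e s \<eta> \<in> ?X \<longleftrightarrow> (\<forall>i\<in>J \<union> D. \<eta> i \<in> B i)" if "\<eta> \<in> space \<Xi>" for \<eta>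
      proof -
        have sp: "subtract_clocks e s \<eta> \<in> space \<Xi>"
          using measurable_space[OF measurable_subtract_clocks that] .
        have "subtract_clocks e s \<eta> \<in> ?X \<longleftrightarrow> (\<forall>i\<in>J. subtract_clocks e s \<eta> i \<in> A i)"
          using sp J by (auto simp: prod_emb_def space_PiM)
        also have "\<dots> \<longleftrightarrow> (\<forall>i\<in>J. (if i \<in> D then \<eta> i - s else \<eta> i) \<in> A i)"
        proof (intro ball_cong refl)
          fix i assume "i \<in> J"
          then have "i \<in> E \<times> UNIV" using J by auto
          then show "subtract_clocks e s \<eta> i \<in> A i \<longleftrightarrow> (if i \<in> D then \<eta> i - s else \<eta> i) \<in> A i"
            by (cases i; cases "fst i = e") (auto simp: subtract_clocks_def D_def)
        qed
        finally show ?thesis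
          using that by (auto simp: S_def B_def A'_def D_def split: if_splits)
      qed
      then show ?thesis by auto
    qed
    also have "emeasure \<Xi> \<dots> = (\<Prod>i\<in>J \<union> D. emeasure exp1 (B i))"
      using J D B by (intro clock.emeasure_PiM_Collect) auto
    also have "\<dots> = (\<Prod>i\<in>J \<union> D. (if i \<in> D then ennreal (exp (- s)) else 1) * emeasure exp1 (A' i))"
      using s I by (intro prod.cong refl) (simp add: B_def emeasure_exp1_memoryless)
    also have "\<dots> = ennreal (exp (- s)) ^ card D * (\<Prod>i\<in>J \<union> D. emeasure exp1 (A' i))"
      using J D by (simp add: prod.distrib prod.If_cases Int_absorb1)
    also have "(\<Prod>i\<in>J \<union> D. emeasure exp1 (A' i)) = (\<Prod>i\<in>J. emeasure exp1 (A i))"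
    proof (rule prod.mono_neutral_cong_right)
      show "\<forall>i\<in>J \<union> D - J. emeasure exp1 (A' i) = 1"
        using prob_space.emeasure_space_1[OF prob_space_exp1] by (simp add: A'_def)
    qed (use J D in \<open>auto simp: A'_def\<close>)
    also have "\<dots> = emeasure \<Xi> ?X"
      using J A by (intro clock.emeasure_PiM_emb[symmetric]) auto
    finally show "emeasure ?L ?X = emeasure ?R ?X" by (simp add: D)
  next
    have "emeasure ?L (space ?L) = emeasure \<Xi> (S \<inter> (subtract_clocks e s -` space \<Xi> \<inter> space \<Xi>))"
      using S by (simp, intro emeasure_distr_density_indicator) auto
    then show "finite_measure ?L" by (intro finite_measureI) simp
  qed simp_all
  then have "emeasure ?L X = ennreal (exp (- s)) ^ (card E - 1) * emeasure \<Xi> X" by simp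
  moreover have "emeasure ?L X = emeasure \<Xi> (S \<inter> (subtract_clocks e s -` X \<inter> space \<Xi>))"
    using S X by (intro emeasure_distr_density_indicator) auto
  moreover have "S \<inter> (subtract_clocks e s -` X \<inter> space \<Xi>) =
      {\<eta> \<in> space \<Xi>. (\<forall>e'\<in>E - {e}. \<eta> (e', 0) - s \<in> I) \<and> subtract_clocks e s \<eta> \<in> X}"
    by (auto simp: S_def)
  ultimately show ?thesis by simp
qed

end

lemma prob_space_unit_uniform: "prob_space unit_uniform"
  by (rule prob_spaceI) (simp add: unit_uniform_def space_restrict_space emeasure_restrict_space)

lemma space_unit_uniform [simp]: "space unit_uniform = {0<..<1}"
  by (simp add: unit_uniform_def space_restrict_space)

section \<open>The first ring and the restart of the clocks\<close>

context local_rule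
begin

text \<open>The sub-probability law of the first event time on the event that one given edge rings
  first: its own Exp(1) density times the probability that the other \<open>card E - 1\<close>
  clocks outlive \<open>s\<close>. It is the same for every edge, which is the source of the uniform
  choice of edges.\<close>

definition first_time_law :: "real measure" where
  "first_time_law = density exp1 (\<lambda>s. ennreal (exp (- s)) ^ (card E - 1))"

lemma sets_first_time_law [measurable_cong, simp]: "sets first_time_law = sets borel"
  by (simp add: first_time_law_def)

lemma sets_first_time_pair: "sets (first_time_law \<Otimes>\<^sub>M \<Xi>) = sets (borel \<Otimes>\<^sub>M \<Xi>)"
  by (rule sets_pair_measure_cong) simp_all

lemma measurable_clock: "i \<in> E \<times> UNIV \<Longrightarrow> (\<lambda>\<xi>. \<xi> i) \<in> borel_measurable \<Xi>"
  using measurable_component_singleton[of i "E \<times> UNIV" "\<lambda>_. exp1"] by simp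

text \<open>Writing the clocks as \<open>insert_clock e s\<close> applied to fresh clocks separates
  the first ring time of \<open>e\<close> from the rest. For each fixed \<open>s\<close> the
  condition becomes that of \<open>emeasure_subtract_clocks\<close>, and integrating over
  \<open>s\<close> gives the product.\<close>

lemma emeasure_first_ring:
  assumes e: "e \<in> E" and I: "I = {0<..} \<or> I = {0::real..}"
    and A: "A \<in> sets borel" and X: "X \<in> sets \<Xi>"
  defines "T \<equiv> {\<xi> \<in> space \<Xi>. (\<forall>e'\<in>E - {e}. \<xi> (e', 0) - \<xi> (e, 0) \<in> I) \<and>
      \<xi> (e, 0) \<in> A \<and> shift_clocks e (\<xi> (e, 0)) \<xi> \<in> X}"
  shows "T \<in> sets \<Xi>" "emeasure \<Xi> T = emeasure first_time_law A * emeasure \<Xi> X"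
proof -
  interpret exp1: prob_space exp1 by (rule prob_space_exp1)
  have [measurable]: "I \<in> sets borel" using I by auto
  note [measurable] = A X measurable_insert_clock[OF e] measurable_shift_clocks[OF e]
  have e0[measurable]: "(\<lambda>\<xi>. \<xi> (e, 0)) \<in> borel_measurable \<Xi>" using e by (intro measurable_clock) simp
  have 1: "{\<xi> \<in> space \<Xi>. \<forall>e'\<in>E - {e}. \<xi> (e', 0) - \<xi> (e, 0) \<in> I} \<in> sets \<Xi>"
  proof (intro sets.sets_Collect_finite_All)
    fix e' assume "e' \<in> E - {e}"
    then have [measurable]: "(\<lambda>\<xi>. \<xi> (e', 0)) \<in> borel_measurable \<Xi>" by (intro measurable_clock) auto
    show "{\<xi> \<in> space \<Xi>. \<xi> (e', 0) - \<xi> (e, 0) \<in> I} \<in> sets \<Xi>" by measurable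
  qed simp
  have 2: "{\<xi> \<in> space \<Xi>. \<xi> (e, 0) \<in> A \<and> shift_clocks e (\<xi> (e, 0)) \<xi> \<in> X} \<in> sets \<Xi>" by measurable
  show T[measurable]: "T \<in> sets \<Xi>"
    using sets.sets_Collect_conj[OF 1 2] unfolding T_def by (simp add: conj_ac)
  have "emeasure \<Xi> T = emeasure (distr (exp1 \<Otimes>\<^sub>M \<Xi>) \<Xi> (\<lambda>(s, \<eta>). insert_clock e s \<eta>)) T"
    by (simp add: distr_insert_clock[OF e])
  also have "\<dots> = emeasure (exp1 \<Otimes>\<^sub>M \<Xi>)
      ((\<lambda>(s, \<eta>). insert_clock e s \<eta>) -` T \<inter> space (exp1 \<Otimes>\<^sub>M \<Xi>))"
    by (rule emeasure_distr) measurable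
  also have "\<dots> = (\<integral>\<^sup>+s. emeasure \<Xi> (Pair s -` ((\<lambda>(s, \<eta>). insert_clock e s \<eta>) -` T \<inter> space (exp1 \<Otimes>\<^sub>M \<Xi>))) \<partial>exp1)"
    by (rule clock.P.emeasure_pair_measure_alt) measurable
  also have "\<dots> = (\<integral>\<^sup>+s. ennreal (exp (- s)) ^ (card E - 1) * indicator A s * emeasure \<Xi> X \<partial>exp1)"
  proof (rule nn_integral_cong_AE)
    show "AE s in exp1. emeasure \<Xi> (Pair s -` ((\<lambda>(s, \<eta>). insert_clock e s \<eta>) -` T \<inter> space (exp1 \<Otimes>\<^sub>M \<Xi>))) =
        ennreal (exp (- s)) ^ (card E - 1) * indicator A s * emeasure \<Xi> X"
      using AE_exp1_nonneg
    proof eventually_elim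
      case (elim s)
      have "Pair s -` ((\<lambda>(s, \<eta>). insert_clock e s \<eta>) -` T \<inter> space (exp1 \<Otimes>\<^sub>M \<Xi>)) =
          (if s \<in> A then {\<eta> \<in> space \<Xi>. (\<forall>e'\<in>E - {e}. \<eta> (e', 0) - s \<in> I) \<and> subtract_clocks e s \<eta> \<in> X} else {})"
      proof -
        have "insert_clock e s \<eta> \<in> space \<Xi>" if "\<eta> \<in> space \<Xi>" for \<eta>
          using measurable_space[OF measurable_insert_clock[OF e], of "(s, \<eta>)"] that
          by (simp add: space_pair_measure)
        moreover have "insert_clock e s \<eta> (e, 0) = s" for \<eta>
          using e by (simp add: insert_clock_def)
        moreover have "insert_clock e s \<eta> (e', 0) = \<eta> (e', 0)" if "e' \<in> E - {e}" for \<eta> e'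
          using that by (simp add: insert_clock_def)
        ultimately show ?thesis
          by (auto simp: T_def space_pair_measure shift_insert_clock)
      qed
      then show ?case using emeasure_subtract_clocks[OF e elim I X] by simp
    qed
  qed
  also have "\<dots> = (\<integral>\<^sup>+s. ennreal (exp (- s)) ^ (card E - 1) * indicator A s \<partial>exp1) * emeasure \<Xi> X"
  proof (rule nn_integral_multc)
    have [measurable]: "(indicator A :: real \<Rightarrow> ennreal) \<in> borel_measurable exp1"
      by (intro borel_measurable_indicator) (simp add: A)
    show "(\<lambda>s. ennreal (exp (- s)) ^ (card E - 1) * indicator A s) \<in> borel_measurable exp1"
      by (intro borel_measurable_times_ennreal) simp_all
  qed
  also have "(\<integral>\<^sup>+s. ennreal (exp (- s)) ^ (card E - 1) * indicator A s \<partial>exp1) = emeasure first_time_law A"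
    by (simp add: first_time_law_def emeasure_density)
  finally show "emeasure \<Xi> T = emeasure first_time_law A * emeasure \<Xi> X" .
qed

lemma measurable_first_edge [measurable]: "first_edge \<in> \<Xi> \<rightarrow>\<^sub>M count_space UNIV"
  unfolding first_edge_def[abs_def] by (rule measurable_next_edge)

text \<open>
  Requiring strict inequalities resp. weak inequalities between the first ring arrival_times bounds the
  event that \<open>e\<close> rings first from both sides; since both bounds have the same probability, ties
  need no separate treatment.
\<close>

lemma emeasure_first_edge:
  assumes e: "e \<in> E" and A: "A \<in> sets borel" and X: "X \<in> sets \<Xi>"
  shows "emeasure \<Xi> {\<xi> \<in> space \<Xi>. first_edge \<xi> = e \<and> \<xi> (e, 0) \<in> A \<and> shift_clocks e (\<xi> (e, 0)) \<xi> \<in> X} =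
     emeasure first_time_law A * emeasure \<Xi> X" (is "emeasure \<Xi> ?F = _")
proof (rule antisym)
  note [measurable] = A X measurable_shift_clocks[OF e]
  have [measurable]: "(\<lambda>\<xi>. \<xi> (e, 0)) \<in> borel_measurable \<Xi>" using e by (intro measurable_clock) simp
  have F: "?F \<in> sets \<Xi>" by measurable
  have min: "\<xi> (first_edge \<xi>, 0) \<le> \<xi> (e', 0)" if "e' \<in> E" for \<xi> e'
    using next_edge_min[OF that, of \<xi> "\<lambda>_. 0"] by (simp add: ring_time_def first_edge_def)
  have fe: "first_edge \<xi> \<in> E" for \<xi> by (simp add: first_edge_def next_edge_in)
  note weak = emeasure_first_ring[OF e _ A X, of "{0..}", simplified]
  note strict = emeasure_first_ring[OF e _ A X, of "{0<..}", simplified]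
  show "emeasure \<Xi> ?F \<le> emeasure first_time_law A * emeasure \<Xi> X"
    unfolding weak(2)[symmetric] using min by (intro emeasure_mono weak(1)) auto
  show "emeasure first_time_law A * emeasure \<Xi> X \<le> emeasure \<Xi> ?F"
    unfolding strict(2)[symmetric]
  proof (intro emeasure_mono F subsetI)
    fix \<xi> assume \<xi>: "\<xi> \<in> {\<xi> \<in> space \<Xi>. (\<forall>e'\<in>E - {e}. \<xi> (e, 0) < \<xi> (e', 0)) \<and> \<xi> (e, 0) \<in> A \<and>
        shift_clocks e (\<xi> (e, 0)) \<xi> \<in> X}"
    then have "first_edge \<xi> = e"
      using min[OF e, of \<xi>] fe[of \<xi>] by (cases "first_edge \<xi> = e") (auto simp: not_le[symmetric])
    then show "\<xi> \<in> ?F" using \<xi> by simp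
  qed
qed

lemma finite_first_time_law: "finite_measure first_time_law"
proof (rule finite_measureI)
  obtain e where e: "e \<in> E" using edges_ne by auto
  have "emeasure first_time_law UNIV * emeasure \<Xi> (space \<Xi>) \<le> 1"
    unfolding emeasure_first_edge[OF e space_in_borel sets.top, symmetric]
    by (rule clock.P.measure_le_1)
  then show "emeasure first_time_law (space first_time_law) \<noteq> \<infinity>"
    by (auto simp: clock.P.emeasure_space_1 first_time_law_def top_unique)
qed

text \<open>Product sets determine the product measure, so the factorisation passes to events that
  couple the first time with the restarted clocks. Such events arise because each later event time
  is the first one plus a time of the restarted clocks.\<close>

lemma emeasure_first_edge_pair:
  assumes e: "e \<in> E" and Y: "Y \<in> sets (borel \<Otimes>\<^sub>M \<Xi>)"
  shows "emeasure \<Xi> {\<xi> \<in> space \<Xi>. first_edge \<xi> = e \<and> (\<xi> (e, 0), shift_clocks e (\<xi> (e, 0)) \<xi>) \<in> Y} =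
     emeasure (first_time_law \<Otimes>\<^sub>M \<Xi>) Y"
proof -
  interpret first: finite_measure first_time_law by (rule finite_first_time_law)
  note [measurable] = measurable_shift_clocks[OF e]
  have [measurable]: "(\<lambda>\<xi>. \<xi> (e, 0)) \<in> borel_measurable \<Xi>" using e by (intro measurable_clock) simp
  let ?S = "{\<xi> \<in> space \<Xi>. first_edge \<xi> = e}"
  let ?f = "\<lambda>\<xi>. (\<xi> (e, 0), shift_clocks e (\<xi> (e, 0)) \<xi>)"
  let ?L = "distr (density \<Xi> (indicator ?S)) (borel \<Otimes>\<^sub>M \<Xi>) ?f"
  have S: "?S \<in> sets \<Xi>" by measurable
  have f: "?f \<in> \<Xi> \<rightarrow>\<^sub>M borel \<Otimes>\<^sub>M \<Xi>" by measurable
  have L: "emeasure ?L Z = emeasure \<Xi> {\<xi> \<in> space \<Xi>. first_edge \<xi> = e \<and> ?f \<xi> \<in> Z}"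
    if "Z \<in> sets (borel \<Otimes>\<^sub>M \<Xi>)" for Z
    unfolding emeasure_distr_density_indicator[OF S f that] by (rule arg_cong[where f = "emeasure \<Xi>"]) auto
  have "first_time_law \<Otimes>\<^sub>M \<Xi> = ?L"
  proof (rule pair_measure_eqI)
    fix A B assume "A \<in> sets first_time_law" "B \<in> sets \<Xi>"
    then have "A \<in> sets borel" "B \<in> sets \<Xi>" by simp_all
    then show "emeasure first_time_law A * emeasure \<Xi> B = emeasure ?L (A \<times> B)"
      by (subst L) (auto simp: emeasure_first_edge[OF e, symmetric])
  qed (auto intro: first.sigma_finite_measure_axioms clock.P.sigma_finite_measure_axioms
        simp: sets_pair_measure_cong[OF sets_first_time_law refl])
  then show ?thesis using L[OF Y] by simp
qed

section \<open>Independence of the event times from the sequence of ringing edges\<close>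

definition arrival_times :: "('v set \<times> nat \<Rightarrow> real) \<Rightarrow> nat \<Rightarrow> real" where
  "arrival_times \<xi> h = event_time E (\<xi>, undefined) h"

definition arrival_edges :: "('v set \<times> nat \<Rightarrow> real) \<Rightarrow> nat \<Rightarrow> 'v set" where
  "arrival_edges \<xi> h = event_edge E (\<xi>, undefined) h"

lemma event_time_fst: "event_time E d = arrival_times (fst d)"
  by (simp add: arrival_times_def event_time_def event_edge_def fun_eq_iff)

lemma event_edge_fst: "event_edge E d = arrival_edges (fst d)"
  by (simp add: arrival_edges_def event_edge_def fun_eq_iff)

lemma measurable_times [measurable]: "arrival_times \<in> \<Xi> \<rightarrow>\<^sub>M (\<Pi>\<^sub>M h\<in>UNIV. borel)"
  unfolding arrival_times_def[abs_def] by (rule measurable_abs_UNIV) (rule measurable_event_time)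

lemma measurable_edges [measurable]: "(\<lambda>\<xi>. arrival_edges \<xi> h) \<in> \<Xi> \<rightarrow>\<^sub>M count_space UNIV"
  unfolding arrival_edges_def by (rule measurable_event_edge)

lemma times_shift:
  "arrival_times \<xi> = case_nat (\<xi> (first_edge \<xi>, 0))
    (\<lambda>h. \<xi> (first_edge \<xi>, 0) + arrival_times (shift_clocks (first_edge \<xi>) (\<xi> (first_edge \<xi>, 0)) \<xi>) h)"
  by (auto simp: fun_eq_iff arrival_times_def event_time_0 event_time_Suc[OF refl, where U' = undefined] split: nat.split)

lemma measurable_cons_times [measurable]:
  "(\<lambda>(s, \<eta>). case_nat s (\<lambda>h. s + arrival_times \<eta> h)) \<in> borel \<Otimes>\<^sub>M \<Xi> \<rightarrow>\<^sub>M (\<Pi>\<^sub>M h\<in>(UNIV::nat set). borel)"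
  unfolding case_prod_beta
proof (rule measurable_abs_UNIV)
  fix n
  have [measurable]: "(\<lambda>\<xi>. arrival_times \<xi> h) \<in> borel_measurable \<Xi>" for h
    unfolding arrival_times_def by (rule measurable_event_time)
  show "(\<lambda>x. case n of 0 \<Rightarrow> fst x | Suc h \<Rightarrow> fst x + arrival_times (snd x) h) \<in> borel_measurable (borel \<Otimes>\<^sub>M \<Xi>)"
    by (cases n) auto
qed

text \<open>Each edge wins the first race with the same joint law of time and restarted clocks, so
  prescribing the winner costs a factor \<open>1 / card E\<close> and says nothing about the times.
  Restarting then leaves one edge less to prescribe; \<open>D\<close> is kept general since it
  changes at the restart.\<close>

lemma emeasure_times_edges:
  assumes D: "D \<in> sets (\<Pi>\<^sub>M h\<in>(UNIV::nat set). borel)" and es: "\<And>i. i < n \<Longrightarrow> es i \<in> E"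
  shows "emeasure \<Xi> {\<xi> \<in> space \<Xi>. arrival_times \<xi> \<in> D \<and> (\<forall>i<n. arrival_edges \<xi> i = es i)} =
    ennreal (1 / card E) ^ n * emeasure \<Xi> {\<xi> \<in> space \<Xi>. arrival_times \<xi> \<in> D}"
  using assms
proof (induction n arbitrary: D es)
  case 0
  then show ?case by simp
next
  case (Suc n)
  note D[measurable] = Suc.prems(1)
  let ?q = "ennreal (1 / card E)"
  \<comment> \<open>Both sets concern a pair of first ring time and restarted clocks:
    \<open>Y\<close> is the time event, and \<open>Z\<close> adds the remaining \<open>n\<close>
    prescribed edges.\<close>
  define Y where "Y = {(s, \<eta>) \<in> space (borel \<Otimes>\<^sub>M \<Xi>). case_nat s (\<lambda>h. s + arrival_times \<eta> h) \<in> D}"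
  define Z where "Z = {(s, \<eta>) \<in> space (borel \<Otimes>\<^sub>M \<Xi>). case_nat s (\<lambda>h. s + arrival_times \<eta> h) \<in> D \<and>
      (\<forall>i<n. arrival_edges \<eta> i = es (Suc i))}"
  have Y[measurable]: "Y \<in> sets (borel \<Otimes>\<^sub>M \<Xi>)"
    using measurable_sets[OF measurable_cons_times D]
    by (auto simp: Y_def vimage_def Int_def case_prod_unfold conj_commute)
  have Z[measurable]: "Z \<in> sets (borel \<Otimes>\<^sub>M \<Xi>)"
  proof -
    have "Z = Y \<inter> {x \<in> space (borel \<Otimes>\<^sub>M \<Xi>). \<forall>i<n. arrival_edges (snd x) i = es (Suc i)}"
      by (auto simp: Y_def Z_def)
    also have "\<dots> \<in> sets (borel \<Otimes>\<^sub>M \<Xi>)" by measurable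
    finally show ?thesis .
  qed
  have sh: "shift_clocks e (\<xi> (e, 0)) \<xi> \<in> space \<Xi>" if "e \<in> E" "\<xi> \<in> space \<Xi>" for e \<xi>
    using measurable_space[OF measurable_shift_clocks] that .
  have fe: "first_edge \<xi> \<in> E" for \<xi> by (simp add: first_edge_def next_edge_in)
  have "emeasure \<Xi> {\<xi> \<in> space \<Xi>. arrival_times \<xi> \<in> D \<and> (\<forall>i<Suc n. arrival_edges \<xi> i = es i)} =
     emeasure \<Xi> {\<xi> \<in> space \<Xi>. first_edge \<xi> = es 0 \<and> (\<xi> (es 0, 0), shift_clocks (es 0) (\<xi> (es 0, 0)) \<xi>) \<in> Z}"
  proof (rule arg_cong[where f = "emeasure \<Xi>"], rule Collect_cong)
    fix \<xi>
    show "\<xi> \<in> space \<Xi> \<and> arrival_times \<xi> \<in> D \<and> (\<forall>i<Suc n. arrival_edges \<xi> i = es i) \<longleftrightarrow>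
       \<xi> \<in> space \<Xi> \<and> first_edge \<xi> = es 0 \<and> (\<xi> (es 0, 0), shift_clocks (es 0) (\<xi> (es 0, 0)) \<xi>) \<in> Z"
      unfolding All_less_Suc2 arrival_edges_def event_edge_0
      using sh[of "es 0" \<xi>] Suc.prems(2)[of 0] times_shift[of \<xi>]
        event_edge_Suc[of \<xi> "es 0" undefined _ undefined]
      by (auto simp: Z_def space_pair_measure arrival_edges_def)
  qed
  also have "\<dots> = emeasure (first_time_law \<Otimes>\<^sub>M \<Xi>) Z"
    using Suc.prems(2)[of 0] by (intro emeasure_first_edge_pair Z) auto
  also have "\<dots> = (\<integral>\<^sup>+s. emeasure \<Xi> (Pair s -` Z) \<partial>first_time_law)"
    by (rule clock.P.emeasure_pair_measure_alt) (simp only: sets_first_time_pair Z)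
  also have "\<dots> = (\<integral>\<^sup>+s. ?q ^ n * emeasure \<Xi> (Pair s -` Y) \<partial>first_time_law)"
  proof (rule nn_integral_cong)
    fix s
    \<comment> \<open>Seen after a first ring at time \<open>s\<close>, the time event
      \<open>D\<close> becomes this section, to which the induction hypothesis is applied.\<close>
    let ?D = "{t. case_nat s (\<lambda>h. s + t h) \<in> D}"
    have "(\<lambda>t. case_nat s (\<lambda>h. s + t h)) \<in> (\<Pi>\<^sub>M h\<in>(UNIV::nat set). borel) \<rightarrow>\<^sub>M (\<Pi>\<^sub>M h\<in>(UNIV::nat set). borel)"
    proof (rule measurable_abs_UNIV)
      fix n show "(\<lambda>t. case n of 0 \<Rightarrow> s | Suc h \<Rightarrow> s + t h) \<in> borel_measurable (\<Pi>\<^sub>M h\<in>(UNIV::nat set). borel)"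
        by (cases n) auto
    qed
    from measurable_sets[OF this D] have D': "?D \<in> sets (\<Pi>\<^sub>M h\<in>(UNIV::nat set). borel)"
      by (simp add: vimage_def space_PiM)
    have "emeasure \<Xi> (Pair s -` Z) =
        emeasure \<Xi> {\<eta> \<in> space \<Xi>. arrival_times \<eta> \<in> ?D \<and> (\<forall>i<n. arrival_edges \<eta> i = es (Suc i))}"
      by (rule arg_cong[where f = "emeasure \<Xi>"]) (auto simp: Z_def space_pair_measure)
    also have "\<dots> = ?q ^ n * emeasure \<Xi> {\<eta> \<in> space \<Xi>. arrival_times \<eta> \<in> ?D}"
      using Suc.prems(2) by (intro Suc.IH D') auto
    also have "{\<eta> \<in> space \<Xi>. arrival_times \<eta> \<in> ?D} = Pair s -` Y"
      by (auto simp: Y_def space_pair_measure)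
    finally show "emeasure \<Xi> (Pair s -` Z) = ?q ^ n * emeasure \<Xi> (Pair s -` Y)" .
  qed
  also have "\<dots> = ?q ^ n * emeasure (first_time_law \<Otimes>\<^sub>M \<Xi>) Y"
    using Y unfolding sets_first_time_pair[symmetric]
    by (simp add: nn_integral_cmult clock.P.emeasure_pair_measure_alt clock.P.measurable_emeasure_Pair)
  \<comment> \<open>Summing over the winner gives \<open>card E\<close> equal terms, so a single one
    is the fraction \<open>?q\<close> of the total.\<close>
  also have "emeasure (first_time_law \<Otimes>\<^sub>M \<Xi>) Y = ?q * emeasure \<Xi> {\<xi> \<in> space \<Xi>. arrival_times \<xi> \<in> D}"
  proof -
    have "emeasure \<Xi> {\<xi> \<in> space \<Xi>. arrival_times \<xi> \<in> D} =
        emeasure \<Xi> (\<Union>e\<in>E. {\<xi> \<in> space \<Xi>. first_edge \<xi> = e \<and> arrival_times \<xi> \<in> D})"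
      using fe by (intro arg_cong[where f = "emeasure \<Xi>"]) auto
    also have "\<dots> = (\<Sum>e\<in>E. emeasure \<Xi> {\<xi> \<in> space \<Xi>. first_edge \<xi> = e \<and> arrival_times \<xi> \<in> D})"
      by (intro sum_emeasure[symmetric]) (auto simp: disjoint_family_on_def)
    also have "\<dots> = (\<Sum>e\<in>E. emeasure (first_time_law \<Otimes>\<^sub>M \<Xi>) Y)"
    proof (rule sum.cong[OF refl])
      fix e assume e: "e \<in> E"
      have "{\<xi> \<in> space \<Xi>. first_edge \<xi> = e \<and> arrival_times \<xi> \<in> D} =
        {\<xi> \<in> space \<Xi>. first_edge \<xi> = e \<and> (\<xi> (e, 0), shift_clocks e (\<xi> (e, 0)) \<xi>) \<in> Y}"
      proof (rule Collect_cong)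
        fix \<xi>
        show "\<xi> \<in> space \<Xi> \<and> first_edge \<xi> = e \<and> arrival_times \<xi> \<in> D \<longleftrightarrow>
            \<xi> \<in> space \<Xi> \<and> first_edge \<xi> = e \<and> (\<xi> (e, 0), shift_clocks e (\<xi> (e, 0)) \<xi>) \<in> Y"
          using sh[OF e, of \<xi>] times_shift[of \<xi>] by (auto simp: Y_def space_pair_measure)
      qed
      then show "emeasure \<Xi> {\<xi> \<in> space \<Xi>. first_edge \<xi> = e \<and> arrival_times \<xi> \<in> D} = emeasure (first_time_law \<Otimes>\<^sub>M \<Xi>) Y"
        by (simp add: emeasure_first_edge_pair[OF e Y])
    qed
    also have "?q * \<dots> = emeasure (first_time_law \<Otimes>\<^sub>M \<Xi>) Y"
      using edges_ne by (simp add: mult.assoc[symmetric] ennreal_of_nat_eq_real_of_nat ennreal_mult[symmetric])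
    finally show ?thesis by simp
  qed
  finally show ?case by (simp add: mult_ac)
qed

section \<open>The event marks: independent, with the uniform law on the marked edge space\<close>

lemma prob_space_mark_law: "prob_space (mark_law E)"
  unfolding mark_law_def using edges_ne
  by (intro prob_space_pair prob_space_unit_uniform prob_space_uniform_count_measure) simp_all

lemma space_mark_law: "space (mark_law E) = E \<times> {0<..<1}"
  by (simp add: mark_law_def space_pair_measure space_uniform_count_measure)

lemma sets_mark_law [measurable_cong]:
  "sets (mark_law E) = sets (count_space E \<Otimes>\<^sub>M unit_uniform)"
  unfolding mark_law_def by (rule sets_pair_measure_cong) (simp_all add: sets_uniform_count_measure)

lemma emeasure_mark_law:
  assumes G: "G \<in> sets (mark_law E)"
  shows "emeasure (mark_law E) G = (\<Sum>e\<in>E. ennreal (1 / card E) * emeasure unit_uniform (Pair e -` G))"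
proof -
  interpret prob_space unit_uniform by (rule prob_space_unit_uniform)
  show ?thesis
    using G unfolding mark_law_def
    by (simp add: emeasure_pair_measure_alt uniform_count_measure_def nn_integral_point_measure_finite)
qed

sublocale unif: product_prob_space "\<lambda>_. unit_uniform" "UNIV :: nat set"
  by (intro product_prob_spaceI prob_space_unit_uniform)

lemma prob_space_driving: "prob_space (driving_law E)"
  unfolding driving_law_def by (intro prob_space_pair prob_space_clock unif.prob_space_axioms)

lemma measurable_driving_event_time: "event_time E \<in> driving_law E \<rightarrow>\<^sub>M (\<Pi>\<^sub>M h\<in>UNIV. borel)"
  unfolding driving_law_def event_time_fst[abs_def] by measurable

lemma measurable_event_mark: "(\<lambda>d. event_mark E d h) \<in> driving_law E \<rightarrow>\<^sub>M mark_law E"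
proof -
  have [measurable]: "(\<lambda>\<xi>. arrival_edges \<xi> h) \<in> \<Xi> \<rightarrow>\<^sub>M count_space E"
    by (rule measurable_count_space_extend[OF _ _ measurable_edges]) (auto simp: arrival_edges_def event_edge_in)
  show ?thesis
    unfolding driving_law_def event_mark_def event_edge_fst measurable_cong_sets[OF refl sets_mark_law]
    by measurable
qed

text \<open>A mark mixes two sources, the clocks through its edge and the separate uniforms.
  Splitting over the finitely many edge sequences \<open>g\<close> makes each piece a rectangle
  \<open>A g \<times> B g\<close> of the two; the sum of products is then refolded into a product of
  sums over edges.\<close>

lemma emeasure_times_marks:
  assumes D: "D \<in> sets (\<Pi>\<^sub>M h\<in>UNIV. borel)" and G: "\<And>i. i < n \<Longrightarrow> G i \<in> sets (mark_law E)"
  shows "emeasure (driving_law E)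
      {d \<in> space (driving_law E). event_time E d \<in> D \<and> (\<forall>i<n. event_mark E d i \<in> G i)} =
    emeasure (driving_law E) {d \<in> space (driving_law E). event_time E d \<in> D} *
      (\<Prod>i<n. emeasure (mark_law E) (G i))"
proof -
  note D[measurable]
  let ?N = "\<Pi>\<^sub>M h\<in>(UNIV :: nat set). unit_uniform"
  let ?P = "PiE {..<n} (\<lambda>_. E)"
  let ?T = "emeasure \<Xi> {\<xi> \<in> space \<Xi>. arrival_times \<xi> \<in> D}"
  let ?q = "ennreal (1 / card E)"
  define A where "A g = {\<xi> \<in> space \<Xi>. arrival_times \<xi> \<in> D \<and> (\<forall>i<n. arrival_edges \<xi> i = g i)}" for g
  define B where "B g = {U \<in> space ?N. \<forall>i\<in>{..<n}. U i \<in> Pair (g i) -` G i}" for g :: "nat \<Rightarrow> 'v set"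
  have P: "finite ?P" by (intro finite_PiE) auto
  have A[measurable]: "A g \<in> sets \<Xi>" for g unfolding A_def by measurable
  have slice: "Pair e -` G i \<in> sets unit_uniform" if "i < n" for e i
    using G[OF that] unfolding mark_law_def by (rule sets_Pair1)
  have B[measurable]: "B g \<in> sets ?N" for g
    unfolding B_def
  proof (intro sets.sets_Collect_finite_All)
    fix i assume "i \<in> {..<n}"
    with slice[of i] have [measurable]: "Pair (g i) -` G i \<in> sets unit_uniform" by simp
    show "{x \<in> space ?N. x i \<in> Pair (g i) -` G i} \<in> sets ?N" by measurable
  qed simp
  have T: "emeasure (driving_law E) {d \<in> space (driving_law E). event_time E d \<in> D} = ?T"
  proof -
    have "{d \<in> space (driving_law E). event_time E d \<in> D} = {\<xi> \<in> space \<Xi>. arrival_times \<xi> \<in> D} \<times> space ?N"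
      by (auto simp: driving_law_def space_pair_measure event_time_fst)
    then show ?thesis
      unfolding driving_law_def
      by (simp add: unif.P.emeasure_pair_measure_Times unif.P.emeasure_space_1)
  qed
  have "{d \<in> space (driving_law E). event_time E d \<in> D \<and> (\<forall>i<n. event_mark E d i \<in> G i)} =
      (\<Union>g\<in>?P. A g \<times> B g)"
  proof (intro set_eqI iffI)
    fix d assume d: "d \<in> {d \<in> space (driving_law E). event_time E d \<in> D \<and> (\<forall>i<n. event_mark E d i \<in> G i)}"
    then have "d \<in> A (restrict (arrival_edges (fst d)) {..<n}) \<times> B (restrict (arrival_edges (fst d)) {..<n})"
      by (auto simp: A_def B_def driving_law_def space_pair_measure event_time_fst event_mark_def event_edge_fst mem_Times_iff)
    then show "d \<in> (\<Union>g\<in>?P. A g \<times> B g)"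
      by (intro UN_I[of "restrict (arrival_edges (fst d)) {..<n}"]) (auto simp: arrival_edges_def event_edge_in)
  qed (auto simp: A_def B_def driving_law_def space_pair_measure event_time_fst event_mark_def event_edge_fst)
  then have "emeasure (driving_law E)
      {d \<in> space (driving_law E). event_time E d \<in> D \<and> (\<forall>i<n. event_mark E d i \<in> G i)} =
      emeasure (\<Xi> \<Otimes>\<^sub>M ?N) (\<Union>g\<in>?P. A g \<times> B g)"
    by (simp add: driving_law_def)
  also have "\<dots> = (\<Sum>g\<in>?P. emeasure (\<Xi> \<Otimes>\<^sub>M ?N) (A g \<times> B g))"
  proof (intro sum_emeasure[symmetric] P)
    show "disjoint_family_on (\<lambda>g. A g \<times> B g) ?P"
      unfolding disjoint_family_on_def
    proof safe
      fix g g' \<xi> U assume "g \<in> ?P" "g' \<in> ?P" "g \<noteq> g'" "\<xi> \<in> A g" "\<xi> \<in> A g'"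
      then have "g = g'" by (intro PiE_ext[of g "{..<n}" "\<lambda>_. E"]) (auto simp: A_def)
      with \<open>g \<noteq> g'\<close> show "(\<xi>, U) \<in> {}" by simp
    qed
  qed auto
  also have "\<dots> = (\<Sum>g\<in>?P. ?T * (\<Prod>i<n. ?q * emeasure unit_uniform (Pair (g i) -` G i)))"
  proof (rule sum.cong[OF refl])
    fix g assume g: "g \<in> ?P"
    have "emeasure \<Xi> (A g) = ?q ^ n * ?T"
      unfolding A_def using g by (intro emeasure_times_edges D) auto
    moreover have "emeasure ?N (B g) = (\<Prod>i<n. emeasure unit_uniform (Pair (g i) -` G i))"
      unfolding B_def using slice by (intro unif.emeasure_PiM_Collect) auto
    ultimately show "emeasure (\<Xi> \<Otimes>\<^sub>M ?N) (A g \<times> B g) =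
        ?T * (\<Prod>i<n. ?q * emeasure unit_uniform (Pair (g i) -` G i))"
      by (simp add: unif.P.emeasure_pair_measure_Times prod.distrib mult_ac)
  qed
  also have "\<dots> = ?T * (\<Prod>i<n. emeasure (mark_law E) (G i))"
    unfolding sum_distrib_left[symmetric]
    by (subst prod_sum_PiE[symmetric]) (auto intro!: arg_cong2[where f = times_class.times] prod.cong simp: emeasure_mark_law G)
  finally show ?thesis by (simp add: T)
qed

end

subsection \<open>Resampling on a set\<close>

text \<open>On a null set, conditioning is replaced by the unconditional law so that kernels stay total.\<close>

definition cond_on :: "'a measure \<Rightarrow> 'a set \<Rightarrow> 'a measure" where
  "cond_on M S = (if emeasure M S = 0 then M else uniform_measure M S)"

definition resample :: "'a measure \<Rightarrow> 'a set \<Rightarrow> 'a \<Rightarrow> 'a measure" where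
  "resample M S a = (if a \<in> S then cond_on M S else return M a)"

lemma sets_cond_on [simp, measurable_cong]: "sets (cond_on M S) = sets M"
  by (simp add: cond_on_def)

lemma space_cond_on [simp]: "space (cond_on M S) = space M"
  by (simp add: cond_on_def)

context prob_space
begin

lemma prob_space_cond_on: "prob_space (cond_on M S)"
  using prob_space_axioms by (auto simp: cond_on_def intro!: prob_space_uniform_measure)

text \<open>The multiplied form avoids a quotient and so remains true for null \<open>S\<close>,
  where both sides vanish.\<close>

lemma emeasure_cond_on:
  assumes [measurable]: "S \<in> events" "A \<in> events"
  shows "emeasure M S * emeasure (cond_on M S) A = emeasure M (S \<inter> A)"
proof (cases "emeasure M S = 0")
  case True
  then have "emeasure M (S \<inter> A) \<le> 0" using emeasure_mono[of "S \<inter> A" S M] assms by auto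
  then show ?thesis using True by simp
next
  case False
  have "emeasure M S * emeasure (cond_on M S) A = emeasure M (S \<inter> A) * emeasure M S / emeasure M S"
    using False by (simp add: cond_on_def ennreal_times_divide mult.commute)
  then show ?thesis using False by (simp add: ennreal_mult_divide_eq)
qed

lemma integrable_cond_on:
  fixes f :: "'a \<Rightarrow> real"
  assumes [measurable]: "S \<in> events" and f: "integrable M f"
  shows "integrable (cond_on M S) f" "(LINT x:S|M. f x) = prob S * (\<integral>x. f x \<partial>cond_on M S)"
proof -
  have [measurable]: "f \<in> borel_measurable M" using f by auto
  have "integrable (cond_on M S) f \<and> (LINT x:S|M. f x) = prob S * (\<integral>x. f x \<partial>cond_on M S)"
  proof (cases "emeasure M S = 0")
    case True
    then have "AE x in M. indicator S x *\<^sub>R f x = 0"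
      by (auto dest: AE_not_in intro: AE_I[where N = S])
    then have "(LINT x:S|M. f x) = 0"
      unfolding set_lebesgue_integral_def by (rule integral_eq_zero_AE)
    then show ?thesis using True f by (simp add: cond_on_def measure_def)
  next
    case False
    then have pos: "prob S > 0" by (simp add: emeasure_eq_measure zero_less_measure_iff)
    have "cond_on M S = density M (\<lambda>x. ennreal (indicator S x / prob S))"
      using False pos by (simp add: cond_on_def uniform_measure_def emeasure_eq_measure
          divide_ennreal ennreal_indicator[symmetric] del: ennreal_indicator)
    moreover have "integrable M (\<lambda>x. (indicator S x / prob S) *\<^sub>R f x)"
      using integrable_mult_indicator[OF assms(1) f] by simp
    moreover have "(\<integral>x. (indicator S x / prob S) *\<^sub>R f x \<partial>M) = (LINT x:S|M. f x) / prob S"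
      by (simp add: set_lebesgue_integral_def)
    ultimately show ?thesis
      using pos by (simp add: integrable_density integral_density)
  qed
  then show "integrable (cond_on M S) f" "(LINT x:S|M. f x) = prob S * (\<integral>x. f x \<partial>cond_on M S)" by auto
qed

lemma measurable_resample:
  assumes [measurable]: "S \<in> events"
  shows "resample M S \<in> M \<rightarrow>\<^sub>M prob_algebra M"
  unfolding resample_def[abs_def]
  by (intro measurable_If measurable_const measurable_return_prob_space)
    (auto simp: space_prob_algebra prob_space_cond_on)

text \<open>Up to null sets, resampling moves mass only inside \<open>S\<close> and redistributes it
  there in proportion to \<open>M\<close> itself.\<close>

lemma bind_resample:
  assumes S[measurable]: "S \<in> events"
  shows "M \<bind> resample M S = M"
proof (rule measure_eqI)
  have M: "M \<in> space (prob_algebra M)" by (simp add: space_prob_algebra prob_space_axioms)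
  show s: "sets (M \<bind> resample M S) = events"
    using sets_bind'[OF M measurable_resample[OF S]] .
  fix A assume "A \<in> sets (M \<bind> resample M S)"
  then have A[measurable]: "A \<in> events" by (simp add: s)
  have "emeasure (M \<bind> resample M S) A = (\<integral>\<^sup>+x. emeasure (resample M S x) A \<partial>M)"
    by (rule emeasure_bind_prob_algebra[OF M measurable_resample[OF S] A])
  also have "\<dots> = (\<integral>\<^sup>+x. indicator S x * emeasure (cond_on M S) A + indicator (A - S) x \<partial>M)"
    by (intro nn_integral_cong) (auto simp: resample_def indicator_def)
  also have "\<dots> = emeasure M (S \<inter> A) + emeasure M (A - S)"
    by (subst nn_integral_add) (auto simp: nn_integral_multc emeasure_cond_on)
  also have "\<dots> = emeasure M A"
    by (subst plus_emeasure) (auto intro!: arg_cong[where f = "emeasure M"])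
  finally show "emeasure (M \<bind> resample M S) A = emeasure M A" .
qed

lemma integrable_return_prob:
  fixes f :: "'a \<Rightarrow> real"
  assumes "f \<in> borel_measurable M" "a \<in> space M"
  shows "integrable (return M a) f"
  by (rule integrableI_bounded) (use assms in \<open>auto simp: nn_integral_return\<close>)

text \<open>In the sub-sigma-algebra \<open>F\<close> the set \<open>S\<close> is an atom, while
  outside \<open>S\<close> every event of \<open>M\<close> is retained. Conditional expectation onto
  \<open>F\<close> therefore averages over \<open>S\<close> and leaves the function alone elsewhere,
  which is integration against \<open>resample\<close>.\<close>

lemma acts_as_cond_exp_resample:
  assumes S[measurable]: "S \<in> events"
  shows "acts_as_cond_exp M (resample M S)"
proof -
  define \<A> where "\<A> = {A \<in> events. S \<subseteq> A \<or> A \<inter> S = {}}"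
  define F where "F = sigma (space M) \<A>"
  have "sigma_algebra (space M) \<A>"
    unfolding sigma_algebra_iff2
  proof (intro conjI ballI allI impI)
    show "\<A> \<subseteq> Pow (space M)" by (auto simp: \<A>_def dest: sets.sets_into_space)
    fix A :: "nat \<Rightarrow> 'a set" assume A: "range A \<subseteq> \<A>"
    then have "(\<Union>i. A i) \<in> events" by (auto simp: \<A>_def)
    moreover have "S \<subseteq> (\<Union>i. A i) \<or> (\<Union>i. A i) \<inter> S = {}"
      using A by (cases "\<exists>i. S \<subseteq> A i") (auto simp: \<A>_def image_subset_iff)
    ultimately show "(\<Union>i. A i) \<in> \<A>" by (simp add: \<A>_def)
  qed (use sets.sets_into_space[OF S] in \<open>auto simp: \<A>_def\<close>)
  then have sets_F: "sets F = \<A>" and space_F: "space F = space M"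
    by (simp_all add: F_def sigma_algebra.sets_measure_of_eq space_measure_of_conv)
  have sub: "subalgebra M F" by (auto simp: subalgebra_def sets_F space_F \<A>_def)
  interpret finite_measure_subalgebra M F by unfold_locales (rule sub)
  show ?thesis
    unfolding acts_as_cond_exp_def
  proof (intro exI[of _ F] conjI sub ballI impI)
    fix f :: "'a \<Rightarrow> real"
    assume f[measurable]: "f \<in> borel_measurable M" and sq: "integrable M (\<lambda>a. (f a)\<^sup>2)"
    have int_f: "integrable M f" by (rule square_integrable_imp_integrable[OF f sq])
    \<comment> \<open>For null \<open>S\<close> the value \<open>c\<close> is the unconditional
      mean; it then enters \<open>g\<close> only on a null set.\<close>
    define c where "c = (\<integral>b. f b \<partial>cond_on M S)"
    define g where "g a = (if a \<in> S then c else f a)" for a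
    have g[measurable]: "g \<in> borel_measurable M" unfolding g_def[abs_def] by measurable
    have int_g: "integrable M g"
    proof -
      have "integrable M (\<lambda>a. c * indicator S a + indicator (space M - S) a *\<^sub>R f a)"
        using integrable_mult_indicator[OF _ int_f, of "space M - S"]
        by (intro Bochner_Integration.integrable_add) (auto simp: less_top[symmetric])
      then show ?thesis
        by (rule Bochner_Integration.integrable_cong[OF refl, THEN iffD1, rotated]) (auto simp: g_def)
    qed
    have "AE a in M. real_cond_exp M F f a = g a"
    proof (rule real_cond_exp_charact)
      show "g \<in> borel_measurable F"
      proof (rule measurableI)
        fix B :: "real set" assume [measurable]: "B \<in> sets borel"
        \<comment> \<open>Since \<open>g\<close> is constant on \<open>S\<close>, this preimage
          either contains \<open>S\<close> or misses it.\<close>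
        have "g -` B \<inter> space M \<in> events" by measurable
        then show "g -` B \<inter> space F \<in> sets F"
          using sets.sets_into_space[OF S] by (auto simp: sets_F space_F \<A>_def g_def)
      qed simp
      fix A assume "A \<in> sets F"
      then have A[measurable]: "A \<in> events" and "S \<subseteq> A \<or> A \<inter> S = {}" by (auto simp: sets_F \<A>_def)
      from this(2) show "(LINT x:A|M. f x) = (LINT x:A|M. g x)"
      proof
        assume "S \<subseteq> A"
        then have A_eq: "A = S \<union> (A - S)" by auto
        have split: "(LINT x:A|M. h x) = (LINT x:S|M. h x) + (LINT x:A - S|M. h x)"
          if h: "integrable M h" for h :: "'a \<Rightarrow> real"
          using integrable_mult_indicator[OF S h] integrable_mult_indicator[OF _ h, of "A - S"]
          by (subst A_eq, intro set_integral_Un) (auto simp: set_integrable_def)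
        have "(LINT x:S|M. g x) = (LINT x:S|M. c)"
          by (rule set_lebesgue_integral_cong) (auto simp: g_def)
        also have "\<dots> = prob S * c" by (simp add: set_lebesgue_integral_def)
        also have "\<dots> = (LINT x:S|M. f x)" by (simp add: c_def integrable_cond_on(2)[OF S int_f])
        finally have "(LINT x:S|M. g x) = (LINT x:S|M. f x)" .
        moreover have "(LINT x:A - S|M. g x) = (LINT x:A - S|M. f x)"
          by (rule set_lebesgue_integral_cong) (auto simp: g_def)
        ultimately show ?thesis by (simp add: split int_f int_g)
      next
        assume "A \<inter> S = {}"
        then show ?thesis by (intro set_lebesgue_integral_cong) (auto simp: g_def)
      qed
    qed (use int_f int_g in auto)
    then show "AE a in M. integrable (resample M S a) f \<and> (\<integral>b. f b \<partial>resample M S a) = real_cond_exp M F f a"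
    proof (rule AE_mp, intro AE_I2 impI)
      fix a assume "a \<in> space M" "real_cond_exp M F f a = g a"
      then show "integrable (resample M S a) f \<and> (\<integral>b. f b \<partial>resample M S a) = real_cond_exp M F f a"
        by (auto simp: resample_def g_def c_def integral_return integrable_return_prob integrable_cond_on(1)[OF S int_f])
    qed
  qed
qed

end

text \<open>Serves to integrate out one fresh mark of the auxiliary process while all the others are
  held fixed.\<close>

lemma nn_integral_PiM_split:
  assumes M: "\<And>i. i \<in> I \<Longrightarrow> prob_space (M i)" and k: "k \<in> I"
    and f: "f \<in> borel_measurable (PiM I M)"
  shows "(\<integral>\<^sup>+a. f a \<partial>PiM I M) = (\<integral>\<^sup>+a. \<integral>\<^sup>+x. f (a(k := x)) \<partial>M k \<partial>PiM (I - {k}) M)"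
proof -
  have ins: "insert k (I - {k}) = I" using k by auto
  interpret k: prob_space "M k" using M k .
  interpret J: prob_space "PiM (I - {k}) M" using M by (intro prob_space_PiM) auto
  interpret pair_sigma_finite "M k" "PiM (I - {k}) M" ..
  have u: "(\<lambda>(x, X). X(k := x)) \<in> M k \<Otimes>\<^sub>M PiM (I - {k}) M \<rightarrow>\<^sub>M PiM I M"
    using k unfolding case_prod_beta by (intro measurable_fun_upd[where J = "I - {k}"]) auto
  have "distr (M k \<Otimes>\<^sub>M PiM (I - {k}) M) (PiM (insert k (I - {k})) M) (\<lambda>(x, X). X(k := x)) =
      PiM (insert k (I - {k})) M"
    by (rule distr_pair_PiM_eq_PiM) (use M k in auto)
  from this[unfolded ins, symmetric] have "PiM I M =
      distr (M k \<Otimes>\<^sub>M PiM (I - {k}) M) (PiM I M) (\<lambda>(x, X). X(k := x))" .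
  then have "(\<integral>\<^sup>+a. f a \<partial>PiM I M) =
      (\<integral>\<^sup>+a. f a \<partial>distr (M k \<Otimes>\<^sub>M PiM (I - {k}) M) (PiM I M) (\<lambda>(x, X). X(k := x)))"
    by simp
  also have "\<dots> = (\<integral>\<^sup>+y. f (case y of (x, X) \<Rightarrow> X(k := x)) \<partial>(M k \<Otimes>\<^sub>M PiM (I - {k}) M))"
    by (rule nn_integral_distr[OF u]) (simp add: f)
  also have "\<dots> = (\<integral>\<^sup>+a. \<integral>\<^sup>+x. f (a(k := x)) \<partial>M k \<partial>PiM (I - {k}) M)"
    using nn_integral_snd[OF measurable_compose[OF u f]] by simp
  finally show ?thesis .
qed

subsection \<open>The auxiliary process\<close>

lemma space_path_space [simp]: "space path_space = UNIV"
  by (simp add: path_space_def space_pair_measure space_PiM)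

lemma measurable_path_selected [measurable]:
  "(\<lambda>\<gamma>. path_selected \<gamma> h) \<in> (path_space :: 'v::finite path measure) \<rightarrow>\<^sub>M count_space UNIV"
  unfolding path_selected_def path_space_def by measurable

lemma measurable_path_profile [measurable]:
  "(\<lambda>\<gamma>. path_profile \<gamma> h) \<in> (path_space :: 'v::finite path measure) \<rightarrow>\<^sub>M count_space UNIV"
proof (induction h)
  case 0
  then show ?case by (simp add: path_profile_def path_space_def)
next
  case (Suc h)
  have "(\<lambda>\<gamma>. add_ball (path_profile \<gamma> h) (path_selected \<gamma> h)) \<in> (path_space :: 'v::finite path measure) \<rightarrow>\<^sub>M count_space UNIV"
  proof (rule measurable_compose_countable[where f = "\<lambda>x \<gamma>. add_ball x (path_selected \<gamma> h)", OF _ Suc])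
    show "(\<lambda>\<gamma>. add_ball x (path_selected \<gamma> h)) \<in> (path_space :: 'v::finite path measure) \<rightarrow>\<^sub>M count_space UNIV" for x
      by (rule measurable_compose_discrete[OF measurable_path_selected])
  qed
  then show ?case by (simp add: path_profile_def path_selected_def)
qed

lemma path_profile_Suc: "path_profile \<gamma> (Suc h) = add_ball (path_profile \<gamma> h) (path_selected \<gamma> h)"
  by (simp add: path_profile_def path_selected_def)

context local_rule
begin

abbreviation "\<rho> \<equiv> mark_law E"

sublocale mark: prob_space \<rho>
  by (rule prob_space_mark_law)

lemma measurable_sel [measurable]: "\<sigma> x \<in> \<rho> \<rightarrow>\<^sub>M count_space UNIV"
  unfolding measurable_cong_sets[OF sets_mark_law refl]
proof (rule measurable_pair_measure_countable1)
  fix e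
  have "(\<lambda>U. if U \<le> c then fst (ori e) else snd (ori e)) \<in> unit_uniform \<rightarrow>\<^sub>M count_space UNIV" for c
    unfolding unit_uniform_def by (rule measurable_restrict_space1) measurable
  then show "(\<lambda>U. \<sigma> x (e, U)) \<in> unit_uniform \<rightarrow>\<^sub>M count_space UNIV"
    by (simp add: sel_def)
qed simp

definition chosen :: "'v profile \<Rightarrow> 'v \<Rightarrow> 'v mark set" where
  "chosen x j = {a \<in> space \<rho>. \<sigma> x a = j}"

lemma chosen_sets [measurable]: "chosen x j \<in> sets \<rho>"
  unfolding chosen_def by measurable

text \<open>The bridge from marks to rates: \<open>rate\<close> adds up the lengths of the fibers of
  \<open>chosen x w\<close>, and \<rho> weights each fiber by \<open>1 / card E\<close>. Through it,
  invariance of \<rho> turns into the statement about the law of the tag.\<close>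

lemma emeasure_chosen: "emeasure \<rho> (chosen x w) = ennreal (rate E ori p x w / card E)"
proof -
  have "emeasure unit_uniform (Pair e -` chosen x w) =
      ennreal (measure lborel {U \<in> {0<..<1}. \<sigma> x (e, U) = w})" if e: "e \<in> E" for e
  proof -
    have "Pair e -` chosen x w = {U \<in> {0<..<1}. \<sigma> x (e, U) = w}"
      using e by (auto simp: chosen_def space_mark_law)
    moreover have "emeasure lborel {U \<in> {0<..<1::real}. \<sigma> x (e, U) = w} < \<infinity>"
      by (rule le_less_trans[OF emeasure_mono[of _ "{0<..<1}"]]) auto
    ultimately show ?thesis
      unfolding unit_uniform_def
      by (subst emeasure_restrict_space) (auto simp: emeasure_eq_ennreal_measure less_top)
  qed
  then have "emeasure \<rho> (chosen x w) =
      (\<Sum>e\<in>E. ennreal (1 / card E) * ennreal (measure lborel {U \<in> {0<..<1}. \<sigma> x (e, U) = w}))"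
    by (simp add: emeasure_mark_law)
  also have "\<dots> = ennreal (\<Sum>e\<in>E. 1 / card E * measure lborel {U \<in> {0<..<1}. \<sigma> x (e, U) = w})"
    by (simp add: ennreal_mult[symmetric] sum_ennreal)
  finally show ?thesis by (simp add: rate_def sum_divide_distrib)
qed

lemma measure_chosen: "measure \<rho> (chosen x w) = rate E ori p x w / card E"
  using emeasure_chosen[of x w]
  by (simp add: mark.emeasure_eq_measure rate_def sum_nonneg)

abbreviation mark_kernel :: "'v profile \<Rightarrow> 'v \<Rightarrow> 'v mark \<Rightarrow> 'v mark measure" where
  "mark_kernel x j \<equiv> resample \<rho> (chosen x j)"

abbreviation mark_cond :: "'v profile \<Rightarrow> 'v \<Rightarrow> 'v mark measure" where
  "mark_cond x j \<equiv> cond_on \<rho> (chosen x j)"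

text \<open>An edge disjoint from the closed neighborhood does not contain \<open>j\<close>, and a
  mark selects only endpoints of its edge, so no mark of such a fiber lies in
  \<open>chosen x j\<close>.\<close>

lemma mark_kernel_local:
  assumes "e \<in> E" "e \<inter> closed_nbhd E j = {}" "U \<in> {0<..<1}"
  shows "mark_kernel x j (e, U) = return \<rho> (e, U)"
proof -
  have "j \<notin> e" using assms(2) by (auto simp: closed_nbhd_def)
  then have "\<sigma> x (e, U) \<noteq> j" using sel_in_edge[OF assms(1)] by metis
  then show ?thesis by (simp add: resample_def chosen_def)
qed

text \<open>Coordinate 0 is the initial mark, and coordinate \<open>Suc h\<close> is the replacement
  kept ready for event \<open>h\<close>. Drawing all of them independently in advance makes the
  chain a deterministic function on a product space.\<close>

primrec noise_law :: "'v path \<Rightarrow> nat \<Rightarrow> 'v mark measure" where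
  "noise_law \<gamma> 0 = \<rho>"
| "noise_law \<gamma> (Suc h) = mark_cond (path_profile \<gamma> h) (path_selected \<gamma> h)"

lemma prob_space_noise: "prob_space (noise_law \<gamma> h)"
  by (cases h) (simp_all add: mark.prob_space_axioms mark.prob_space_cond_on)

lemma sets_noise [simp, measurable_cong]: "sets (noise_law \<gamma> h) = sets \<rho>"
  by (cases h) simp_all

lemma space_noise [simp]: "space (noise_law \<gamma> h) = space \<rho>"
  by (cases h) simp_all

primrec chain :: "'v path \<Rightarrow> (nat \<Rightarrow> 'v mark) \<Rightarrow> nat \<Rightarrow> 'v mark" where
  "chain \<gamma> a 0 = a 0"
| "chain \<gamma> a (Suc h) =
     (if \<sigma> (path_profile \<gamma> h) (chain \<gamma> a h) = path_selected \<gamma> h then a (Suc h) else chain \<gamma> a h)"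

abbreviation marks_space :: "(nat \<Rightarrow> 'v mark) measure" where
  "marks_space \<equiv> \<Pi>\<^sub>M h\<in>(UNIV :: nat set). \<rho>"

definition aux_law :: "'v path \<Rightarrow> (nat \<Rightarrow> 'v mark) measure" where
  "aux_law \<gamma> = distr (PiM UNIV (noise_law \<gamma>)) marks_space (chain \<gamma>)"

lemma sets_PiM_noise [measurable_cong]: "sets (PiM UNIV (noise_law \<gamma>)) = sets marks_space"
  by (rule sets_PiM_cong) simp_all

lemma measurable_sel_path:
  assumes "c \<in> N \<rightarrow>\<^sub>M \<rho>" "g \<in> N \<rightarrow>\<^sub>M path_space"
  shows "(\<lambda>y. \<sigma> (path_profile (g y) h) (c y)) \<in> N \<rightarrow>\<^sub>M count_space UNIV"
  by (rule measurable_compose_countable[OF measurable_compose[OF assms(1) measurable_sel]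
        measurable_compose[OF assms(2) measurable_path_profile]])

lemma measurable_chain_joint:
  "(\<lambda>(\<gamma>, a). chain \<gamma> a) \<in> path_space \<Otimes>\<^sub>M marks_space \<rightarrow>\<^sub>M marks_space"
  unfolding case_prod_beta
proof (rule measurable_abs_UNIV)
  fix h
  show "(\<lambda>y. chain (fst y) (snd y) h) \<in> path_space \<Otimes>\<^sub>M marks_space \<rightarrow>\<^sub>M \<rho>"
  proof (induction h)
    case 0
    then show ?case by simp
  next
    case (Suc h)
    note [measurable] = Suc measurable_sel_path[OF Suc measurable_fst]
    show ?case by simp
  qed
qed

lemma measurable_chain [measurable]: "chain \<gamma> \<in> marks_space \<rightarrow>\<^sub>M marks_space"
  using measurable_compose[OF measurable_Pair1' measurable_chain_joint, of \<gamma>]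
  by (simp add: path_space_def space_pair_measure space_PiM)

text \<open>Testing finite boxes suffices. There the product measure is a finite product of factors,
  each depending on the path through at most one profile and one selected vertex, both
  discrete.\<close>

lemma measurable_noise_path: "(\<lambda>\<gamma>. PiM UNIV (noise_law \<gamma>)) \<in> path_space \<rightarrow>\<^sub>M prob_algebra marks_space"
proof (rule measurable_prob_algebra_generated[OF sets_PiM Int_stable_prod_algebra prod_algebra_sets_into_space])
  fix \<gamma> :: "'v path"
  show "prob_space (PiM UNIV (noise_law \<gamma>))" by (intro prob_space_PiM prob_space_noise)
  show "sets (PiM UNIV (noise_law \<gamma>)) = sets marks_space" by (rule sets_PiM_noise)
next
  fix A assume "A \<in> prod_algebra UNIV (\<lambda>_ :: nat. \<rho>)"
  then obtain J F where A: "A = prod_emb UNIV (\<lambda>_. \<rho>) J (Pi\<^sub>E J F)" "finite J" "\<And>i. i \<in> J \<Longrightarrow> F i \<in> sets \<rho>"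
    by (rule prod_algebraE) auto
  have "emeasure (PiM UNIV (noise_law \<gamma>)) A = (\<Prod>i\<in>J. emeasure (noise_law \<gamma> i) (F i))" for \<gamma>
  proof -
    have "A = prod_emb UNIV (noise_law \<gamma>) J (Pi\<^sub>E J F)" by (simp add: A(1) prod_emb_def)
    then show ?thesis using A(2,3) prob_space_noise by (simp add: emeasure_PiM_emb)
  qed
  moreover have "(\<lambda>\<gamma>. emeasure (noise_law \<gamma> i) (F i)) \<in> borel_measurable path_space" for i
  proof (cases i)
    case (Suc h)
    have "(\<lambda>\<gamma>. emeasure (mark_cond (path_profile \<gamma> h) (path_selected \<gamma> h)) (F i)) \<in> borel_measurable path_space"
    proof (rule measurable_compose_countable[OF _ measurable_path_profile])
      show "(\<lambda>\<gamma>. emeasure (mark_cond x (path_selected \<gamma> h)) (F i)) \<in> borel_measurable path_space" for x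
        by (rule measurable_compose[OF measurable_path_selected]) simp
    qed
    then show ?thesis by (simp add: Suc)
  qed simp
  ultimately show "(\<lambda>\<gamma>. emeasure (PiM UNIV (noise_law \<gamma>)) A) \<in> borel_measurable path_space"
    by simp
qed

lemma measurable_aux_law: "aux_law \<in> path_space \<rightarrow>\<^sub>M prob_algebra marks_space"
  unfolding aux_law_def[abs_def]
  by (rule measurable_distr_prob_space2[OF measurable_noise_path measurable_chain_joint])

lemma aux_law_space: "aux_law \<gamma> \<in> space (prob_algebra marks_space)"
  using measurable_space[OF measurable_aux_law, of \<gamma>] by simp

lemma sets_aux_law [simp, measurable_cong]: "sets (aux_law \<gamma>) = sets marks_space"
  by (simp add: aux_law_def)

lemma space_aux_law [simp]: "space (aux_law \<gamma>) = space marks_space"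
  by (simp add: aux_law_def)

lemma chain_cong: "(\<And>i. i \<le> h \<Longrightarrow> a i = a' i) \<Longrightarrow> chain \<gamma> a h = chain \<gamma> a' h"
  by (induction h) simp_all

lemma measurable_mark_kernel:
  assumes C: "C \<in> sets \<rho>"
  shows "(\<lambda>c. emeasure (mark_kernel x j c) C) \<in> borel_measurable \<rho>"
  using measurable_compose[OF mark.measurable_resample[OF chosen_sets, THEN measurable_prob_algebraD]
      measurable_emeasure_subprob_algebra[OF C]] .

lemma nn_integral_aux_law:
  "f \<in> borel_measurable marks_space \<Longrightarrow> (\<integral>\<^sup>+b. f b \<partial>aux_law \<gamma>) = (\<integral>\<^sup>+a. f (chain \<gamma> a) \<partial>PiM UNIV (noise_law \<gamma>))"
  unfolding aux_law_def by (subst nn_integral_distr) simp_all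

text \<open>The chain up to step \<open>h\<close> does not look at noise coordinate
  \<open>Suc h\<close>, so this coordinate can be integrated out alone: it yields the conditioned
  law if the current mark is resampled and a point mass otherwise.\<close>

lemma aux_law_step:
  assumes A[measurable]: "A \<in> sets (\<Pi>\<^sub>M k\<in>{..h}. \<rho>)" and C[measurable]: "C \<in> sets \<rho>"
  shows "emeasure (aux_law \<gamma>) {b \<in> space marks_space. restrict b {..h} \<in> A \<and> b (Suc h) \<in> C} =
    (\<integral>\<^sup>+b. indicator A (restrict b {..h}) *
       emeasure (mark_kernel (path_profile \<gamma> h) (path_selected \<gamma> h) (b h)) C \<partial>aux_law \<gamma>)"
proof -
  let ?N = "noise_law \<gamma>" and ?k = "Suc h"
  let ?P = "PiM (UNIV - {?k}) ?N"
  let ?K = "mark_kernel (path_profile \<gamma> h) (path_selected \<gamma> h)"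
  note [measurable] = measurable_mark_kernel[OF C]
  have r[measurable]: "(\<lambda>b. restrict b {..h}) \<in> marks_space \<rightarrow>\<^sub>M (\<Pi>\<^sub>M k\<in>{..h}. \<rho>)"
    by (rule measurable_restrict_subset) simp
  let ?ind = "\<lambda>b. indicator A (restrict b {..h}) :: ennreal"
  have ind[measurable]: "?ind \<in> borel_measurable marks_space" by measurable
  have split: "(\<integral>\<^sup>+a. f a \<partial>PiM UNIV ?N) = (\<integral>\<^sup>+a. \<integral>\<^sup>+x. f (a(?k := x)) \<partial>?N ?k \<partial>?P)"
    if "f \<in> borel_measurable marks_space" for f
    by (rule nn_integral_PiM_split) (use that in \<open>auto simp: prob_space_noise cong: measurable_cong_sets[OF sets_PiM_noise refl]\<close>)
  have upd: "restrict (chain \<gamma> (a(?k := x))) {..h} = restrict (chain \<gamma> a) {..h}"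
    "chain \<gamma> (a(?k := x)) h = chain \<gamma> a h" for a x
    by (auto simp: restrict_def fun_eq_iff intro!: chain_cong)
  have "emeasure (aux_law \<gamma>) {b \<in> space marks_space. restrict b {..h} \<in> A \<and> b ?k \<in> C} =
      (\<integral>\<^sup>+b. indicator {b \<in> space marks_space. restrict b {..h} \<in> A \<and> b ?k \<in> C} b \<partial>aux_law \<gamma>)"
    by (rule nn_integral_indicator[symmetric]) measurable
  also have "\<dots> = (\<integral>\<^sup>+b. ?ind b * indicator C (b ?k) \<partial>aux_law \<gamma>)"
    by (intro nn_integral_cong) (auto simp: indicator_def)
  also have "\<dots> = (\<integral>\<^sup>+a. ?ind (chain \<gamma> a) * indicator C (chain \<gamma> a ?k) \<partial>PiM UNIV ?N)"
    by (rule nn_integral_aux_law) measurable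
  also have "\<dots> = (\<integral>\<^sup>+a. \<integral>\<^sup>+x. ?ind (chain \<gamma> (a(?k := x))) * indicator C (chain \<gamma> (a(?k := x)) ?k) \<partial>?N ?k \<partial>?P)"
    by (rule split) measurable
  \<comment> \<open>On the right the inner integrand no longer depends on \<open>x\<close>; the
    integral over \<open>x\<close> is kept so that \<open>split\<close> can be undone
    afterwards.\<close>
  also have "\<dots> = (\<integral>\<^sup>+a. \<integral>\<^sup>+x. ?ind (chain \<gamma> (a(?k := x))) * emeasure (?K (chain \<gamma> (a(?k := x)) h)) C \<partial>?N ?k \<partial>?P)"
  proof (rule nn_integral_cong)
    fix a assume a: "a \<in> space ?P"
    interpret N: prob_space "?N ?k" by (rule prob_space_noise)
    have one: "emeasure (?N ?k) (space \<rho>) = 1" using N.emeasure_space_1 by (simp only: space_noise)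
    \<comment> \<open>Here \<open>a\<close> lacks coordinate \<open>?k\<close>; any filler
      \<open>y\<close> completes it to a point of \<open>marks_space\<close>, and step
      \<open>h\<close> of the chain does not see the filler.\<close>
    have sp: "chain \<gamma> a h \<in> space \<rho>"
    proof -
      obtain y where y: "y \<in> space \<rho>" using mark.not_empty by auto
      have "a(?k := y) \<in> space marks_space" using a y by (auto simp: space_PiM PiE_iff extensional_def)
      from measurable_space[OF measurable_chain this, of \<gamma>] have "chain \<gamma> (a(?k := y)) h \<in> space \<rho>"
        by (auto simp: space_PiM)
      then show ?thesis by (simp only: upd)
    qed
    have "(\<integral>\<^sup>+x. indicator C (chain \<gamma> (a(?k := x)) ?k) \<partial>?N ?k) = emeasure (?K (chain \<gamma> a h)) C"
    proof (cases "\<sigma> (path_profile \<gamma> h) (chain \<gamma> a h) = path_selected \<gamma> h")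
      case True
      then have "(\<integral>\<^sup>+x. indicator C (chain \<gamma> (a(?k := x)) ?k) \<partial>?N ?k) = (\<integral>\<^sup>+x. indicator C x \<partial>?N ?k)"
        by (simp add: upd del: noise_law.simps)
      also have "\<dots> = emeasure (?N ?k) C" by (rule nn_integral_indicator) simp
      finally show ?thesis using True sp by (simp add: resample_def chosen_def)
    next
      case False
      then have "(\<integral>\<^sup>+x. indicator C (chain \<gamma> (a(?k := x)) ?k) \<partial>?N ?k) = indicator C (chain \<gamma> a h)"
        by (simp add: upd one del: noise_law.simps)
      then show ?thesis using False by (simp add: resample_def chosen_def)
    qed
    then show "(\<integral>\<^sup>+x. ?ind (chain \<gamma> (a(?k := x))) * indicator C (chain \<gamma> (a(?k := x)) ?k) \<partial>?N ?k) =
       (\<integral>\<^sup>+x. ?ind (chain \<gamma> (a(?k := x))) * emeasure (?K (chain \<gamma> (a(?k := x)) h)) C \<partial>?N ?k)"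
      by (cases "restrict (chain \<gamma> a) {..h} \<in> A")
        (simp_all add: upd one del: noise_law.simps chain.simps)
  qed
  also have "\<dots> = (\<integral>\<^sup>+a. ?ind (chain \<gamma> a) * emeasure (?K (chain \<gamma> a h)) C \<partial>PiM UNIV ?N)"
    by (rule split[symmetric]) measurable
  also have "\<dots> = (\<integral>\<^sup>+b. ?ind b * emeasure (?K (b h)) C \<partial>aux_law \<gamma>)"
    by (rule nn_integral_aux_law[symmetric]) measurable
  finally show ?thesis .
qed

lemma distr_aux_law_0: "distr (aux_law \<gamma>) \<rho> (\<lambda>b. b 0) = \<rho>"
proof -
  have "distr (aux_law \<gamma>) \<rho> (\<lambda>b. b 0) = distr (PiM UNIV (noise_law \<gamma>)) \<rho> (\<lambda>a. a 0)"
    unfolding aux_law_def by (subst distr_distr) (auto simp: comp_def)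
  also have "\<dots> = \<rho>"
    using distr_PiM_component[of UNIV "noise_law \<gamma>" 0] prob_space_noise by simp
  finally show ?thesis .
qed

lemma markov_chain_aux_law:
  "markov_chain_law \<rho> \<rho> (\<lambda>h. mark_kernel (path_profile \<gamma> h) (path_selected \<gamma> h)) (aux_law \<gamma>)"
  unfolding markov_chain_law_def
proof (intro conjI allI ballI aux_law_space distr_aux_law_0)
  fix h :: nat and A C assume A[measurable]: "A \<in> sets (\<Pi>\<^sub>M k\<in>{..h}. \<rho>)" and C[measurable]: "C \<in> sets \<rho>"
  let ?K = "mark_kernel (path_profile \<gamma> h) (path_selected \<gamma> h)"
  have r[measurable]: "(\<lambda>b. restrict b {..h}) \<in> marks_space \<rightarrow>\<^sub>M (\<Pi>\<^sub>M k\<in>{..h}. \<rho>)"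
    by (rule measurable_restrict_subset) simp
  note [measurable] = measurable_mark_kernel[OF C]
  have K: "emeasure (?K c) C = ennreal (measure (?K c) C)" if "c \<in> space \<rho>" for c
    using measurable_space[OF mark.measurable_resample[OF chosen_sets] that]
    by (auto simp: space_prob_algebra finite_measure.emeasure_eq_measure prob_space.finite_measure)
  have "(\<integral>b. indicat_real A (restrict b {..h}) * measure (?K (b h)) C \<partial>aux_law \<gamma>) =
      enn2real (\<integral>\<^sup>+b. ennreal (indicat_real A (restrict b {..h}) * measure (?K (b h)) C) \<partial>aux_law \<gamma>)"
    unfolding measure_def by (rule integral_eq_nn_integral) auto
  also have "(\<integral>\<^sup>+b. ennreal (indicat_real A (restrict b {..h}) * measure (?K (b h)) C) \<partial>aux_law \<gamma>) =
      (\<integral>\<^sup>+b. indicator A (restrict b {..h}) * emeasure (?K (b h)) C \<partial>aux_law \<gamma>)"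
  proof (rule nn_integral_cong)
    fix b assume "b \<in> space (aux_law \<gamma>)"
    then have "b h \<in> space \<rho>" by (auto simp: space_PiM)
    then show "ennreal (indicat_real A (restrict b {..h}) * measure (?K (b h)) C) =
        indicator A (restrict b {..h}) * emeasure (?K (b h)) C"
      by (simp add: K indicator_def)
  qed
  finally show "measure (aux_law \<gamma>) {b \<in> space (aux_law \<gamma>). restrict b {..h} \<in> A \<and> b (Suc h) \<in> C} =
      (\<integral>b. indicat_real A (restrict b {..h}) * measure (?K (b h)) C \<partial>aux_law \<gamma>)"
    unfolding measure_def space_aux_law aux_law_step[OF A C] by (rule sym)
qed

text \<open>Every kernel preserves \<rho> by \<open>bind_resample\<close>, whatever the path. The
  step formula is used with the trivial past event.\<close>

lemma distr_aux_law: "distr (aux_law \<gamma>) \<rho> (\<lambda>b. b h) = \<rho>"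
proof (induction h)
  case 0
  then show ?case by (rule distr_aux_law_0)
next
  case (Suc h)
  let ?K = "mark_kernel (path_profile \<gamma> h) (path_selected \<gamma> h)"
  show ?case
  proof (rule measure_eqI)
    fix C assume "C \<in> sets (distr (aux_law \<gamma>) \<rho> (\<lambda>b. b (Suc h)))"
    then have C[measurable]: "C \<in> sets \<rho>" by simp
    note [measurable] = measurable_mark_kernel[OF C]
    have "emeasure (distr (aux_law \<gamma>) \<rho> (\<lambda>b. b (Suc h))) C =
        emeasure (aux_law \<gamma>) {b \<in> space marks_space. restrict b {..h} \<in> space (\<Pi>\<^sub>M k\<in>{..h}. \<rho>) \<and> b (Suc h) \<in> C}"
      by (subst emeasure_distr) (auto intro!: arg_cong[where f = "emeasure (aux_law \<gamma>)"] simp: space_PiM)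
    also have "\<dots> = (\<integral>\<^sup>+b. indicator (space (\<Pi>\<^sub>M k\<in>{..h}. \<rho>)) (restrict b {..h}) * emeasure (?K (b h)) C \<partial>aux_law \<gamma>)"
      by (rule aux_law_step) auto
    also have "\<dots> = (\<integral>\<^sup>+b. emeasure (?K (b h)) C \<partial>aux_law \<gamma>)"
      by (intro nn_integral_cong) (auto simp: indicator_def space_PiM)
    also have "\<dots> = (\<integral>\<^sup>+c. emeasure (?K c) C \<partial>distr (aux_law \<gamma>) \<rho> (\<lambda>b. b h))"
      by (subst nn_integral_distr) auto
    also have "\<dots> = emeasure (\<rho> \<bind> ?K) C"
      unfolding Suc using mark.prob_space_axioms
      by (intro emeasure_bind_prob_algebra[symmetric, OF _ mark.measurable_resample[OF chosen_sets] C])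
        (simp add: space_prob_algebra)
    also have "\<dots> = emeasure \<rho> C" by (simp add: mark.bind_resample)
    finally show "emeasure (distr (aux_law \<gamma>) \<rho> (\<lambda>b. b (Suc h))) C = emeasure \<rho> C" .
  qed simp
qed

end

subsection \<open>Conditional laws given the selected base path\<close>

lemma map_upt_eq_iff: "map f [0..<n] = l \<longleftrightarrow> length l = n \<and> (\<forall>i<n. f i = l ! i)"
  by (auto simp: list_eq_iff_nth_eq)

text \<open>Every event of the sigma-algebra generated by \<open>Y\<close> is the preimage of some
  \<open>C\<close> in \<open>S\<close>, so the defining property of the conditional expectation need
  only be tested on these. The rest translates between nonnegative and Bochner integrals.\<close>

lemma cond_prob_given_eqI:
  assumes M: "prob_space M" and Y[measurable]: "Y \<in> M \<rightarrow>\<^sub>M S" and g[measurable]: "g \<in> borel_measurable S"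
    and g01: "\<And>y. 0 \<le> g y" "\<And>y. g y \<le> 1"
    and P[measurable]: "{\<omega> \<in> space M. P \<omega>} \<in> sets M"
    and eq: "\<And>C. C \<in> sets S \<Longrightarrow> emeasure M {\<omega> \<in> space M. Y \<omega> \<in> C \<and> P \<omega>} =
      (\<integral>\<^sup>+\<omega>. indicator C (Y \<omega>) * ennreal (g (Y \<omega>)) \<partial>M)"
  shows "AE \<omega> in M. cond_prob_given M Y S P \<omega> = g (Y \<omega>)"
proof -
  interpret prob_space M by fact
  define F where "F = vimage_algebra (space M) Y S"
  have Y_sp: "Y \<in> space M \<rightarrow> space S" using measurable_space[OF Y] by auto
  have YF: "Y \<in> F \<rightarrow>\<^sub>M S" unfolding F_def by (rule measurable_vimage_algebra1[OF Y_sp])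
  have sub: "subalgebra M F"
    by (auto simp: subalgebra_def F_def sets_vimage_algebra2[OF Y_sp])
  interpret finite_measure_subalgebra M F by unfold_locales (rule sub)
  let ?f = "indicat_real {\<omega> \<in> space M. P \<omega>}"
  have int_g: "integrable M (\<lambda>\<omega>. g (Y \<omega>))"
    by (rule integrable_const_bound[where B = 1]) (use g01 in auto)
  have "AE \<omega> in M. real_cond_exp M F ?f \<omega> = g (Y \<omega>)"
  proof (rule real_cond_exp_charact)
    show "(\<lambda>\<omega>. g (Y \<omega>)) \<in> borel_measurable F" using YF by (rule measurable_compose) (rule g)
    fix A assume "A \<in> sets F"
    then obtain C where C[measurable]: "C \<in> sets S" and A: "A = Y -` C \<inter> space M"
      by (auto simp: F_def sets_vimage_algebra2[OF Y_sp])
    have "(LINT \<omega>:A|M. ?f \<omega>) = (\<integral>\<omega>. indicat_real {\<omega> \<in> space M. Y \<omega> \<in> C \<and> P \<omega>} \<omega> \<partial>M)"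
      unfolding set_lebesgue_integral_def
      by (intro Bochner_Integration.integral_cong) (auto simp: A indicator_def)
    also have "\<dots> = prob {\<omega> \<in> space M. Y \<omega> \<in> C \<and> P \<omega>}"
      by (simp add: Int_def conj_commute)
    also have "\<dots> = enn2real (\<integral>\<^sup>+\<omega>. indicator C (Y \<omega>) * ennreal (g (Y \<omega>)) \<partial>M)"
      by (simp add: measure_def eq)
    also have "(\<integral>\<^sup>+\<omega>. indicator C (Y \<omega>) * ennreal (g (Y \<omega>)) \<partial>M) =
        (\<integral>\<^sup>+\<omega>. ennreal (indicator A \<omega> *\<^sub>R g (Y \<omega>)) \<partial>M)"
      by (intro nn_integral_cong) (auto simp: A indicator_def)
    also have "enn2real \<dots> = (LINT \<omega>:A|M. g (Y \<omega>))"
      unfolding set_lebesgue_integral_def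
      by (rule integral_eq_nn_integral[symmetric]) (use g01 in \<open>auto simp: A\<close>)
    finally show "(LINT \<omega>:A|M. ?f \<omega>) = (LINT \<omega>:A|M. g (Y \<omega>))" .
  qed (use int_g in \<open>auto simp: less_top[symmetric]\<close>)
  then show ?thesis by (simp add: cond_prob_given_def F_def)
qed

context local_rule
begin

lemma measurable_sel_mark:
  assumes "(\<lambda>y. X y) \<in> N \<rightarrow>\<^sub>M count_space UNIV" "a \<in> N \<rightarrow>\<^sub>M \<rho>"
  shows "(\<lambda>y. \<sigma> (X y) (a y)) \<in> N \<rightarrow>\<^sub>M count_space UNIV"
  by (rule measurable_compose_countable[OF measurable_compose[OF assms(2) measurable_sel] assms(1)])

lemma measurable_load: "(\<lambda>d. load E ori p x d h) \<in> driving_law E \<rightarrow>\<^sub>M count_space UNIV"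
proof (induction h)
  case (Suc h)
  have "(\<lambda>d. add_ball y (\<sigma> (load E ori p x d h) (event_mark E d h))) \<in> driving_law E \<rightarrow>\<^sub>M count_space UNIV" for y
    by (rule measurable_compose_discrete[OF measurable_sel_mark[OF Suc measurable_event_mark]])
  from measurable_compose_countable[OF this Suc] show ?case by simp
qed simp

lemma measurable_selected: "(\<lambda>d. selected E ori p x d h) \<in> driving_law E \<rightarrow>\<^sub>M count_space UNIV"
  unfolding selected_def by (rule measurable_sel_mark[OF measurable_load measurable_event_mark])

lemma measurable_tag_step [measurable]: "tag_step x w \<in> \<rho> \<rightarrow>\<^sub>M count_space UNIV"
  unfolding tag_step_def[abs_def] by measurable

lemma measurable_tag: "(\<lambda>d. tag E ori p x v d h) \<in> driving_law E \<rightarrow>\<^sub>M count_space UNIV"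
proof (induction h)
  case 0
  then show ?case by (simp add: tag_0)
next
  case (Suc h)
  have "(\<lambda>d. tag_step y w (event_mark E d h)) \<in> driving_law E \<rightarrow>\<^sub>M count_space UNIV" for y w
    by (rule measurable_compose[OF measurable_event_mark measurable_tag_step])
  then have "(\<lambda>d. tag_step y (tag E ori p x v d h) (event_mark E d h)) \<in> driving_law E \<rightarrow>\<^sub>M count_space UNIV" for y
    by (rule measurable_compose_countable[OF _ Suc])
  from measurable_compose_countable[OF this measurable_load] show ?case by (simp add: tag_Suc)
qed

text \<open>The common one-step law: when \<open>j\<close> is selected at \<open>x\<close>, it
  governs both the move of the tag from \<open>w\<close> to \<open>w'\<close> and the move of the
  vertex read off from the auxiliary mark. The next two lemmas establish the two halves.\<close>

definition trans_prob :: "'v profile \<Rightarrow> 'v \<Rightarrow> 'v \<Rightarrow> 'v \<Rightarrow> ennreal" where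
  "trans_prob x j w w' =
     (if w = j then emeasure (mark_cond x j) (chosen (add_ball x j) w') else if w' = w then 1 else 0)"

lemma emeasure_sel_tag_step:
  "emeasure \<rho> {a \<in> space \<rho>. \<sigma> x a = j \<and> tag_step x w a = w'} =
     emeasure \<rho> (chosen x j) * trans_prob x j w w'"
proof (cases "w = j")
  case True
  then have "{a \<in> space \<rho>. \<sigma> x a = j \<and> tag_step x w a = w'} = chosen x j \<inter> chosen (add_ball x j) w'"
    by (auto simp: chosen_def tag_step_def)
  then show ?thesis using True by (simp add: trans_prob_def mark.emeasure_cond_on)
next
  case False
  then have "{a \<in> space \<rho>. \<sigma> x a = j \<and> tag_step x w a = w'} = (if w' = w then chosen x j else {})"
    by (auto simp: chosen_def tag_step_def)
  then show ?thesis using False by (simp add: trans_prob_def)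
qed

text \<open>The right side sees \<open>b\<close> only through \<open>\<sigma> x b\<close>, which is
  why the projected process is again Markov. A resampled mark is read at the new profile under the
  conditioned law; an unchanged one gives the same vertex there by
  \<open>sel_add_ball\<close>.\<close>

lemma emeasure_mark_kernel_chosen:
  assumes b: "b \<in> space \<rho>"
  shows "emeasure (mark_kernel x j b) (chosen (add_ball x j) w') = trans_prob x j (\<sigma> x b) w'"
proof (cases "\<sigma> x b = j")
  case True
  then show ?thesis using b by (simp add: resample_def trans_prob_def chosen_def)
next
  case False
  have "fst b \<in> E" using b by (auto simp: space_mark_law)
  then have "\<sigma> (add_ball x j) b = \<sigma> x b" using sel_add_ball False by simp
  then show ?thesis using False b by (auto simp: resample_def trans_prob_def chosen_def indicator_def)
qed

text \<open>On the past event the current vertex is known to be \<open>w n\<close>, so the kernel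
  term is a constant that leaves the integral, and the projected transitions multiply up.\<close>

lemma emeasure_aux_law_cylinder:
  "emeasure (aux_law \<gamma>) {b \<in> space marks_space. \<forall>i\<le>n. \<sigma> (path_profile \<gamma> i) (b i) = w i} =
     emeasure \<rho> (chosen (path_profile \<gamma> 0) (w 0)) *
     (\<Prod>i<n. trans_prob (path_profile \<gamma> i) (path_selected \<gamma> i) (w i) (w (Suc i)))"
proof (induction n)
  case 0
  have "emeasure (aux_law \<gamma>) {b \<in> space marks_space. \<forall>i\<le>0. \<sigma> (path_profile \<gamma> i) (b i) = w i} =
      emeasure (distr (aux_law \<gamma>) \<rho> (\<lambda>b. b 0)) (chosen (path_profile \<gamma> 0) (w 0))"
    by (subst emeasure_distr) (auto intro!: arg_cong[where f = "emeasure (aux_law \<gamma>)"] simp: chosen_def space_PiM)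
  then show ?case by (simp add: distr_aux_law_0)
next
  case (Suc n)
  let ?x = "path_profile \<gamma>" and ?s = "path_selected \<gamma>"
  define A where "A = {c \<in> space (\<Pi>\<^sub>M k\<in>{..n}. \<rho>). \<forall>i\<in>{..n}. \<sigma> (?x i) (c i) = w i}"
  have A[measurable]: "A \<in> sets (\<Pi>\<^sub>M k\<in>{..n}. \<rho>)"
    unfolding A_def
  proof (intro sets.sets_Collect_finite_All)
    fix i assume "i \<in> {..n}"
    then have c: "(\<lambda>c. c i) \<in> (\<Pi>\<^sub>M k\<in>{..n}. \<rho>) \<rightarrow>\<^sub>M \<rho>"
      by (rule measurable_component_singleton)
    have "(\<lambda>c. \<sigma> (?x i) (c i)) \<in> (\<Pi>\<^sub>M k\<in>{..n}. \<rho>) \<rightarrow>\<^sub>M count_space UNIV"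
      by (rule measurable_compose[OF c measurable_sel])
    then show "{c \<in> space (\<Pi>\<^sub>M k\<in>{..n}. \<rho>). \<sigma> (?x i) (c i) = w i} \<in> sets (\<Pi>\<^sub>M k\<in>{..n}. \<rho>)"
      by measurable
  qed simp
  have memA: "restrict b {..n} \<in> A \<longleftrightarrow> (\<forall>i\<le>n. \<sigma> (?x i) (b i) = w i)" if "b \<in> space marks_space" for b
    using that by (auto simp: A_def space_PiM)
  have "emeasure (aux_law \<gamma>) {b \<in> space marks_space. \<forall>i\<le>Suc n. \<sigma> (?x i) (b i) = w i} =
     emeasure (aux_law \<gamma>) {b \<in> space marks_space. restrict b {..n} \<in> A \<and> b (Suc n) \<in> chosen (?x (Suc n)) (w (Suc n))}"
    by (rule arg_cong[where f = "emeasure (aux_law \<gamma>)"])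
      (auto simp: memA chosen_def le_Suc_eq space_PiM)
  also have "\<dots> = (\<integral>\<^sup>+b. indicator A (restrict b {..n}) *
      emeasure (mark_kernel (?x n) (?s n) (b n)) (chosen (?x (Suc n)) (w (Suc n))) \<partial>aux_law \<gamma>)"
    by (rule aux_law_step) auto
  also have "\<dots> = (\<integral>\<^sup>+b. indicator {b \<in> space marks_space. \<forall>i\<le>n. \<sigma> (?x i) (b i) = w i} b *
      trans_prob (?x n) (?s n) (w n) (w (Suc n)) \<partial>aux_law \<gamma>)"
  proof (rule nn_integral_cong)
    fix b assume "b \<in> space (aux_law \<gamma>)"
    then have b: "b \<in> space marks_space" "b n \<in> space \<rho>" by (auto simp: space_PiM)
    show "indicator A (restrict b {..n}) *
        emeasure (mark_kernel (?x n) (?s n) (b n)) (chosen (?x (Suc n)) (w (Suc n))) =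
       indicator {b \<in> space marks_space. \<forall>i\<le>n. \<sigma> (?x i) (b i) = w i} b *
        trans_prob (?x n) (?s n) (w n) (w (Suc n))"
      using b memA[OF b(1)] by (auto simp: indicator_def path_profile_Suc emeasure_mark_kernel_chosen)
  qed
  also have "\<dots> = emeasure (aux_law \<gamma>) {b \<in> space marks_space. \<forall>i\<le>n. \<sigma> (?x i) (b i) = w i} *
      trans_prob (?x n) (?s n) (w n) (w (Suc n))"
  proof -
    have "{b \<in> space marks_space. \<forall>i\<le>n. \<sigma> (?x i) (b i) = w i} =
        (\<lambda>b. restrict b {..n}) -` A \<inter> space marks_space"
      by (auto simp: memA)
    also have "\<dots> \<in> sets (aux_law \<gamma>)"
      unfolding sets_aux_law by (rule measurable_sets[OF measurable_restrict_subset A]) simp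
    finally show ?thesis by (subst nn_integral_multc) simp_all
  qed
  finally show ?case by (simp add: Suc.IH mult.assoc)
qed

section \<open>The candidate conditional law of the tag and the generating cylinders\<close>

abbreviation tag_space :: "(nat \<Rightarrow> 'v) measure" where
  "tag_space \<equiv> \<Pi>\<^sub>M h\<in>(UNIV :: nat set). count_space UNIV"

definition tag_kernel :: "'v path \<Rightarrow> (nat \<Rightarrow> 'v) measure" where
  "tag_kernel \<gamma> = distr (aux_law \<gamma>) tag_space (\<lambda>b h. \<sigma> (path_profile \<gamma> h) (b h))"

lemma measurable_sel_chain: "(\<lambda>b h. \<sigma> (path_profile \<gamma> h) (b h)) \<in> marks_space \<rightarrow>\<^sub>M tag_space"
  by (rule measurable_abs_UNIV, rule measurable_compose[OF _ measurable_sel]) simp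

lemma measurable_tag_kernel: "tag_kernel \<in> path_space \<rightarrow>\<^sub>M prob_algebra tag_space"
  unfolding tag_kernel_def[abs_def]
proof (rule measurable_distr_prob_space2[OF measurable_aux_law])
  show "(\<lambda>(\<gamma>, b). \<lambda>h. \<sigma> (path_profile \<gamma> h) (b h)) \<in> path_space \<Otimes>\<^sub>M marks_space \<rightarrow>\<^sub>M tag_space"
    unfolding case_prod_beta
    by (rule measurable_abs_UNIV, rule measurable_sel_path) simp_all
qed

lemma emeasure_tag_kernel:
  "A \<in> sets tag_space \<Longrightarrow> emeasure (tag_kernel \<gamma>) A =
     emeasure (aux_law \<gamma>) {b \<in> space marks_space. (\<lambda>h. \<sigma> (path_profile \<gamma> h) (b h)) \<in> A}"
  unfolding tag_kernel_def
  by (subst emeasure_distr)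
    (auto intro!: arg_cong[where f = "emeasure (aux_law \<gamma>)"] simp: measurable_sel_chain cong: measurable_cong_sets)

text \<open>The first \<open>n\<close> selections accompany \<open>n\<close> tag transitions, hence
  \<open>n + 1\<close> tag positions. The set \<open>D\<close> constrains the entire sequence of
  event times, since the conditioning includes all of it.\<close>

definition cylinder :: "'v profile \<Rightarrow> (nat \<Rightarrow> real) set \<Rightarrow> (nat \<Rightarrow> 'v) \<Rightarrow> (nat \<Rightarrow> 'v) \<Rightarrow> nat \<Rightarrow> ('v path \<times> (nat \<Rightarrow> 'v)) set" where
  "cylinder x D s w n = {(\<gamma>, z). fst \<gamma> = x \<and> fst (snd \<gamma>) \<in> D \<and>
      (\<forall>i<n. path_selected \<gamma> i = s i) \<and> (\<forall>i\<le>n. z i = w i)}"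

abbreviation time_space :: "(nat \<Rightarrow> real) measure" where
  "time_space \<equiv> \<Pi>\<^sub>M h\<in>(UNIV :: nat set). borel"

text \<open>The other members fix an initial profile; \<open>UNIV\<close> is added because the
  uniqueness theorem for measures asks for generators that exhaust the space.\<close>

definition cylinders :: "('v path \<times> (nat \<Rightarrow> 'v)) set set" where
  "cylinders = insert UNIV {cylinder x D s w n |x D s w n. D \<in> sets time_space}"

text \<open>The longer cylinder prescribes all discrete data that the shorter one does, so the two
  are compatible or disjoint. The time set \<open>{}\<close> represents the empty set as a
  cylinder.\<close>

lemma cylinders_Int_le:
  assumes "n \<le> n'" "D \<in> sets time_space" "D' \<in> sets time_space"
  shows "cylinder x D s w n \<inter> cylinder x' D' s' w' n' \<in> cylinders"
proof -
  have "cylinder x D s w n \<inter> cylinder x' D' s' w' n' =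
     (if x = x' \<and> (\<forall>i<n. s i = s' i) \<and> (\<forall>i\<le>n. w i = w' i) then cylinder x' (D \<inter> D') s' w' n'
      else cylinder x' {} s' w' n')"
    using assms(1) by (auto simp: cylinder_def)
  moreover have "cylinder x' (D \<inter> D') s' w' n' \<in> cylinders" "cylinder x' {} s' w' n' \<in> cylinders"
    using assms(2,3) by (auto simp: cylinders_def intro!: exI)
  ultimately show ?thesis by simp
qed

lemma Int_stable_cylinders: "Int_stable cylinders"
proof (rule Int_stableI)
  fix a b assume ab: "a \<in> cylinders" "b \<in> cylinders"
  show "a \<inter> b \<in> cylinders"
  proof (cases "a = UNIV \<or> b = UNIV")
    case True
    then show ?thesis using ab by auto
  next
    case False
    with ab obtain x D s w n x' D' s' w' n' where
      a: "a = cylinder x D s w n" "D \<in> sets time_space" and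
      b: "b = cylinder x' D' s' w' n'" "D' \<in> sets time_space"
      unfolding cylinders_def by blast
    show ?thesis
      using cylinders_Int_le[of n n' D D' x s w x' s' w'] cylinders_Int_le[of n' n D' D x' s' w' x s w] a b
      by (cases "n \<le> n'") (auto simp: Int_commute)
  qed
qed

lemma measurable_path_tag [measurable]:
  "(\<lambda>y. fst (fst y)) \<in> path_space \<Otimes>\<^sub>M tag_space \<rightarrow>\<^sub>M count_space UNIV"
  "(\<lambda>y. fst (snd (fst y))) \<in> path_space \<Otimes>\<^sub>M tag_space \<rightarrow>\<^sub>M time_space"
  "(\<lambda>y. path_selected (fst y) i) \<in> path_space \<Otimes>\<^sub>M tag_space \<rightarrow>\<^sub>M count_space UNIV"
  "(\<lambda>y. snd y i) \<in> path_space \<Otimes>\<^sub>M tag_space \<rightarrow>\<^sub>M count_space UNIV"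
  unfolding path_selected_def path_space_def by measurable

lemma cylinder_sets:
  assumes [measurable]: "D \<in> sets time_space"
  shows "cylinder x D s w n \<in> sets (path_space \<Otimes>\<^sub>M tag_space)"
proof -
  have "cylinder x D s w n = {y \<in> space (path_space \<Otimes>\<^sub>M tag_space). fst (fst y) = x \<and> fst (snd (fst y)) \<in> D \<and>
      (\<forall>i<n. path_selected (fst y) i = s i) \<and> (\<forall>i\<le>n. snd y i = w i)}"
    by (auto simp: cylinder_def space_pair_measure space_PiM)
  also have "\<dots> \<in> sets (path_space \<Otimes>\<^sub>M tag_space)" by measurable
  finally show ?thesis .
qed

lemma sets_path_tag: "sets (path_space \<Otimes>\<^sub>M tag_space) = sigma_sets UNIV cylinders"
proof
  let ?S = "sigma UNIV cylinders"
  have sp: "space (path_space \<Otimes>\<^sub>M tag_space) = UNIV" by (simp add: space_pair_measure space_PiM)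
  have S[simp]: "sets ?S = sigma_sets UNIV cylinders" "space ?S = UNIV" by (simp_all add: space_measure_of_conv)
  have cyl: "cylinder x D s w n \<in> sets ?S" if "D \<in> sets time_space" for x D s w n
  proof -
    have "cylinder x D s w n \<in> cylinders" using that unfolding cylinders_def by blast
    then show ?thesis by (simp add: sigma_sets.Basic)
  qed
  \<comment> \<open>\<open>R n\<close> collects the discrete data seen by a cylinder of length
    \<open>n\<close>. It takes countably many values, and each nonempty fiber is a cylinder with
    unrestricted times, so all discrete coordinates are measurable functions of these maps.\<close>
  define R where "R n y = (fst (fst y), map (path_selected (fst y)) [0..<n], map (snd y) [0..<Suc n])"
    for n and y :: "'v path \<times> (nat \<Rightarrow> 'v)"
  have R: "R n \<in> ?S \<rightarrow>\<^sub>M count_space UNIV" for n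
  proof (subst measurable_count_space_eq2_countable)
    have "R n -` {(x, ls, lw)} \<in> sets ?S" for x ls lw
    proof (cases "length ls = n \<and> length lw = Suc n")
      case True
      then have "R n -` {(x, ls, lw)} = cylinder x UNIV (nth ls) (nth lw) n"
        by (auto simp: R_def cylinder_def map_upt_eq_iff less_Suc_eq_le simp del: upt_Suc)
      then show ?thesis using cyl[OF sets.top[of time_space]] by (simp add: space_PiM)
    next
      case False
      then have "R n -` {(x, ls, lw)} = {}" by (auto simp: R_def)
      then show ?thesis by (simp add: sigma_sets.Empty)
    qed
    then show "R n \<in> space ?S \<rightarrow> UNIV \<and> (\<forall>a\<in>UNIV. R n -` {a} \<inter> space ?S \<in> sets ?S)" by auto
  qed
  have 1: "(\<lambda>y. fst (fst y)) \<in> ?S \<rightarrow>\<^sub>M count_space UNIV"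
    using measurable_compose_discrete[OF R[of 0], of fst] by (simp add: R_def)
  have 2: "(\<lambda>y. fst (snd (fst y))) \<in> ?S \<rightarrow>\<^sub>M time_space"
  proof (rule measurableI)
    fix D assume D: "D \<in> sets time_space"
    \<comment> \<open>At length 0 a cylinder fixes only the initial profile and one tag position;
      the countable union over both leaves just the time event.\<close>
    have "(\<lambda>y :: 'v path \<times> (nat \<Rightarrow> 'v). fst (snd (fst y))) -` D \<inter> space ?S =
        (\<Union>(x, w)\<in>UNIV. cylinder x D undefined (\<lambda>_. w) 0)"
      by (auto simp: cylinder_def)
    also have "\<dots> \<in> sets ?S" using cyl[OF D] by (intro sets.countable_UN') auto
    finally show "(\<lambda>y :: 'v path \<times> (nat \<Rightarrow> 'v). fst (snd (fst y))) -` D \<inter> space ?S \<in> sets ?S" .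
  qed (simp add: space_PiM)
  have 3: "(\<lambda>y. snd (snd (fst y))) \<in> ?S \<rightarrow>\<^sub>M tag_space"
  proof (rule measurable_abs_UNIV)
    fix i
    show "(\<lambda>y. snd (snd (fst y)) i) \<in> ?S \<rightarrow>\<^sub>M count_space UNIV"
      using measurable_compose_discrete[OF R[of "Suc i"], of "\<lambda>r. fst (snd r) ! i"]
      by (simp add: R_def path_selected_def nth_append)
  qed
  have 4: "snd \<in> ?S \<rightarrow>\<^sub>M tag_space"
  proof (rule measurable_abs_UNIV)
    fix i
    show "(\<lambda>y. snd y i) \<in> ?S \<rightarrow>\<^sub>M count_space UNIV"
      using measurable_compose_discrete[OF R[of i], of "\<lambda>r. snd (snd r) ! i"]
      by (simp add: R_def nth_append)
  qed
  have "(\<lambda>y. ((fst (fst y), (fst (snd (fst y)), snd (snd (fst y)))), snd y)) \<in> ?S \<rightarrow>\<^sub>M path_space \<Otimes>\<^sub>M tag_space"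
    unfolding path_space_def by (intro measurable_Pair 1 2 3 4)
  then have id: "(\<lambda>y. y) \<in> ?S \<rightarrow>\<^sub>M path_space \<Otimes>\<^sub>M tag_space" by simp
  show "sets (path_space \<Otimes>\<^sub>M tag_space) \<subseteq> sigma_sets UNIV cylinders"
    using measurable_sets[OF id] by auto
  show "sigma_sets UNIV cylinders \<subseteq> sets (path_space \<Otimes>\<^sub>M tag_space)"
  proof -
    have "cylinders \<subseteq> sets (path_space \<Otimes>\<^sub>M tag_space)"
      using cylinder_sets sets.top[of "path_space \<Otimes>\<^sub>M tag_space"]
      unfolding sp cylinders_def by blast
    from sets.sigma_sets_subset[OF this] show ?thesis by (simp only: sp)
  qed
qed

section \<open>The joint law of base path and tag\<close>

sublocale driving: prob_space "driving_law E"
  by (rule prob_space_driving)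

lemma prob_space_process: "prob_space (process_law \<nu> E)"
  unfolding process_law_def by (intro prob_space_pair prob_space_measure_pmf driving.prob_space_axioms)

lemma space_process: "space (process_law \<nu> E) = UNIV \<times> space (driving_law E)"
  by (simp add: process_law_def space_pair_measure)

lemma event_mark_space: "d \<in> space (driving_law E) \<Longrightarrow> event_mark E d h \<in> space \<rho>"
  using measurable_space[OF measurable_event_mark] .

lemma measurable_start [measurable]: "fst \<in> process_law \<nu> E \<rightarrow>\<^sub>M count_space UNIV"
  unfolding process_law_def by (rule measurable_compose[OF measurable_fst, where g = "\<lambda>x. x"]) simp

lemma measurable_driving [measurable]: "snd \<in> process_law \<nu> E \<rightarrow>\<^sub>M driving_law E"
  unfolding process_law_def by simp

lemma measurable_process_split:
  assumes "\<And>x v. (\<lambda>d. f ((x, v), d)) \<in> driving_law E \<rightarrow>\<^sub>M N"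
  shows "f \<in> process_law \<nu> E \<rightarrow>\<^sub>M N"
proof -
  have "(\<lambda>\<omega>. f (z, snd \<omega>)) \<in> process_law \<nu> E \<rightarrow>\<^sub>M N" for z
    by (cases z) (auto intro: measurable_compose[OF measurable_driving] assms)
  from measurable_compose_countable[where f = "\<lambda>z \<omega>. f (z, snd \<omega>)", OF this measurable_start]
  show ?thesis by simp
qed

lemma measurable_base_path: "base_path E ori p \<in> process_law \<nu> E \<rightarrow>\<^sub>M path_space"
proof (rule measurable_process_split)
  fix x :: "'v profile" and v :: 'v
  have "(\<lambda>d. selected E ori p x d) \<in> driving_law E \<rightarrow>\<^sub>M tag_space"
    by (rule measurable_abs_UNIV) (rule measurable_selected)
  then show "(\<lambda>d. base_path E ori p ((x, v), d)) \<in> driving_law E \<rightarrow>\<^sub>M path_space"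
    unfolding base_path_def path_space_def
    using measurable_driving_event_time by simp
qed

abbreviation tag_path :: "('v profile \<times> 'v) \<times> 'v driving \<Rightarrow> nat \<Rightarrow> 'v" where
  "tag_path \<equiv> (\<lambda>((x, v), d). tag E ori p x v d)"

lemma measurable_tag_path: "tag_path \<in> process_law \<nu> E \<rightarrow>\<^sub>M tag_space"
  by (rule measurable_process_split) (simp, rule measurable_abs_UNIV, rule measurable_tag)

text \<open>As long as the selections follow \<open>s\<close>, the profiles are those replayed from
  \<open>s\<close>. Replacing the random profile by this fixed one makes every condition concern a
  single mark, as independence requires.\<close>

lemma selected_cylinder_iff:
  "(\<forall>i<n. selected E ori p x d i = s i) \<longleftrightarrow> (\<forall>i<n. \<sigma> (replay x s i) (event_mark E d i) = s i)"
proof (induction n)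
  case (Suc n)
  have "replay x (selected E ori p x d) n = replay x s n" if "\<forall>i<n. selected E ori p x d i = s i"
    using that by (intro replay_cong) auto
  then show ?case using Suc by (auto simp: less_Suc_eq selected_def load_eq_replay)
qed simp

text \<open>The same decoupling with the tag included: its random current position is replaced by
  the prescribed \<open>w i\<close>.\<close>

lemma path_cylinder_iff:
  "(\<forall>i<n. selected E ori p x d i = s i) \<and> (\<forall>i\<le>n. tag E ori p x v d i = w i) \<longleftrightarrow>
   v = w 0 \<and> (\<forall>i<n. \<sigma> (replay x s i) (event_mark E d i) = s i \<and>
     tag_step (replay x s i) (w i) (event_mark E d i) = w (Suc i))"
proof (induction n)
  case 0
  then show ?case by (simp add: tag_0)
next
  case (Suc n)
  have load: "load E ori p x d n = replay x s n" if "\<forall>i<n. selected E ori p x d i = s i"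
    unfolding load_eq_replay using that by (intro replay_cong) auto
  have "(\<forall>i<Suc n. selected E ori p x d i = s i) \<and> (\<forall>i\<le>Suc n. tag E ori p x v d i = w i) \<longleftrightarrow>
     ((\<forall>i<n. selected E ori p x d i = s i) \<and> (\<forall>i\<le>n. tag E ori p x v d i = w i)) \<and>
      selected E ori p x d n = s n \<and> tag E ori p x v d (Suc n) = w (Suc n)"
    by (auto simp: less_Suc_eq le_Suc_eq)
  also have "\<dots> \<longleftrightarrow> ((\<forall>i<n. selected E ori p x d i = s i) \<and> (\<forall>i\<le>n. tag E ori p x v d i = w i)) \<and>
      \<sigma> (replay x s n) (event_mark E d n) = s n \<and>
      tag_step (replay x s n) (w n) (event_mark E d n) = w (Suc n)"
    using load by (auto simp: selected_def tag_Suc)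
  also have "\<dots> \<longleftrightarrow> v = w 0 \<and> (\<forall>i<Suc n. \<sigma> (replay x s i) (event_mark E d i) = s i \<and>
     tag_step (replay x s i) (w i) (event_mark E d i) = w (Suc i))"
    unfolding Suc.IH by (auto simp: less_Suc_eq)
  finally show ?case .
qed

lemma emeasure_process_rectangle:
  assumes D: "D \<in> sets time_space" and G: "\<And>i. i < n \<Longrightarrow> G i \<in> sets \<rho>"
  shows "emeasure (process_law \<nu> E) {\<omega> \<in> space (process_law \<nu> E). fst \<omega> \<in> S \<and>
      event_time E (snd \<omega>) \<in> D \<and> (\<forall>i<n. event_mark E (snd \<omega>) i \<in> G i)} =
    emeasure (measure_pmf \<nu>) S *
      emeasure (driving_law E) {d \<in> space (driving_law E). event_time E d \<in> D} *
      (\<Prod>i<n. emeasure \<rho> (G i))"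
proof -
  let ?T = "{d \<in> space (driving_law E). event_time E d \<in> D \<and> (\<forall>i<n. event_mark E d i \<in> G i)}"
  have "?T = {d \<in> space (driving_law E). event_time E d \<in> D} \<inter>
      {d \<in> space (driving_law E). \<forall>i\<in>{..<n}. event_mark E d i \<in> G i}" by auto
  also have "\<dots> \<in> sets (driving_law E)"
  proof (intro sets.Int sets.sets_Collect_finite_All)
    show "{d \<in> space (driving_law E). event_time E d \<in> D} \<in> sets (driving_law E)"
      using measurable_sets[OF measurable_driving_event_time D] by (simp add: vimage_def Int_def conj_commute)
    fix i assume "i \<in> {..<n}"
    then show "{d \<in> space (driving_law E). event_mark E d i \<in> G i} \<in> sets (driving_law E)"
      using measurable_sets[OF measurable_event_mark G, of i] by (simp add: vimage_def Int_def conj_commute)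
  qed simp
  finally have T: "?T \<in> sets (driving_law E)" .
  have "{\<omega> \<in> space (process_law \<nu> E). fst \<omega> \<in> S \<and>
      event_time E (snd \<omega>) \<in> D \<and> (\<forall>i<n. event_mark E (snd \<omega>) i \<in> G i)} = S \<times> ?T"
    by (auto simp: space_process)
  then show ?thesis
    using T by (simp add: process_law_def driving.emeasure_pair_measure_Times emeasure_times_marks[OF D G] mult.assoc)
qed

text \<open>The initial law assumed in the theorem, named so that it can also be verified for the
  start from one fixed profile.\<close>

definition size_biased :: "('v profile \<times> 'v) pmf \<Rightarrow> bool" where
  "size_biased \<nu> \<longleftrightarrow> (\<forall>x w. x \<in> fst ` set_pmf \<nu> \<longrightarrow>
     \<P>(z in measure_pmf \<nu>. snd z = w \<bar> fst z = x) = rate E ori p x w / real (card E))"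

lemma size_biased_mass:
  assumes "size_biased \<nu>"
  shows "emeasure (measure_pmf \<nu>) {(x, w)} = emeasure (measure_pmf \<nu>) {z. fst z = x} * emeasure \<rho> (chosen x w)"
proof -
  have "measure (measure_pmf \<nu>) {(x, w)} = measure (measure_pmf \<nu>) {z. fst z = x} * measure \<rho> (chosen x w)"
  proof (cases "x \<in> fst ` set_pmf \<nu>")
    case True
    have eq: "{z. snd z = w \<and> fst z = x} = {(x, w)}" by auto
    have "measure (measure_pmf \<nu>) {z. fst z = x} \<noteq> 0"
      using True by (auto simp: measure_pmf_zero_iff)
    moreover have "\<P>(z in measure_pmf \<nu>. snd z = w \<bar> fst z = x) = rate E ori p x w / real (card E)"
      using assms True by (auto simp: size_biased_def)
    then have "measure (measure_pmf \<nu>) {(x, w)} / measure (measure_pmf \<nu>) {z. fst z = x} = measure \<rho> (chosen x w)"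
      by (simp add: cond_prob_def eq measure_chosen)
    ultimately show ?thesis by (simp add: field_simps)
  next
    case False
    then have "measure (measure_pmf \<nu>) {(x, w)} = 0" "measure (measure_pmf \<nu>) {z. fst z = x} = 0"
      by (force simp: measure_pmf_zero_iff)+
    then show ?thesis by simp
  qed
  then show ?thesis
    by (simp only: measure_pmf.emeasure_eq_measure mark.emeasure_eq_measure ennreal_mult[symmetric] measure_nonneg)
qed

lemma base_path_simps:
  "fst (base_path E ori p \<omega>) = fst (fst \<omega>)"
  "fst (snd (base_path E ori p \<omega>)) = event_time E (snd \<omega>)"
  "path_selected (base_path E ori p \<omega>) i = selected E ori p (fst (fst \<omega>)) (snd \<omega>) i"
  "path_profile (base_path E ori p \<omega>) i = load E ori p (fst (fst \<omega>)) (snd \<omega>) i"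
  by (simp_all add: base_path_def path_selected_def path_profile_def load_eq_replay split: prod.split)

text \<open>Both sides equal the probability of the base-path event \<open>S\<close> times the same
  constant \<open>c\<close>. On the left each mark contributes its selection probability times
  \<open>trans_prob\<close>; on the right the kernel gives \<open>c\<close> on \<open>S\<close> and
  0 elsewhere.\<close>

lemma emeasure_cylinder:
  assumes D: "D \<in> sets time_space" and \<nu>: "size_biased \<nu>"
  shows "emeasure (process_law \<nu> E) {\<omega> \<in> space (process_law \<nu> E).
      (base_path E ori p \<omega>, tag_path \<omega>) \<in> cylinder x D s w n} =
    (\<integral>\<^sup>+\<omega>. emeasure (tag_kernel (base_path E ori p \<omega>))
      {z \<in> space tag_space. (base_path E ori p \<omega>, z) \<in> cylinder x D s w n} \<partial>process_law \<nu> E)"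
    (is "?lhs = ?rhs")
proof -
  let ?M = "process_law \<nu> E" and ?r = "replay x s"
  let ?\<tau> = "emeasure (driving_law E) {d \<in> space (driving_law E). event_time E d \<in> D}"
  define G where "G i = {a \<in> space \<rho>. \<sigma> (?r i) a = s i \<and> tag_step (?r i) (w i) a = w (Suc i)}" for i
  define S where "S = {\<omega> \<in> space ?M. fst \<omega> \<in> {z. fst z = x} \<and> event_time E (snd \<omega>) \<in> D \<and>
      (\<forall>i<n. event_mark E (snd \<omega>) i \<in> chosen (?r i) (s i))}"
  define c where "c = emeasure \<rho> (chosen x (w 0)) * (\<Prod>i<n. trans_prob (?r i) (s i) (w i) (w (Suc i)))"
  have G[measurable]: "G i \<in> sets \<rho>" for i unfolding G_def by measurable
  have S_iff: "\<omega> \<in> S \<longleftrightarrow> fst (fst \<omega>) = x \<and> event_time E (snd \<omega>) \<in> D \<and>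
      (\<forall>i<n. selected E ori p x (snd \<omega>) i = s i)" if "\<omega> \<in> space ?M" for \<omega>
    using that unfolding selected_cylinder_iff
    by (auto simp: S_def chosen_def space_process event_mark_space mem_Times_iff)
  have "{\<omega> \<in> space ?M. (base_path E ori p \<omega>, tag_path \<omega>) \<in> cylinder x D s w n} =
     {\<omega> \<in> space ?M. fst \<omega> \<in> {(x, w 0)} \<and> event_time E (snd \<omega>) \<in> D \<and>
      (\<forall>i<n. event_mark E (snd \<omega>) i \<in> G i)}"
  proof (rule Collect_cong)
    fix \<omega> :: "('v profile \<times> 'v) \<times> 'v driving"
    obtain x' v d where \<omega>: "\<omega> = ((x', v), d)" by (metis surj_pair)
    show "\<omega> \<in> space ?M \<and> (base_path E ori p \<omega>, tag_path \<omega>) \<in> cylinder x D s w n \<longleftrightarrow>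
       \<omega> \<in> space ?M \<and> fst \<omega> \<in> {(x, w 0)} \<and> event_time E (snd \<omega>) \<in> D \<and> (\<forall>i<n. event_mark E (snd \<omega>) i \<in> G i)"
      using path_cylinder_iff[of n x d s v w]
      by (auto simp: \<omega> cylinder_def base_path_simps G_def space_process event_mark_space)
  qed
  then have "?lhs = emeasure (measure_pmf \<nu>) {(x, w 0)} * ?\<tau> * (\<Prod>i<n. emeasure \<rho> (G i))"
    by (simp only: emeasure_process_rectangle[OF D G])
  \<comment> \<open>The start and each mark split into a base factor and a tag factor; the tag
    factors are collected in \<open>c\<close>.\<close>
  also have "\<dots> = emeasure (measure_pmf \<nu>) {z. fst z = x} * ?\<tau> * (\<Prod>i<n. emeasure \<rho> (chosen (?r i) (s i))) * c"
    by (simp add: G_def emeasure_sel_tag_step size_biased_mass[OF \<nu>] prod.distrib c_def mult_ac)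
  also have "\<dots> = emeasure ?M S * c"
    unfolding S_def by (simp only: emeasure_process_rectangle[OF D chosen_sets])
  also have "\<dots> = (\<integral>\<^sup>+\<omega>. indicator S \<omega> * c \<partial>?M)"
  proof -
    have [measurable]: "(\<lambda>\<omega>. event_time E (snd \<omega>)) \<in> ?M \<rightarrow>\<^sub>M time_space"
      by (rule measurable_compose[OF measurable_driving measurable_driving_event_time])
    have [measurable]: "(\<lambda>\<omega>. event_mark E (snd \<omega>) i) \<in> ?M \<rightarrow>\<^sub>M \<rho>" for i
      by (rule measurable_compose[OF measurable_driving measurable_event_mark])
    note [measurable] = D
    have [measurable]: "Measurable.pred ?M (\<lambda>\<omega>. fst (fst \<omega>) = x)"
      by (rule measurable_compose_discrete[OF measurable_start])
    have [measurable]: "Measurable.pred ?M (\<lambda>\<omega>. event_time E (snd \<omega>) \<in> D \<and>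
        (\<forall>i<n. event_mark E (snd \<omega>) i \<in> chosen (?r i) (s i)))" by measurable
    have "S \<in> sets ?M" unfolding S_def mem_Collect_eq by (intro sets.sets_Collect_conj) (simp_all add: pred_def[symmetric])
    then show ?thesis by (simp add: nn_integral_multc)
  qed
  also have "\<dots> = ?rhs"
  proof (rule nn_integral_cong)
    fix \<omega> assume \<omega>: "\<omega> \<in> space ?M"
    let ?\<gamma> = "base_path E ori p \<omega>"
    show "indicator S \<omega> * c = emeasure (tag_kernel ?\<gamma>) {z \<in> space tag_space. (?\<gamma>, z) \<in> cylinder x D s w n}"
    proof (cases "\<omega> \<in> S")
      case True
      then have S: "fst (fst \<omega>) = x" "event_time E (snd \<omega>) \<in> D" "\<And>i. i < n \<Longrightarrow> selected E ori p x (snd \<omega>) i = s i"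
        using S_iff[OF \<omega>] by auto
      have prof: "path_profile ?\<gamma> i = ?r i" if "i \<le> n" for i
        using S that by (auto simp: base_path_simps load_eq_replay intro!: replay_cong)
      have sel: "path_selected ?\<gamma> i = s i" if "i < n" for i
        using S that by (simp add: base_path_simps)
      have eq: "{z \<in> space tag_space. (?\<gamma>, z) \<in> cylinder x D s w n} = {z \<in> space tag_space. \<forall>i\<le>n. z i = w i}"
        using S by (auto simp: cylinder_def base_path_simps)
      have "{z \<in> space tag_space. \<forall>i\<le>n. z i = w i} \<in> sets tag_space" by measurable
      then have "emeasure (tag_kernel ?\<gamma>) {z \<in> space tag_space. \<forall>i\<le>n. z i = w i} =
          emeasure (aux_law ?\<gamma>) {b \<in> space marks_space. \<forall>i\<le>n. \<sigma> (path_profile ?\<gamma> i) (b i) = w i}"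
        by (subst emeasure_tag_kernel) (auto simp: space_PiM)
      also have "\<dots> = c"
        unfolding emeasure_aux_law_cylinder c_def using prof[of 0] by (simp add: prof sel)
      finally show ?thesis using True by (simp add: eq)
    next
      case False
      then have "{z \<in> space tag_space. (?\<gamma>, z) \<in> cylinder x D s w n} = {}"
        using S_iff[OF \<omega>] by (auto simp: cylinder_def base_path_simps)
      then show ?thesis using False by (simp only: indicator_simps emeasure_empty mult_zero_left not_False_eq_True)
    qed
  qed
  finally show ?thesis .
qed

lemma measurable_path_tag_kernel:
  "(\<lambda>\<gamma>. distr (tag_kernel \<gamma>) (path_space \<Otimes>\<^sub>M tag_space) (\<lambda>z. (\<gamma>, z))) \<in>
    path_space \<rightarrow>\<^sub>M prob_algebra (path_space \<Otimes>\<^sub>M tag_space)"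
  by (rule measurable_distr_prob_space2[OF measurable_tag_kernel]) simp

text \<open>Says that the joint law is the path law followed by \<open>tag_kernel\<close>;
  uniqueness on the cylinders extends it to every \<open>B\<close>. Sets \<open>B\<close> that are
  not products are needed for reading the tag at a path-dependent index.\<close>

lemma emeasure_path_tag:
  assumes \<nu>: "size_biased \<nu>" and B: "B \<in> sets (path_space \<Otimes>\<^sub>M tag_space)"
  shows "emeasure (process_law \<nu> E) {\<omega> \<in> space (process_law \<nu> E). (base_path E ori p \<omega>, tag_path \<omega>) \<in> B} =
    (\<integral>\<^sup>+\<omega>. emeasure (tag_kernel (base_path E ori p \<omega>))
      {z \<in> space tag_space. (base_path E ori p \<omega>, z) \<in> B} \<partial>process_law \<nu> E)"
proof -
  let ?M = "process_law \<nu> E" and ?S = "path_space \<Otimes>\<^sub>M tag_space"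
  let ?Y = "base_path E ori p"
  let ?k = "\<lambda>\<omega>. distr (tag_kernel (?Y \<omega>)) ?S (\<lambda>z. (?Y \<omega>, z))"
  have YZ: "(\<lambda>\<omega>. (?Y \<omega>, tag_path \<omega>)) \<in> ?M \<rightarrow>\<^sub>M ?S"
    by (intro measurable_Pair measurable_base_path measurable_tag_path)
  have k: "?k \<in> ?M \<rightarrow>\<^sub>M prob_algebra ?S"
    by (rule measurable_compose[OF measurable_base_path measurable_path_tag_kernel])
  interpret M: prob_space ?M by (rule prob_space_process)
  have M: "?M \<in> space (prob_algebra ?M)" by (simp add: space_prob_algebra M.prob_space_axioms)
  define Q1 where "Q1 = distr ?M ?S (\<lambda>\<omega>. (?Y \<omega>, tag_path \<omega>))"
  define Q2 where "Q2 = ?M \<bind> ?k"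
  have Q1: "emeasure Q1 A = emeasure ?M {\<omega> \<in> space ?M. (?Y \<omega>, tag_path \<omega>) \<in> A}" if "A \<in> sets ?S" for A
    unfolding Q1_def emeasure_distr[OF YZ that] by (rule arg_cong[where f = "emeasure ?M"]) auto
  have tk: "sets (tag_kernel \<gamma>) = sets tag_space" "space (tag_kernel \<gamma>) = space tag_space" for \<gamma>
    by (simp_all add: tag_kernel_def)
  have Q2: "emeasure Q2 A = (\<integral>\<^sup>+\<omega>. emeasure (tag_kernel (?Y \<omega>)) {z \<in> space tag_space. (?Y \<omega>, z) \<in> A} \<partial>?M)"
    if A: "A \<in> sets ?S" for A
  proof -
    have "emeasure Q2 A = (\<integral>\<^sup>+\<omega>. emeasure (?k \<omega>) A \<partial>?M)"
      unfolding Q2_def by (rule emeasure_bind_prob_algebra[OF M k A])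
    also have "\<dots> = (\<integral>\<^sup>+\<omega>. emeasure (tag_kernel (?Y \<omega>)) {z \<in> space tag_space. (?Y \<omega>, z) \<in> A} \<partial>?M)"
    proof (rule nn_integral_cong)
      fix \<omega>
      have "(\<lambda>z. (?Y \<omega>, z)) \<in> tag_kernel (?Y \<omega>) \<rightarrow>\<^sub>M ?S"
        unfolding measurable_cong_sets[OF tk(1) refl] by (rule measurable_Pair1') simp
      then show "emeasure (?k \<omega>) A = emeasure (tag_kernel (?Y \<omega>)) {z \<in> space tag_space. (?Y \<omega>, z) \<in> A}"
        using A by (subst emeasure_distr) (auto simp: tk space_PiM intro!: arg_cong[where f = "emeasure (tag_kernel (?Y \<omega>))"])
    qed
    finally show ?thesis .
  qed
  have p1: "emeasure Q1 UNIV = 1"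
  proof -
    interpret Q: prob_space Q1 unfolding Q1_def by (rule M.prob_space_distr[OF YZ])
    show ?thesis using Q.emeasure_space_1 by (simp add: Q1_def space_pair_measure space_PiM)
  qed
  have p2: "emeasure Q2 UNIV = 1"
  proof -
    have "prob_space Q2" unfolding Q2_def by (rule prob_space_bind'[OF M k])
    then interpret Q: prob_space Q2 .
    have "space Q2 = UNIV"
      using sets_eq_imp_space_eq[OF sets_bind'[OF M k]] by (simp add: Q2_def space_pair_measure space_PiM)
    then show ?thesis using Q.emeasure_space_1 by simp
  qed
  have "Q1 = Q2"
  proof (rule measure_eqI_generator_eq[OF Int_stable_cylinders])
    show "cylinders \<subseteq> Pow UNIV" by simp
    show "sets Q1 = sigma_sets UNIV cylinders" by (simp add: Q1_def sets_path_tag)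
    show "sets Q2 = sigma_sets UNIV cylinders"
      unfolding Q2_def using sets_bind'[OF M k] by (simp add: sets_path_tag)
    show "emeasure Q1 X = emeasure Q2 X" if "X \<in> cylinders" for X
    proof (cases "X = UNIV")
      case True
      then show ?thesis by (simp add: p1 p2)
    next
      case False
      with that obtain x D s w n where X: "X = cylinder x D s w n" and D: "D \<in> sets time_space"
        unfolding cylinders_def by blast
      show ?thesis
        unfolding X Q1[OF cylinder_sets[OF D]] Q2[OF cylinder_sets[OF D]] by (rule emeasure_cylinder[OF D \<nu>])
    qed
    show "range (\<lambda>_ :: nat. UNIV) \<subseteq> cylinders" by (auto simp: cylinders_def)
  qed (use p1 in \<open>auto\<close>)
  then show ?thesis using Q1[OF B] Q2[OF B] by simp
qed

subsection \<open>The tag at physical times\<close>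

lemma is_cond_law_tag:
  assumes \<nu>: "size_biased \<nu>"
  shows "is_cond_law (process_law \<nu> E) (base_path E ori p) path_space tag_path tag_space tag_kernel"
  unfolding is_cond_law_def
proof (intro conjI ballI measurable_base_path measurable_tag_path measurable_tag_kernel)
  fix A assume A[measurable]: "A \<in> sets tag_space"
  let ?M = "process_law \<nu> E"
  have pk: "prob_space (tag_kernel \<gamma>)" for \<gamma>
    using measurable_space[OF measurable_tag_kernel, of \<gamma>] by (simp add: space_prob_algebra)
  have sk: "sets (tag_kernel \<gamma>) = sets tag_space" for \<gamma> by (simp add: tag_kernel_def)
  show "AE \<omega> in ?M. cond_prob_given ?M (base_path E ori p) path_space (\<lambda>\<omega>. tag_path \<omega> \<in> A) \<omega> =
      measure (tag_kernel (base_path E ori p \<omega>)) A"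
  proof (rule cond_prob_given_eqI[OF prob_space_process measurable_base_path])
    show "(\<lambda>\<gamma>. measure (tag_kernel \<gamma>) A) \<in> borel_measurable path_space"
      by (rule measurable_compose[OF measurable_tag_kernel measurable_measure_prob_algebra[OF A]])
    show "measure (tag_kernel \<gamma>) A \<le> 1" for \<gamma> by (rule prob_space.prob_le_1[OF pk])
    show "{\<omega> \<in> space ?M. tag_path \<omega> \<in> A} \<in> sets ?M"
      using measurable_sets[OF measurable_tag_path A] by (simp add: vimage_def Int_def conj_commute)
    fix C assume C: "C \<in> sets (path_space :: 'v path measure)"
    have "emeasure ?M {\<omega> \<in> space ?M. base_path E ori p \<omega> \<in> C \<and> tag_path \<omega> \<in> A} =
        emeasure ?M {\<omega> \<in> space ?M. (base_path E ori p \<omega>, tag_path \<omega>) \<in> C \<times> A}"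
      by simp
    also have "\<dots> = (\<integral>\<^sup>+\<omega>. emeasure (tag_kernel (base_path E ori p \<omega>))
        {z \<in> space tag_space. (base_path E ori p \<omega>, z) \<in> C \<times> A} \<partial>?M)"
      using A C by (intro emeasure_path_tag[OF \<nu>]) auto
    also have "\<dots> = (\<integral>\<^sup>+\<omega>. indicator C (base_path E ori p \<omega>) *
        ennreal (measure (tag_kernel (base_path E ori p \<omega>)) A) \<partial>?M)"
    proof (rule nn_integral_cong)
      fix \<omega>
      have "{z \<in> space tag_space. (base_path E ori p \<omega>, z) \<in> C \<times> A} = (if base_path E ori p \<omega> \<in> C then A else {})"
        by (auto simp: space_PiM)
      moreover have "emeasure (tag_kernel \<gamma>) A = ennreal (measure (tag_kernel \<gamma>) A)" for \<gamma>
        by (rule finite_measure.emeasure_eq_measure[OF prob_space.finite_measure[OF pk]])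
      ultimately show "emeasure (tag_kernel (base_path E ori p \<omega>)) {z \<in> space tag_space. (base_path E ori p \<omega>, z) \<in> C \<times> A} =
          indicator C (base_path E ori p \<omega>) * ennreal (measure (tag_kernel (base_path E ori p \<omega>)) A)"
        by (auto simp: indicator_def)
    qed
    finally show "emeasure ?M {\<omega> \<in> space ?M. base_path E ori p \<omega> \<in> C \<and> tag_path \<omega> \<in> A} =
        (\<integral>\<^sup>+\<omega>. indicator C (base_path E ori p \<omega>) * ennreal (measure (tag_kernel (base_path E ori p \<omega>)) A) \<partial>?M)" .
  qed simp
qed

text \<open>Counting events from the path alone shows that the index belonging to time
  \<open>t\<close> is known once the path is given.\<close>

definition path_events :: "'v path \<Rightarrow> real \<Rightarrow> nat" where
  "path_events \<gamma> t = card {h. fst (snd \<gamma>) h \<le> t}"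

lemma measurable_path_events [measurable]:
  "(\<lambda>\<gamma>. path_events \<gamma> t) \<in> (path_space :: 'v path measure) \<rightarrow>\<^sub>M count_space UNIV"
  unfolding path_events_def path_space_def by measurable

lemma num_events_path: "num_events E (snd \<omega>) t = path_events (base_path E ori p \<omega>) t"
  by (simp add: num_events_def path_events_def base_path_simps)

lemma measurable_profile_at [measurable]:
  "(\<lambda>\<gamma>. path_profile \<gamma> (path_events \<gamma> t)) \<in> (path_space :: 'v path measure) \<rightarrow>\<^sub>M count_space UNIV"
  by (rule measurable_compose_countable[where f = "\<lambda>n \<gamma>. path_profile \<gamma> n", OF measurable_path_profile measurable_path_events])

lemma load_at_path: "load_at E ori p (fst (fst \<omega>)) (snd \<omega>) t =
    path_profile (base_path E ori p \<omega>) (path_events (base_path E ori p \<omega>) t)"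
  by (simp add: load_at_def num_events_path base_path_simps)

lemma tag_at_path: "tag_at E ori p (fst (fst \<omega>)) (snd (fst \<omega>)) (snd \<omega>) t =
    tag_path \<omega> (path_events (base_path E ori p \<omega>) t)"
  by (simp add: tag_at_def num_events_path split: prod.split)

text \<open>Combines the invariance of \<rho> along the chain with \<open>emeasure_chosen\<close>,
  for an arbitrary fixed path and index.\<close>

lemma emeasure_tag_kernel_marginal:
  "emeasure (tag_kernel \<gamma>) {z \<in> space tag_space. z n = w} = ennreal (rate E ori p (path_profile \<gamma> n) w / card E)"
proof -
  have "{z \<in> space tag_space. z n = w} \<in> sets tag_space" by measurable
  then have "emeasure (tag_kernel \<gamma>) {z \<in> space tag_space. z n = w} =
      emeasure (aux_law \<gamma>) {b \<in> space marks_space. \<sigma> (path_profile \<gamma> n) (b n) = w}"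
    by (subst emeasure_tag_kernel) (auto simp: space_PiM)
  also have "\<dots> = emeasure (distr (aux_law \<gamma>) \<rho> (\<lambda>b. b n)) (chosen (path_profile \<gamma> n) w)"
    by (subst emeasure_distr) (auto intro!: arg_cong[where f = "emeasure (aux_law \<gamma>)"] simp: chosen_def space_PiM)
  finally show ?thesis by (simp add: distr_aux_law emeasure_chosen)
qed

lemma rate_bounds: "0 \<le> rate E ori p x w / card E" "rate E ori p x w / card E \<le> 1"
  unfolding measure_chosen[symmetric] by simp_all

lemma measurable_tag_at:
  "(\<lambda>\<omega>. tag_at E ori p (fst (fst \<omega>)) (snd (fst \<omega>)) (snd \<omega>) t) \<in> process_law \<nu> E \<rightarrow>\<^sub>M count_space UNIV"
  unfolding tag_at_path
proof (rule measurable_compose_countable[where f = "\<lambda>n \<omega>. tag_path \<omega> n"])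
  show "(\<lambda>\<omega>. tag_path \<omega> n) \<in> process_law \<nu> E \<rightarrow>\<^sub>M count_space UNIV" for n
    by (rule measurable_compose[OF measurable_tag_path, where g = "\<lambda>z. z n"]) simp
  show "(\<lambda>\<omega>. path_events (base_path E ori p \<omega>) t) \<in> process_law \<nu> E \<rightarrow>\<^sub>M count_space UNIV"
    by (rule measurable_compose[OF measurable_base_path measurable_path_events])
qed

lemma cond_prob_tag_at:
  assumes \<nu>: "size_biased \<nu>"
  shows "AE \<omega> in process_law \<nu> E.
      cond_prob_given (process_law \<nu> E) (base_path E ori p) path_space
        (\<lambda>((x, v), d). tag_at E ori p x v d t = w) \<omega> =
      rate E ori p (load_at E ori p (fst (fst \<omega>)) (snd \<omega>) t) w / card E"
proof -
  let ?M = "process_law \<nu> E" and ?Y = "base_path E ori p"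
  let ?g = "\<lambda>\<gamma>. rate E ori p (path_profile \<gamma> (path_events \<gamma> t)) w / card E"
  have P: "(\<lambda>((x, v), d). tag_at E ori p x v d t = w) = (\<lambda>\<omega>. tag_path \<omega> (path_events (?Y \<omega>) t) = w)"
    by (auto simp: fun_eq_iff tag_at_path[symmetric])
  have "AE \<omega> in ?M. cond_prob_given ?M ?Y path_space (\<lambda>\<omega>. tag_path \<omega> (path_events (?Y \<omega>) t) = w) \<omega> = ?g (?Y \<omega>)"
  proof (rule cond_prob_given_eqI[OF prob_space_process measurable_base_path])
    show "?g \<in> borel_measurable path_space"
      by (rule measurable_compose[OF measurable_profile_at]) simp
    show "0 \<le> ?g \<gamma>" "?g \<gamma> \<le> 1" for \<gamma> by (rule rate_bounds)+
    show "{\<omega> \<in> space ?M. tag_path \<omega> (path_events (?Y \<omega>) t) = w} \<in> sets ?M"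
      using measurable_sets[OF measurable_tag_at[of t \<nu>], of "{w}"]
      by (simp add: vimage_def Int_def conj_commute tag_at_path)
    fix C assume C[measurable]: "C \<in> sets (path_space :: 'v path measure)"
    \<comment> \<open>The index depends on the path, so this set is not a product and the joint law
      is used. For a given path the index is frozen, and the marginal at that index applies.\<close>
    let ?B = "{y \<in> space (path_space \<Otimes>\<^sub>M tag_space). fst y \<in> C \<and> snd y (path_events (fst y) t) = w}"
    have [measurable]: "(\<lambda>y. snd y (path_events (fst y) t)) \<in> path_space \<Otimes>\<^sub>M tag_space \<rightarrow>\<^sub>M count_space UNIV"
      by (rule measurable_compose_countable[where f = "\<lambda>n y. snd y n", OF measurable_path_tag(4)
            measurable_compose[OF measurable_fst measurable_path_events]])
    have B: "?B \<in> sets (path_space \<Otimes>\<^sub>M tag_space)" by measurable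
    have "emeasure ?M {\<omega> \<in> space ?M. ?Y \<omega> \<in> C \<and> tag_path \<omega> (path_events (?Y \<omega>) t) = w} =
        emeasure ?M {\<omega> \<in> space ?M. (?Y \<omega>, tag_path \<omega>) \<in> ?B}"
      by (simp add: space_pair_measure space_PiM)
    also have "\<dots> = (\<integral>\<^sup>+\<omega>. emeasure (tag_kernel (?Y \<omega>)) {z \<in> space tag_space. (?Y \<omega>, z) \<in> ?B} \<partial>?M)"
      by (rule emeasure_path_tag[OF \<nu> B])
    also have "\<dots> = (\<integral>\<^sup>+\<omega>. indicator C (?Y \<omega>) * ennreal (?g (?Y \<omega>)) \<partial>?M)"
    proof (rule nn_integral_cong)
      fix \<omega>
      have "{z \<in> space tag_space. (?Y \<omega>, z) \<in> ?B} =
          (if ?Y \<omega> \<in> C then {z \<in> space tag_space. z (path_events (?Y \<omega>) t) = w} else {})"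
        by (auto simp: space_PiM space_pair_measure)
      then show "emeasure (tag_kernel (?Y \<omega>)) {z \<in> space tag_space. (?Y \<omega>, z) \<in> ?B} =
          indicator C (?Y \<omega>) * ennreal (?g (?Y \<omega>))"
        by (simp only: emeasure_tag_kernel_marginal emeasure_empty indicator_def split: if_split) simp
    qed
    finally show "emeasure ?M {\<omega> \<in> space ?M. ?Y \<omega> \<in> C \<and> tag_path \<omega> (path_events (?Y \<omega>) t) = w} =
        (\<integral>\<^sup>+\<omega>. indicator C (?Y \<omega>) * ennreal (?g (?Y \<omega>)) \<partial>?M)" .
  qed
  then show ?thesis unfolding P load_at_path .
qed

text \<open>The tag is split over its finitely many values \<open>w\<close>. The factor
  \<open>F (X \<omega>, w)\<close> is a function of the base path, so the indicator of the tag may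
  be replaced by its conditional probability.\<close>

lemma integral_tag_at:
  assumes \<nu>: "size_biased \<nu>" and F: "bounded (range (F :: 'v profile \<times> 'v \<Rightarrow> real))"
  shows "(\<integral>\<omega>. F (load_at E ori p (fst (fst \<omega>)) (snd \<omega>) t, tag_at E ori p (fst (fst \<omega>)) (snd (fst \<omega>)) (snd \<omega>) t)
       \<partial>process_law \<nu> E) =
    (\<integral>\<omega>. (\<Sum>w\<in>UNIV. rate E ori p (load_at E ori p (fst (fst \<omega>)) (snd \<omega>) t) w / card E *
       F (load_at E ori p (fst (fst \<omega>)) (snd \<omega>) t, w)) \<partial>process_law \<nu> E)"
proof -
  let ?M = "process_law \<nu> E" and ?Y = "base_path E ori p"
  interpret M: prob_space ?M by (rule prob_space_process)
  define X where "X \<omega> = load_at E ori p (fst (fst \<omega>)) (snd \<omega>) t" for \<omega> :: "('v profile \<times> 'v) \<times> 'v driving"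
  define J where "J \<omega> = tag_at E ori p (fst (fst \<omega>)) (snd (fst \<omega>)) (snd \<omega>) t" for \<omega> :: "('v profile \<times> 'v) \<times> 'v driving"
  define V where "V = vimage_algebra (space ?M) ?Y path_space"
  have Y_sp: "?Y \<in> space ?M \<rightarrow> space path_space" by simp
  have YV: "?Y \<in> V \<rightarrow>\<^sub>M path_space" unfolding V_def by (rule measurable_vimage_algebra1[OF Y_sp])
  have sub: "subalgebra ?M V"
    using measurable_sets[OF measurable_base_path[of \<nu>]]
    by (auto simp: subalgebra_def V_def sets_vimage_algebra2[OF Y_sp])
  interpret V: finite_measure_subalgebra ?M V by unfold_locales (rule sub)
  have XV: "X \<in> V \<rightarrow>\<^sub>M count_space UNIV"
    unfolding X_def[abs_def] load_at_path by (rule measurable_compose[OF YV measurable_profile_at])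
  have X[measurable]: "X \<in> ?M \<rightarrow>\<^sub>M count_space UNIV" by (rule measurable_from_subalg[OF sub XV])
  have J[measurable]: "J \<in> ?M \<rightarrow>\<^sub>M count_space UNIV"
    unfolding J_def[abs_def] by (rule measurable_tag_at)
  obtain b where b: "\<bar>F y\<bar> \<le> b" for y
    using F by (auto simp: bounded_iff)
  have b0: "0 \<le> b" using b[of undefined] by linarith
  have meas: "(\<lambda>\<omega>. H (X \<omega>)) \<in> borel_measurable ?M" for H :: "'v profile \<Rightarrow> real"
    by (rule measurable_compose[OF X]) simp
  define I where "I w = indicat_real {\<omega> \<in> space ?M. J \<omega> = w}" for w
  have I[measurable]: "I w \<in> borel_measurable ?M" for w unfolding I_def by measurable
  have int: "integrable ?M (\<lambda>\<omega>. F (X \<omega>, w) * I w \<omega>)" for w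
  proof (rule M.integrable_const_bound[where B = b])
    show "AE \<omega> in ?M. norm (F (X \<omega>, w) * I w \<omega>) \<le> b"
      using b b0 by (auto simp: I_def indicator_def)
    show "(\<lambda>\<omega>. F (X \<omega>, w) * I w \<omega>) \<in> borel_measurable ?M"
      by (intro borel_measurable_times meas I)
  qed
  have int': "integrable ?M (\<lambda>\<omega>. rate E ori p (X \<omega>) w / card E * F (X \<omega>, w))" for w
  proof (rule M.integrable_const_bound[where B = b])
    have "\<bar>rate E ori p (X \<omega>) w / card E * F (X \<omega>, w)\<bar> \<le> 1 * b" for \<omega>
      unfolding abs_mult using rate_bounds[of "X \<omega>" w] b by (intro mult_mono) auto
    then show "AE \<omega> in ?M. norm (rate E ori p (X \<omega>) w / card E * F (X \<omega>, w)) \<le> b" by simp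
    show "(\<lambda>\<omega>. rate E ori p (X \<omega>) w / card E * F (X \<omega>, w)) \<in> borel_measurable ?M"
      by (rule meas)
  qed
  have ce: "AE \<omega> in ?M. real_cond_exp ?M V (I w) \<omega> = rate E ori p (X \<omega>) w / card E" for w
  proof -
    have I_eq: "I w = indicat_real {\<omega> \<in> space ?M. (\<lambda>((x, v), d). tag_at E ori p x v d t = w) \<omega>}"
      unfolding I_def by (rule arg_cong[where f = indicator]) (auto simp: J_def)
    show ?thesis
      using cond_prob_tag_at[OF \<nu>, of t w]
      unfolding cond_prob_given_def V_def[symmetric] I_eq[symmetric] X_def .
  qed
  have "(\<integral>\<omega>. F (X \<omega>, J \<omega>) \<partial>?M) = (\<integral>\<omega>. (\<Sum>w\<in>UNIV. F (X \<omega>, w) * I w \<omega>) \<partial>?M)"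
  proof (rule Bochner_Integration.integral_cong[OF refl])
    fix \<omega> assume "\<omega> \<in> space ?M"
    then have "(\<Sum>w\<in>UNIV. F (X \<omega>, w) * I w \<omega>) = (\<Sum>w\<in>UNIV. if w = J \<omega> then F (X \<omega>, w) else 0)"
      by (intro sum.cong) (auto simp: I_def indicator_def)
    then show "F (X \<omega>, J \<omega>) = (\<Sum>w\<in>UNIV. F (X \<omega>, w) * I w \<omega>)" by simp
  qed
  also have "\<dots> = (\<Sum>w\<in>UNIV. \<integral>\<omega>. F (X \<omega>, w) * I w \<omega> \<partial>?M)"
    by (rule Bochner_Integration.integral_sum) (rule int)
  also have "\<dots> = (\<Sum>w\<in>UNIV. \<integral>\<omega>. rate E ori p (X \<omega>) w / card E * F (X \<omega>, w) \<partial>?M)"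
  proof (rule sum.cong[OF refl])
    fix w
    have FV: "(\<lambda>\<omega>. F (X \<omega>, w)) \<in> borel_measurable V"
      by (rule measurable_compose[OF XV]) simp
    have "(\<integral>\<omega>. F (X \<omega>, w) * I w \<omega> \<partial>?M) = (\<integral>\<omega>. F (X \<omega>, w) * real_cond_exp ?M V (I w) \<omega> \<partial>?M)"
      by (rule V.real_cond_exp_intg(2)[OF int FV I, symmetric])
    also have "\<dots> = (\<integral>\<omega>. rate E ori p (X \<omega>) w / card E * F (X \<omega>, w) \<partial>?M)"
    proof (rule integral_cong_AE)
      show "AE \<omega> in ?M. F (X \<omega>, w) * real_cond_exp ?M V (I w) \<omega> = rate E ori p (X \<omega>) w / card E * F (X \<omega>, w)"
        using ce[of w] by eventually_elim simp
      show "(\<lambda>\<omega>. F (X \<omega>, w) * real_cond_exp ?M V (I w) \<omega>) \<in> borel_measurable ?M"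
        by (intro borel_measurable_times meas borel_measurable_cond_exp2)
      show "(\<lambda>\<omega>. rate E ori p (X \<omega>) w / card E * F (X \<omega>, w)) \<in> borel_measurable ?M" by (rule meas)
    qed
    finally show "(\<integral>\<omega>. F (X \<omega>, w) * I w \<omega> \<partial>?M) = (\<integral>\<omega>. rate E ori p (X \<omega>) w / card E * F (X \<omega>, w) \<partial>?M)" .
  qed
  also have "\<dots> = (\<integral>\<omega>. (\<Sum>w\<in>UNIV. rate E ori p (X \<omega>) w / card E * F (X \<omega>, w)) \<partial>?M)"
    by (rule Bochner_Integration.integral_sum[symmetric]) (rule int')
  finally show ?thesis by (simp add: X_def J_def)
qed

section \<open>The start from one fixed profile and the integral identity\<close>

lemma sum_rate: "(\<Sum>w\<in>UNIV. rate E ori p x w / card E) = 1"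
proof -
  have "(\<Sum>w\<in>UNIV. measure \<rho> (chosen x w)) = measure \<rho> (\<Union>w\<in>UNIV. chosen x w)"
    by (rule mark.finite_measure_finite_Union[symmetric]) (auto simp: disjoint_family_on_def chosen_def)
  also have "(\<Union>w\<in>UNIV. chosen x w) = space \<rho>" by (auto simp: chosen_def)
  finally show ?thesis by (simp add: measure_chosen mark.prob_space)
qed

definition tag_pmf :: "'v profile \<Rightarrow> 'v pmf" where
  "tag_pmf x = embed_pmf (\<lambda>w. rate E ori p x w / card E)"

lemma pmf_tag_pmf: "pmf (tag_pmf x) w = rate E ori p x w / card E"
  unfolding tag_pmf_def
proof (rule pmf_embed_pmf)
  have "(\<integral>\<^sup>+w. ennreal (rate E ori p x w / card E) \<partial>count_space UNIV) =
      ennreal (\<Sum>w\<in>UNIV. rate E ori p x w / card E)"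
    by (simp add: nn_integral_count_space_finite sum_ennreal rate_bounds)
  then show "(\<integral>\<^sup>+w. ennreal (rate E ori p x w / card E) \<partial>count_space UNIV) = 1"
    by (simp add: sum_rate)
qed (rule rate_bounds)

definition start_pmf :: "'v profile \<Rightarrow> ('v profile \<times> 'v) pmf" where
  "start_pmf x = map_pmf (Pair x) (tag_pmf x)"

lemma size_biased_start: "size_biased (start_pmf x)"
  unfolding size_biased_def
proof (intro allI impI)
  fix x' :: "'v profile" and w :: 'v assume "x' \<in> fst ` set_pmf (start_pmf x)"
  then have x': "x' = x" by (auto simp: start_pmf_def)
  have "Pair x -` {z. snd z = w \<and> fst z = x} = {w}" "Pair x -` {z :: 'v profile \<times> 'v. fst z = x} = UNIV"
    by auto
  then show "\<P>(z in measure_pmf (start_pmf x). snd z = w \<bar> fst z = x') = rate E ori p x' w / real (card E)"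
    by (simp add: cond_prob_def x' start_pmf_def measure_pmf_single pmf_tag_pmf)
qed

lemma integral_start:
  assumes f: "f \<in> borel_measurable (process_law (start_pmf x) E)" and b: "\<And>\<omega>. \<bar>f \<omega> :: real\<bar> \<le> b"
  shows "(\<integral>\<omega>. f \<omega> \<partial>process_law (start_pmf x) E) =
    (\<Sum>v\<in>UNIV. rate E ori p x v / card E * (\<integral>d. f ((x, v), d) \<partial>driving_law E))"
proof -
  interpret pair_sigma_finite "measure_pmf (start_pmf x)" "driving_law E" ..
  interpret M: prob_space "process_law (start_pmf x) E" by (rule prob_space_process)
  have "integrable (process_law (start_pmf x) E) f"
    by (rule M.integrable_const_bound[where B = b, OF AE_I2 f]) (simp only: real_norm_def b)
  then have int: "integrable (measure_pmf (start_pmf x) \<Otimes>\<^sub>M driving_law E) f"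
    by (simp only: process_law_def)
  have "(\<integral>\<omega>. f \<omega> \<partial>process_law (start_pmf x) E) = (\<integral>z. (\<integral>d. f (z, d) \<partial>driving_law E) \<partial>measure_pmf (start_pmf x))"
    unfolding process_law_def by (rule integral_fst'[OF int, symmetric])
  also have "\<dots> = (\<integral>v. (\<integral>d. f ((x, v), d) \<partial>driving_law E) \<partial>measure_pmf (tag_pmf x))"
    by (simp add: start_pmf_def)
  also have "\<dots> = (\<Sum>v\<in>UNIV. (\<integral>d. f ((x, v), d) \<partial>driving_law E) * pmf (tag_pmf x) v)"
    by (rule integral_measure_pmf_real) simp_all
  finally show ?thesis by (simp add: pmf_tag_pmf mult.commute)
qed

text \<open>Starting at \<open>x\<close> with the size-biased tag turns the weighted sum over
  \<open>v\<close> into one expectation, to which \<open>integral_tag_at\<close> applies;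
  multiplying by \<open>card E\<close> restores the unnormalised rates.\<close>

lemma size_biased_identity:
  assumes F: "bounded (range (F :: 'v profile \<times> 'v \<Rightarrow> real))"
  shows "(\<Sum>v\<in>UNIV. rate E ori p x v *
      (\<integral>d. F (load_at E ori p x d t, tag_at E ori p x v d t) \<partial>driving_law E)) =
    (\<integral>d. (\<Sum>w\<in>UNIV. rate E ori p (load_at E ori p x d t) w * F (load_at E ori p x d t, w)) \<partial>driving_law E)"
proof -
  let ?m = "real (card E)" and ?M = "process_law (start_pmf x) E"
  obtain b where b: "\<bar>F y\<bar> \<le> b" for y
    using F by (auto simp: bounded_iff)
  have X: "(\<lambda>\<omega>. load_at E ori p (fst (fst \<omega>)) (snd \<omega>) t) \<in> ?M \<rightarrow>\<^sub>M count_space UNIV"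
    unfolding load_at_path by (rule measurable_compose[OF measurable_base_path measurable_profile_at])
  have "(\<lambda>\<omega>. F (y, tag_at E ori p (fst (fst \<omega>)) (snd (fst \<omega>)) (snd \<omega>) t)) \<in> borel_measurable ?M" for y
    by (rule measurable_compose[OF measurable_tag_at]) simp
  from measurable_compose_countable[OF this X]
  have 1: "(\<lambda>\<omega>. F (load_at E ori p (fst (fst \<omega>)) (snd \<omega>) t, tag_at E ori p (fst (fst \<omega>)) (snd (fst \<omega>)) (snd \<omega>) t))
      \<in> borel_measurable ?M" .
  have 2: "(\<lambda>\<omega>. \<Sum>w\<in>UNIV. rate E ori p (load_at E ori p (fst (fst \<omega>)) (snd \<omega>) t) w / card E *
       F (load_at E ori p (fst (fst \<omega>)) (snd \<omega>) t, w)) \<in> borel_measurable ?M"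
    by (rule measurable_compose[OF X]) simp
  have b2: "\<bar>\<Sum>w\<in>UNIV. rate E ori p y w / card E * F (y, w)\<bar> \<le> real CARD('v) * b" for y
  proof -
    have "\<bar>rate E ori p y w / card E * F (y, w)\<bar> \<le> 1 * b" for w
      unfolding abs_mult using rate_bounds[of y w] b by (intro mult_mono) auto
    then have "(\<Sum>w\<in>UNIV. \<bar>rate E ori p y w / card E * F (y, w)\<bar>) \<le> (\<Sum>w\<in>(UNIV :: 'v set). b)"
      by (intro sum_mono) simp
    then show ?thesis by (intro order_trans[OF sum_abs]) simp
  qed
  have "(\<Sum>v\<in>UNIV. rate E ori p x v *
      (\<integral>d. F (load_at E ori p x d t, tag_at E ori p x v d t) \<partial>driving_law E)) =
    ?m * (\<Sum>v\<in>UNIV. rate E ori p x v / ?m *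
      (\<integral>d. F (load_at E ori p x d t, tag_at E ori p x v d t) \<partial>driving_law E))"
    using edges_ne by (simp add: sum_distrib_left)
  also have "\<dots> = ?m * (\<Sum>v\<in>UNIV. rate E ori p x v / ?m * (\<integral>d. (\<Sum>w\<in>UNIV. rate E ori p (load_at E ori p x d t) w / ?m *
       F (load_at E ori p x d t, w)) \<partial>driving_law E))"
    using integral_tag_at[OF size_biased_start F, of x t] integral_start[OF 1 b] integral_start[OF 2 b2] by simp
  \<comment> \<open>The integral does not involve \<open>v\<close>, so the initial weights sum out
    to 1.\<close>
  also have "\<dots> = ?m * (\<integral>d. (\<Sum>w\<in>UNIV. rate E ori p (load_at E ori p x d t) w / ?m *
       F (load_at E ori p x d t, w)) \<partial>driving_law E)"
    unfolding sum_distrib_right[symmetric] sum_rate by simp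
  also have "\<dots> = (\<integral>d. ?m * (\<Sum>w\<in>UNIV. rate E ori p (load_at E ori p x d t) w / ?m *
       F (load_at E ori p x d t, w)) \<partial>driving_law E)"
    by simp
  also have "\<dots> = (\<integral>d. (\<Sum>w\<in>UNIV. rate E ori p (load_at E ori p x d t) w * F (load_at E ori p x d t, w)) \<partial>driving_law E)"
    using edges_ne by (simp add: sum_distrib_left del: integral_mult_right_zero)
  finally show ?thesis .
qed

end

theorem proposition3p1:
  fixes E :: "'v::finite set set"
    and ori :: "'v set \<Rightarrow> 'v \<times> 'v"
    and p :: "'v set \<Rightarrow> int \<Rightarrow> real"
    and \<nu> :: "('v profile \<times> 'v) pmf"
  assumes graph: "simple_graph E" "CARD('v) \<ge> 2" "card E \<ge> 1"
    and rule: "endpoint_local_monotone_rule E ori p"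
    and init: "\<And>x w. x \<in> fst ` set_pmf \<nu> \<Longrightarrow>
          \<P>(z in measure_pmf \<nu>. snd z = w \<bar> fst z = x) = rate E ori p x w / real (card E)"
  shows
    "(\<exists>(K :: 'v profile \<Rightarrow> 'v \<Rightarrow> 'v mark \<Rightarrow> 'v mark measure)
       (B :: 'v path \<Rightarrow> (nat \<Rightarrow> 'v mark) measure).
        \<comment> \<open>\<open>K x j\<close>: transition of the auxiliary process when \<open>j\<close> is selected at profile \<open>x\<close>\<close>
        (\<forall>x j. K x j \<in> mark_law E \<rightarrow>\<^sub>M prob_algebra (mark_law E) \<and>
               acts_as_cond_exp (mark_law E) (K x j) \<and>
               (mark_law E \<bind> K x j) = mark_law E \<and>
               (\<forall>e\<in>E. e \<inter> closed_nbhd E j = {} \<longrightarrow>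
                  (\<forall>U\<in>{0<..<1}. K x j (e, U) = return (mark_law E) (e, U)))) \<and>
        \<comment> \<open>\<open>B \<gamma>\<close>: law of the auxiliary process given the selected base path \<open>\<gamma>\<close>\<close>
        B \<in> path_space \<rightarrow>\<^sub>M prob_algebra (\<Pi>\<^sub>M h\<in>UNIV. mark_law E) \<and>
        (\<forall>\<gamma>. markov_chain_law (mark_law E) (mark_law E)
               (\<lambda>h. K (path_profile \<gamma> h) (path_selected \<gamma> h)) (B \<gamma>)) \<and>
        is_cond_law (process_law \<nu> E) (base_path E ori p) path_space
          (\<lambda>((x, v), d). tag E ori p x v d) (\<Pi>\<^sub>M h\<in>UNIV. count_space UNIV)
          (\<lambda>\<gamma>. distr (B \<gamma>) (\<Pi>\<^sub>M h\<in>UNIV. count_space UNIV)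
                  (\<lambda>b h. sel ori p (path_profile \<gamma> h) (b h))))
     \<and> (\<forall>t\<ge>0. \<forall>w. AE \<omega> in process_law \<nu> E.
          cond_prob_given (process_law \<nu> E) (base_path E ori p) path_space
            (\<lambda>((x, v), d). tag_at E ori p x v d t = w) \<omega>
          = (case \<omega> of ((x, v), d) \<Rightarrow> rate E ori p (load_at E ori p x d t) w / real (card E)))
     \<and> (\<forall>t\<ge>0. \<forall>x. \<forall>F :: 'v profile \<times> 'v \<Rightarrow> real. bounded (range F) \<longrightarrow>
          (\<Sum>v\<in>UNIV. rate E ori p x v *
             (\<integral>d. F (load_at E ori p x d t, tag_at E ori p x v d t) \<partial>driving_law E))
          = (\<integral>d. (\<Sum>w\<in>UNIV. rate E ori p (load_at E ori p x d t) w *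
                     F (load_at E ori p x d t, w)) \<partial>driving_law E))"
proof -
  have "E \<noteq> {}" using graph(3) by auto
  then interpret local_rule E ori p
    using graph(1) rule by unfold_locales
  have \<nu>: "size_biased \<nu>" using init by (simp add: size_biased_def)
  show ?thesis
  proof (intro conjI exI[of _ mark_kernel] exI[of _ aux_law] allI impI ballI)
    fix x j
    show "mark_kernel x j \<in> \<rho> \<rightarrow>\<^sub>M prob_algebra \<rho>"
      and "acts_as_cond_exp \<rho> (mark_kernel x j)"
      and "\<rho> \<bind> mark_kernel x j = \<rho>"
      by (rule mark.measurable_resample mark.acts_as_cond_exp_resample mark.bind_resample, rule chosen_sets)+
    show "mark_kernel x j (e, U) = return \<rho> (e, U)"
      if "e \<in> E" "e \<inter> closed_nbhd E j = {}" "U \<in> {0<..<1}" for e U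
      by (rule mark_kernel_local[OF that])
  next
    fix t :: real and w
    show "AE \<omega> in process_law \<nu> E.
          cond_prob_given (process_law \<nu> E) (base_path E ori p) path_space
            (\<lambda>((x, v), d). tag_at E ori p x v d t = w) \<omega>
          = (case \<omega> of ((x, v), d) \<Rightarrow> rate E ori p (load_at E ori p x d t) w / real (card E))"
      using cond_prob_tag_at[OF \<nu>, of t w] by (simp add: case_prod_beta)
  qed (rule measurable_aux_law markov_chain_aux_law size_biased_identity
        is_cond_law_tag[OF \<nu>, unfolded tag_kernel_def[abs_def]]; assumption)+
qed

end
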